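(* Let $\Bbbk$ be a field of characteristic zero and let $P_1,P_2\in\Bbbk[z]$ be monic polynomials of degrees $d_1,d_2$ with $P_1(0)=1=P_2(0)$ and $d_1d_2\ge4$. For every $m\ge1$ one has $Y_{D_m}=Y_m$ in $\mathbb{K}$, where $Y_m=F_{P_1}F_{P_2}\cdots F_{P_m}(Y)$ and $Y_{D_m}=\sum_\omega Y_{D_m}(\omega)$ is the sum, over all $(d_1,d_2)$-bounded compatible gradings $\omega$ of the maximal Dyck path $D_m$, of the associated non-commutative Laurent monomials.
   Context: $\mathbb{K}=\Bbbk(X,Y)$ is the skew-field of rational functions in two non-commuting variables (the free skew-field). For nonzero $P\in\Bbbk[z]$, $F_P$ is the automorphism of $\mathbb{K}$ with $F_P(X)=XYX^{-1}$, $F_P(Y)=P(Y)X^{-1}$; products of $F_P$'s are compositions. Write $P_i(z)=\sum_{j=0}^{d_i}p_{i,j}z^j$ and $\bar P_i(z)=z^{d_i}P_i(z^{-1})$ for $i=1,2$; for $k\in\mathbb{Z}$, $P_k$ is $\bar P_2,P_1,P_2,\bar P_1$ according to $k\equiv0,1,2,3$ modulo $4$. Maximal Dyck paths: for $\mathbf a=(a_1,a_2)\in\mathbb{Z}_{\ge0}^2$, $D_{\mathbf a}$ is the lattice path from $(0,0)$ to $(a_1,a_2)$ with unit East and North steps that never passes strictly above the main diagonal of $[0,a_1]\times[0,a_2]$ and is maximal with this property (every lattice point strictly above the path is strictly above the diagonal). Its edge set $E=H\sqcup V$ ($H$ horizontal, $V$ vertical edges) is labelled $1,\dots,a_1+a_2$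 in order along the path and is totally ordered accordingly. For edges $e\le e'$, $ee'$ is the subpath from $e$ to $e'$ inclusive; $(ee')_H,(ee')_V$ are its sets of horizontal and vertical edges and $|ee'|_H,|ee'|_V$ their cardinalities. A grading is a map $\omega:E\to\mathbb{Z}_{\ge0}$. It is compatible if for all $h\in H$, $v\in V$ with $h<v$ there is an edge $e$ of the path $hv$ such that at least one of the following holds: (HGC) $e\ne v$ and $|he|_V=\sum_{h'\in(he)_H}\omega(h')$; (VGC) $e\neq h$ and $|ev|_H=\sum_{v'\in(ev)_V}\omega(v')$. It is $(d_1,d_2)$-bounded if $\omega(h)\le d_1$ for $h\in H$ and $\omega(v)\le d_2$ for $v\in V$. Weights: for a $(d_1,d_2)$-bounded grading, $\mathrm{wt}_\omega(e)=p_{1,\omega(e)}Y^{\omega(e)}X^{-1}$ if $e\in H$ and $\mathrm{wt}_\omega(e)=p_{2,d_2-\omega(e)}X^{\omega(e)+1}Y^{-1}X^{-1}$ if $e\in V$; $Y_D(\omega)=\mathrm{wt}_\omega(1)\mathrm{wt}_\omega(2)\cdots\mathrm{wt}_\omega(a_1+a_2)$. $D_m=D_{\mathbf a_m}$ where $\mathbf a_0=(0,-1)$, $\mathbf a_1=(1,0)$ and $\mathbf a_{m-1}+\mathbf a_{m+1}=d_2\mathbf a_m$ for $m$ odd, $=d_1\mathbf a_m$ for $m$ even. *)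

theory Defs
  imports
    "HOL-Algebra.Ring"
    "HOL-Computational_Algebra.Polynomial"
    "HOL-Library.FuncSet"
begin

section \<open>The free skew-field\<close>

text \<open>
  The ambient skew-field is a type \<open>'a\<close> of class \<^class>\<open>division_ring\<close>.  It is made
  into an algebra over the ground field \<open>'k\<close> by a ring homomorphism \<open>\<kappa>\<close> with central image.
\<close>

definition scalar_embedding :: "('k::field \<Rightarrow> 'a::division_ring) \<Rightarrow> bool" where
  "scalar_embedding \<kappa> \<longleftrightarrow>
     \<kappa> 1 = 1 \<and> (\<forall>c d. \<kappa> (c + d) = \<kappa> c + \<kappa> d) \<and> (\<forall>c d. \<kappa> (c * d) = \<kappa> c * \<kappa> d) \<and>
     (\<forall>c u. \<kappa> c * u = u * \<kappa> c)"

definition sub_skew_field :: "'a::division_ring set \<Rightarrow> bool" where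
  "sub_skew_field S \<longleftrightarrow>
     1 \<in> S \<and> (\<forall>u\<in>S. \<forall>v\<in>S. u - v \<in> S) \<and> (\<forall>u\<in>S. \<forall>v\<in>S. u * v \<in> S) \<and>
     (\<forall>u\<in>S. inverse u \<in> S)"

text \<open>
  A competitor for the universal property: a skew-field \<open>L\<close> which is an algebra over \<open>'k\<close>
  (through \<open>l\<close>), with two chosen elements \<open>x\<close>, \<open>y\<close>.  This is the same as a homomorphism from
  the free algebra on two generators to a skew-field.
\<close>

definition two_pointed_skew_field ::
    "'b ring \<Rightarrow> ('k::field \<Rightarrow> 'b) \<Rightarrow> 'b \<Rightarrow> 'b \<Rightarrow> bool" where
  "two_pointed_skew_field L l x y \<longleftrightarrow>
     ring L \<and> Units L = carrier L - {\<zero>\<^bsub>L\<^esub>} \<and>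
     (\<forall>c. l c \<in> carrier L) \<and> l 1 = \<one>\<^bsub>L\<^esub> \<and>
     (\<forall>c d. l (c + d) = l c \<oplus>\<^bsub>L\<^esub> l d) \<and> (\<forall>c d. l (c * d) = l c \<otimes>\<^bsub>L\<^esub> l d) \<and>
     (\<forall>c. \<forall>u\<in>carrier L. l c \<otimes>\<^bsub>L\<^esub> u = u \<otimes>\<^bsub>L\<^esub> l c) \<and>
     x \<in> carrier L \<and> y \<in> carrier L"

text \<open>
  A specialization in the sense of P. M. Cohn: a homomorphism of algebras \<open>\<phi>\<close>, defined on a
  subring \<open>R\<close> containing the scalars, \<open>X\<close> and \<open>Y\<close>, such that every element of \<open>R\<close> outside the
  kernel of \<open>\<phi>\<close> is invertible in \<open>R\<close>.
\<close>

definition specialization ::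
    "('k::field \<Rightarrow> 'a::division_ring) \<Rightarrow> 'a \<Rightarrow> 'a \<Rightarrow>
     'b ring \<Rightarrow> ('k \<Rightarrow> 'b) \<Rightarrow> 'b \<Rightarrow> 'b \<Rightarrow> 'a set \<Rightarrow> ('a \<Rightarrow> 'b) \<Rightarrow> bool" where
  "specialization \<kappa> X Y L l x y R \<phi> \<longleftrightarrow>
     range \<kappa> \<subseteq> R \<and> X \<in> R \<and> Y \<in> R \<and>
     (\<forall>u\<in>R. \<forall>v\<in>R. u - v \<in> R) \<and> (\<forall>u\<in>R. \<forall>v\<in>R. u * v \<in> R) \<and>
     \<phi> ` R \<subseteq> carrier L \<and>
     (\<forall>u\<in>R. \<forall>v\<in>R. \<phi> (u + v) = \<phi> u \<oplus>\<^bsub>L\<^esub> \<phi> v) \<and>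
     (\<forall>u\<in>R. \<forall>v\<in>R. \<phi> (u * v) = \<phi> u \<otimes>\<^bsub>L\<^esub> \<phi> v) \<and>
     (\<forall>c. \<phi> (\<kappa> c) = l c) \<and> \<phi> X = x \<and> \<phi> Y = y \<and>
     (\<forall>u\<in>R. \<phi> u \<noteq> \<zero>\<^bsub>L\<^esub> \<longrightarrow> inverse u \<in> R)"

text \<open>
  The free skew-field on \<open>X\<close>, \<open>Y\<close> is the universal field of fractions of the free algebra: it is
  generated by the scalars, \<open>X\<close> and \<open>Y\<close>, and it specializes to every skew-field with two chosen
  elements.  (Hence \<open>X\<close>, \<open>Y\<close> generate a free subalgebra, as the free algebra embeds in some
  skew-field.)  It suffices to let the competitors range over ring structures on subsets of \<open>'a\<close>:
  only the sub-skew-field of \<open>L\<close> generated by \<open>x\<close>, \<open>y\<close> and the scalars matters, and for infinite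
  \<open>'k\<close> its cardinality is at most that of \<open>'k\<close>, hence at most that of \<open>'a\<close>.
\<close>

definition free_skew_field :: "('k::field \<Rightarrow> 'a::division_ring) \<Rightarrow> 'a \<Rightarrow> 'a \<Rightarrow> bool" where
  "free_skew_field \<kappa> X Y \<longleftrightarrow>
     scalar_embedding \<kappa> \<and>
     (\<forall>S. sub_skew_field S \<and> range \<kappa> \<subseteq> S \<and> X \<in> S \<and> Y \<in> S \<longrightarrow> S = UNIV) \<and>
     (\<forall>(L :: 'a ring) l x y. two_pointed_skew_field L l x y \<longrightarrow>
        (\<exists>R \<phi>. specialization \<kappa> X Y L l x y R \<phi>))"


section \<open>The automorphisms and the elements \<open>Y\<^sub>m\<close>\<close>

definition poly_at :: "('k::field \<Rightarrow> 'a::division_ring) \<Rightarrow> 'k poly \<Rightarrow> 'a \<Rightarrow> 'a" where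
  "poly_at \<kappa> P u = (\<Sum>j\<le>degree P. \<kappa> (coeff P j) * u ^ j)"

definition algebra_automorphism ::
    "('k::field \<Rightarrow> 'a::division_ring) \<Rightarrow> ('a \<Rightarrow> 'a) \<Rightarrow> bool" where
  "algebra_automorphism \<kappa> f \<longleftrightarrow>
     bij f \<and> (\<forall>u v. f (u + v) = f u + f v) \<and> (\<forall>u v. f (u * v) = f u * f v) \<and>
     (\<forall>c. f (\<kappa> c) = \<kappa> c)"

definition aut_F ::
    "('k::field \<Rightarrow> 'a::division_ring) \<Rightarrow> 'a \<Rightarrow> 'a \<Rightarrow> 'k poly \<Rightarrow> 'a \<Rightarrow> 'a" where
  "aut_F \<kappa> X Y P =
     (THE f. algebra_automorphism \<kappa> f \<and>
             f X = X * Y * inverse X \<and> f Y = poly_at \<kappa> P Y * inverse X)"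

subsection \<open>Existence and uniqueness of the automorphisms\<close>

text \<open>The skew-field itself as a competitor in its universal property.\<close>

definition self_ring :: "'a::division_ring ring" where
  "self_ring = \<lparr>carrier = UNIV, monoid.mult = (*), one = 1, zero = 0, add = (+)\<rparr>"

lemma scalar_rules:
  assumes "scalar_embedding \<kappa>"
  shows "\<kappa> 1 = 1" "\<kappa> (c + d) = \<kappa> c + \<kappa> d" "\<kappa> (c * d) = \<kappa> c * \<kappa> d" "\<kappa> c * u = u * \<kappa> c"
  using assms unfolding scalar_embedding_def by blast+

lemma two_pointed_self:
  fixes \<kappa> :: "'k::field \<Rightarrow> 'a::division_ring"
  assumes "scalar_embedding \<kappa>"
  shows "two_pointed_skew_field self_ring \<kappa> x y"
proof -
  have "\<exists>v::'a. v + u = 0" for u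
    by (rule exI[of _ "- u"]) simp
  hence "abelian_group (self_ring :: 'a ring)"
    by (intro abelian_groupI) (simp_all add: self_ring_def add.assoc add.commute)
  moreover have "monoid (self_ring :: 'a ring)"
    by (intro monoidI) (simp_all add: self_ring_def mult.assoc)
  ultimately have "ring (self_ring :: 'a ring)"
    by (intro ringI) (simp_all add: self_ring_def distrib_left distrib_right)
  moreover have "(\<exists>v. v * u = 1 \<and> u * v = 1) \<longleftrightarrow> u \<noteq> 0" for u :: 'a
    by (metis left_inverse right_inverse mult_zero_left zero_neq_one)
  hence "Units (self_ring :: 'a ring) = carrier self_ring - {\<zero>\<^bsub>self_ring\<^esub>}"
    unfolding Units_def self_ring_def by auto
  ultimately show ?thesis
    unfolding two_pointed_skew_field_def
    by (intro conjI allI ballI)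
       (assumption | rule scalar_rules(4)[OF assms] |
        simp add: self_ring_def scalar_rules(1-3)[OF assms])+
qed

lemma scalar_zero:
  assumes "scalar_embedding \<kappa>" shows "\<kappa> 0 = 0"
proof -
  have "\<kappa> (0 + 0) = \<kappa> 0 + \<kappa> 0" using assms unfolding scalar_embedding_def by blast
  thus ?thesis by simp
qed

lemma free_skew_field_specialization:
  fixes \<kappa> :: "'k::field \<Rightarrow> 'b::division_ring"
  assumes "free_skew_field \<kappa> X Y"
  obtains R \<phi> where "specialization \<kappa> X Y self_ring \<kappa> x y R \<phi>"
proof -
  have se: "scalar_embedding \<kappa>" using assms by (simp only: free_skew_field_def)
  have "\<forall>(L :: 'b ring) l x y. two_pointed_skew_field L l x y \<longrightarrow>
        (\<exists>R \<phi>. specialization \<kappa> X Y L l x y R \<phi>)"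
    using assms unfolding free_skew_field_def by (elim conjE)
  from this[rule_format, OF two_pointed_self[OF se]] show ?thesis
    using that by blast
qed

lemma specialization_closed:
  assumes se: "scalar_embedding \<kappa>"
    and 1: "specialization \<kappa> X Y self_ring \<kappa> x y R \<phi>"
  shows "\<kappa> c \<in> R" "\<phi> (\<kappa> c) = \<kappa> c" "X \<in> R" "Y \<in> R" "\<phi> X = x" "\<phi> Y = y"
    "u \<in> R \<Longrightarrow> v \<in> R \<Longrightarrow> u - v \<in> R" "u \<in> R \<Longrightarrow> v \<in> R \<Longrightarrow> \<phi> (u - v) = \<phi> u - \<phi> v"
    "u \<in> R \<Longrightarrow> v \<in> R \<Longrightarrow> u + v \<in> R" "u \<in> R \<Longrightarrow> v \<in> R \<Longrightarrow> u * v \<in> R"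
    "u \<in> R \<Longrightarrow> v \<in> R \<Longrightarrow> \<phi> (u + v) = \<phi> u + \<phi> v"
    "u \<in> R \<Longrightarrow> v \<in> R \<Longrightarrow> \<phi> (u * v) = \<phi> u * \<phi> v"
    "u \<in> R \<Longrightarrow> \<phi> u \<noteq> 0 \<Longrightarrow> inverse u \<in> R"
    "u \<in> R \<Longrightarrow> \<phi> u \<noteq> 0 \<Longrightarrow> \<phi> (inverse u) = inverse (\<phi> u)"
    "\<phi> 0 = 0" "\<phi> 1 = 1" "0 \<in> R" "1 \<in> R"
proof -
  have k1: "\<kappa> 1 = 1" using scalar_rules(1)[OF se] .
  have k0: "\<kappa> 0 = 0" using scalar_zero[OF se] .
  have s:
      "range \<kappa> \<subseteq> R" "X \<in> R" "Y \<in> R"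
      "\<forall>u\<in>R. \<forall>v\<in>R. u - v \<in> R" "\<forall>u\<in>R. \<forall>v\<in>R. u * v \<in> R"
      "\<forall>u\<in>R. \<forall>v\<in>R. \<phi> (u + v) = \<phi> u + \<phi> v"
      "\<forall>u\<in>R. \<forall>v\<in>R. \<phi> (u * v) = \<phi> u * \<phi> v"
      "\<forall>c. \<phi> (\<kappa> c) = \<kappa> c" "\<phi> X = x" "\<phi> Y = y" "\<forall>u\<in>R. \<phi> u \<noteq> 0 \<longrightarrow> inverse u \<in> R"
    using 1 unfolding specialization_def self_ring_def ring.simps monoid.simps by simp_all
  show "\<kappa> c \<in> R" "\<phi> (\<kappa> c) = \<kappa> c" for c using s(1,8) by auto
  show "X \<in> R" "Y \<in> R" "\<phi> X = x" "\<phi> Y = y" using s(2,3,9,10) by simp_all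
  have r: "\<kappa> 0 \<in> R" "\<kappa> 1 \<in> R" using s(1) by auto
  show z: "\<phi> 0 = 0" "\<phi> 1 = 1" "0 \<in> R" "1 \<in> R"
    using r s(8)[rule_format, of 0] s(8)[rule_format, of 1] by (simp_all add: k0 k1)
  show sm: "u - v \<in> R" if "u \<in> R" "v \<in> R" for u v using s(4) that by simp
  show "\<phi> (u - v) = \<phi> u - \<phi> v" if "u \<in> R" "v \<in> R" for u v
    using s(6)[rule_format, OF sm[OF that] that(2)] by simp
  show "u + v \<in> R" if "u \<in> R" "v \<in> R" for u v
    using sm[OF that(1) sm[OF z(3) that(2)]] by simp
  show m: "u * v \<in> R" if "u \<in> R" "v \<in> R" for u v using s(5) that by simp
  show "\<phi> (u + v) = \<phi> u + \<phi> v" if "u \<in> R" "v \<in> R" for u v using s(6) that by simp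
  show pm: "\<phi> (u * v) = \<phi> u * \<phi> v" if "u \<in> R" "v \<in> R" for u v using s(7) that by simp
  show i: "inverse u \<in> R" if "u \<in> R" "\<phi> u \<noteq> 0" for u using s(11) that by simp
  show "\<phi> (inverse u) = inverse (\<phi> u)" if "u \<in> R" "\<phi> u \<noteq> 0" for u
  proof -
    have "u \<noteq> 0" using that z by auto
    hence "\<phi> u * \<phi> (inverse u) = 1" using pm[OF that(1) i[OF that]] z(2) by simp
    thus ?thesis by (simp add: inverse_unique)
  qed
qed

text \<open>A specialization to the skew-field itself that is undone by another one is an automorphism.\<close>

lemma specialization_fixed:
  assumes K: "free_skew_field \<kappa> X Y"
    and 1: "specialization \<kappa> X Y self_ring \<kappa> X1 Y1 R1 \<phi>"
    and 2: "specialization \<kappa> X Y self_ring \<kappa> X2 Y2 R2 \<psi>"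
    and XY: "X1 \<in> R2" "Y1 \<in> R2" "\<psi> X1 = X" "\<psi> Y1 = Y"
  shows "R1 = UNIV \<and> (\<forall>u. \<psi> (\<phi> u) = u)"
proof -
  have se: "scalar_embedding \<kappa>" using K by (simp add: free_skew_field_def)
  note c1 = specialization_closed[OF se 1]
  note c2 = specialization_closed[OF se 2]
  define S where "S = {u \<in> R1. \<phi> u \<in> R2 \<and> \<psi> (\<phi> u) = u}"
  have inv: "inverse u \<in> S" if "u \<in> S" for u
  proof (cases "u = 0")
    case True
    thus ?thesis using that by simp
  next
    case False
    hence "\<psi> (\<phi> u) \<noteq> 0" "\<phi> u \<noteq> 0" using that c2(15) by (auto simp: S_def)
    thus ?thesis using that by (simp add: S_def c1 c2)
  qed
  have "sub_skew_field S"
    unfolding sub_skew_field_def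
  proof (intro conjI ballI inv)
    show "1 \<in> S" by (simp add: S_def c1 c2)
    fix u v assume "u \<in> S" "v \<in> S"
    thus "u - v \<in> S" "u * v \<in> S" by (simp_all add: S_def c1 c2)
  qed
  moreover have "range \<kappa> \<subseteq> S" "X \<in> S" "Y \<in> S"
    using XY by (auto simp: S_def c1 c2)
  ultimately have "S = UNIV" using K unfolding free_skew_field_def by blast
  thus ?thesis by (auto simp: S_def)
qed

lemma specialization_poly_at:
  assumes se: "scalar_embedding \<kappa>"
    and 1: "specialization \<kappa> X Y self_ring \<kappa> x y R \<phi>" and u: "u \<in> R"
  shows "poly_at \<kappa> P u \<in> R" "\<phi> (poly_at \<kappa> P u) = poly_at \<kappa> P (\<phi> u)"
proof -
  note c = specialization_closed[OF se 1]
  have pw: "u ^ n \<in> R \<and> \<phi> (u ^ n) = \<phi> u ^ n" for n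
    by (induction n) (auto simp: c u)
  have s: "(\<Sum>j\<le>n. \<kappa> (f j) * u ^ j) \<in> R \<and>
        \<phi> (\<Sum>j\<le>n. \<kappa> (f j) * u ^ j) = (\<Sum>j\<le>n. \<kappa> (f j) * \<phi> u ^ j)" for n f
    by (induction n) (simp_all add: c pw u del: power_Suc)
  show "poly_at \<kappa> P u \<in> R" "\<phi> (poly_at \<kappa> P u) = poly_at \<kappa> P (\<phi> u)"
    using s unfolding poly_at_def by auto
qed

lemma poly_at_scalar:
  assumes "scalar_embedding \<kappa>"
  shows "poly_at \<kappa> P (\<kappa> c) = \<kappa> (poly P c)"
proof -
  have k: "\<kappa> 1 = 1" "\<kappa> (a + b) = \<kappa> a + \<kappa> b" "\<kappa> (a * b) = \<kappa> a * \<kappa> b" for a b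
    using assms unfolding scalar_embedding_def by blast+
  have pw: "\<kappa> (c ^ n) = \<kappa> c ^ n" for n by (induction n) (simp_all add: k)
  have "\<kappa> (\<Sum>j\<le>n. f j * c ^ j) = (\<Sum>j\<le>n. \<kappa> (f j) * \<kappa> c ^ j)" for n f
    by (induction n) (simp_all add: k pw)
  thus ?thesis by (simp add: poly_at_def poly_altdef)
qed

lemma poly_at_conj:
  assumes "scalar_embedding \<kappa>" and t: "(t::'a::division_ring) \<noteq> 0"
  shows "poly_at \<kappa> P (t * u * inverse t) = t * poly_at \<kappa> P u * inverse t"
proof -
  have c: "\<kappa> a * v = v * \<kappa> a" for a v using scalar_rules(4)[OF assms(1)] .
  have pw: "(t * u * inverse t) ^ n = t * u ^ n * inverse t" for n
  proof (induction n)
    case (Suc n)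
    have "(t * u * inverse t) ^ Suc n = (t * u * inverse t) * (t * u ^ n * inverse t)"
      by (simp only: power_Suc Suc)
    also have "\<dots> = t * u * (inverse t * t) * u ^ n * inverse t"
      by (simp only: mult.assoc)
    finally show ?case using t by (simp add: mult.assoc)
  qed (use t in simp)
  have "\<kappa> a * (t * v * inverse t) = t * (\<kappa> a * v) * inverse t" for a v
  proof -
    have "\<kappa> a * (t * v * inverse t) = \<kappa> a * t * v * inverse t" by (simp only: mult.assoc)
    also have "\<kappa> a * t = t * \<kappa> a" by (rule c)
    finally show ?thesis by (simp only: mult.assoc)
  qed
  thus ?thesis
    by (simp add: poly_at_def pw sum_distrib_left sum_distrib_right)
qed

lemma free_nonzero:
  fixes \<kappa> :: "'k::field_char_0 \<Rightarrow> 'a::division_ring"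
  assumes K: "free_skew_field \<kappa> X Y"
  shows "X \<noteq> 0" "Y \<noteq> 0" and "P \<noteq> 0 \<Longrightarrow> poly_at \<kappa> P X \<noteq> 0" "P \<noteq> 0 \<Longrightarrow> poly_at \<kappa> P Y \<noteq> 0"
proof -
  have se: "scalar_embedding \<kappa>" using K by (simp add: free_skew_field_def)
  have k1: "\<kappa> 1 = 1" using scalar_rules(1)[OF se] .
  have knz: "\<kappa> c \<noteq> 0" if "c \<noteq> 0" for c
  proof
    assume "\<kappa> c = 0"
    hence "\<kappa> (c * inverse c) = 0" using scalar_rules(3)[OF se, of c] by simp
    thus False using that k1 by simp
  qed
  have *: "poly_at \<kappa> P X \<noteq> 0 \<and> poly_at \<kappa> P Y \<noteq> 0" if "P \<noteq> 0" for P
  proof -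
    have "finite {c. poly P c = 0}" using that poly_roots_finite by blast
    hence "{c. poly P c = 0} \<noteq> UNIV" using infinite_UNIV_char_0[where ?'a = 'k] by metis
    then obtain c where c: "poly P c \<noteq> 0" by auto
    obtain R \<phi> where s: "specialization \<kappa> X Y self_ring \<kappa> (\<kappa> c) (\<kappa> c) R \<phi>"
      using free_skew_field_specialization[OF K] .
    note cl = specialization_closed[OF se s]
    have "\<phi> (poly_at \<kappa> P X) \<noteq> 0" "\<phi> (poly_at \<kappa> P Y) \<noteq> 0"
      using specialization_poly_at[OF se s] cl(3-6) poly_at_scalar[OF se] knz[OF c] by simp_all
    thus ?thesis using cl(15) by metis
  qed
  thus "P \<noteq> 0 \<Longrightarrow> poly_at \<kappa> P X \<noteq> 0" "P \<noteq> 0 \<Longrightarrow> poly_at \<kappa> P Y \<noteq> 0" by auto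
  have "poly_at \<kappa> [:0, 1:] u = u" for u using scalar_zero[OF se] k1 by (simp add: poly_at_def)
  thus "X \<noteq> 0" "Y \<noteq> 0" using *[of "[:0, 1:]"] by auto
qed

lemma automorphism_unique:
  assumes K: "free_skew_field \<kappa> X Y"
    and f: "algebra_automorphism \<kappa> f" and g: "algebra_automorphism \<kappa> g"
    and XY: "f X = g X" "f Y = g Y"
  shows "f = g"
proof -
  have k1: "\<kappa> 1 = 1" 
    using K scalar_rules(1)[of \<kappa>] by (simp add: free_skew_field_def)
  have d: "h (u - v) = h u - h v" "h (inverse u) = inverse (h u)" "h 1 = 1"
    if "algebra_automorphism \<kappa> h" for h u v
  proof -
    have h: "h (u + v) = h u + h v" "h (u * v) = h u * h v" "h (\<kappa> c) = \<kappa> c" for u v c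
      using that by (simp_all add: algebra_automorphism_def)
    show *: "h (u - v) = h u - h v" for u v using h(1)[of "u - v" v] by simp
    show **: "h 1 = 1" using h(3)[of 1] k1 by simp
    have z: "h 0 = 0" using *[of 0 0] by simp
    show "h (inverse u) = inverse (h u)"
    proof (cases "u = 0")
      case False
      hence "h u * h (inverse u) = 1" using h(2)[of u "inverse u"] ** by simp
      thus ?thesis by (simp add: inverse_unique)
    qed (use z in simp)
  qed
  have "sub_skew_field {u. f u = g u}"
    unfolding sub_skew_field_def
  proof (intro conjI ballI)
    fix u v assume "u \<in> {u. f u = g u}" "v \<in> {u. f u = g u}"
    thus "u * v \<in> {u. f u = g u}" using f g by (simp add: algebra_automorphism_def)
  qed (simp_all add: d[OF f] d[OF g])
  moreover have "range \<kappa> \<subseteq> {u. f u = g u}" using f g by (auto simp: algebra_automorphism_def)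
  moreover have "\<forall>S. sub_skew_field S \<and> range \<kappa> \<subseteq> S \<and> X \<in> S \<and> Y \<in> S \<longrightarrow> S = UNIV"
    using K unfolding free_skew_field_def by (elim conjE)
  ultimately have "{u. f u = g u} = UNIV" using XY by blast
  thus ?thesis by auto
qed

theorem aut_F_properties:
  fixes \<kappa> :: "'k::field_char_0 \<Rightarrow> 'a::division_ring"
  assumes K: "free_skew_field \<kappa> X Y" and P: "P \<noteq> 0"
  shows "algebra_automorphism \<kappa> (aut_F \<kappa> X Y P)"
    and "aut_F \<kappa> X Y P X = X * Y * inverse X"
    and "aut_F \<kappa> X Y P Y = poly_at \<kappa> P Y * inverse X"
proof -
  have se: "scalar_embedding \<kappa>" using K by (simp add: free_skew_field_def)
  note nz = free_nonzero(1,2)[OF K] free_nonzero(3,4)[OF K P]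
  define X1 where "X1 = X * Y * inverse X"
  define Y1 where "Y1 = poly_at \<kappa> P Y * inverse X"
  define X2 where "X2 = poly_at \<kappa> P X * inverse Y"
  define Y2 where "Y2 = inverse X2 * X * X2"
  have nz': "X1 \<noteq> 0" "Y1 \<noteq> 0" "X2 \<noteq> 0" "Y2 \<noteq> 0"
    using nz by (auto simp: X1_def Y1_def X2_def Y2_def)
  obtain R1 \<phi> where s1: "specialization \<kappa> X Y self_ring \<kappa> X1 Y1 R1 \<phi>"
    using free_skew_field_specialization[OF K] .
  obtain R2 \<psi> where s2: "specialization \<kappa> X Y self_ring \<kappa> X2 Y2 R2 \<psi>"
    using free_skew_field_specialization[OF K] .
  note c1 = specialization_closed[OF se s1] specialization_poly_at[OF se s1]
  note c2 = specialization_closed[OF se s2] specialization_poly_at[OF se s2]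
  have m2: "X1 \<in> R2" "Y1 \<in> R2"
    unfolding X1_def Y1_def by (intro c2; simp add: c2 nz')+
  have m1: "X2 \<in> R1"
    unfolding X2_def by (intro c1; simp add: c1 nz')+
  have PX1: "poly_at \<kappa> P X1 = X * poly_at \<kappa> P Y * inverse X"
    unfolding X1_def using poly_at_conj[OF se nz(1)] by simp
  have PY2: "poly_at \<kappa> P Y2 = inverse X2 * poly_at \<kappa> P X * X2"
    unfolding Y2_def using poly_at_conj[OF se, of "inverse X2" P X] nz' by simp
  have iY1: "inverse Y1 = X * inverse (poly_at \<kappa> P Y)"
    unfolding Y1_def using nz by (simp add: nonzero_inverse_mult_distrib)
  have iX2: "inverse X2 = Y * inverse (poly_at \<kappa> P X)"
    unfolding X2_def using nz by (simp add: nonzero_inverse_mult_distrib)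
  have cancel: "a * (inverse a * b) = b" "inverse a * (a * b) = b"
    if "a \<noteq> 0" for a b :: 'a
    using that by (simp_all flip: mult.assoc)
  have "\<phi> X2 = poly_at \<kappa> P X1 * inverse Y1"
    unfolding X2_def by (subst c1, (simp add: c1 nz')+)
  hence v1: "\<phi> X2 = X"
    using nz by (simp add: PX1 iY1 mult.assoc cancel)
  have m1': "Y2 \<in> R1"
    unfolding Y2_def using m1 v1 nz by (simp add: c1)
  have v1': "\<phi> Y2 = Y"
    unfolding Y2_def using m1 v1 nz by (simp add: c1 X1_def mult.assoc cancel)
  have "\<psi> X1 = X2 * Y2 * inverse X2"
    unfolding X1_def using nz' by (simp add: c2)
  hence v2: "\<psi> X1 = X" using nz' by (simp add: Y2_def mult.assoc cancel)
  have "\<psi> Y1 = poly_at \<kappa> P Y2 * inverse X2"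
    unfolding Y1_def using nz' by (simp add: c2)
  hence v2': "\<psi> Y1 = Y" using nz nz' by (simp add: PY2 mult.assoc) (simp add: iX2 mult.assoc)
  have A: "R1 = UNIV" "\<psi> (\<phi> u) = u" for u
    using specialization_fixed[OF K s1 s2 m2 v2 v2'] by auto
  have B: "\<phi> (\<psi> u) = u" for u
    using specialization_fixed[OF K s2 s1 m1 m1' v1 v1'] by auto
  have "bij \<phi>" using A(2) B by (intro o_bij[of \<psi>]) auto
  hence ex: "algebra_automorphism \<kappa> \<phi>"
    unfolding algebra_automorphism_def by (simp add: c1(2,11,12) A(1))
  have "\<exists>!f. algebra_automorphism \<kappa> f \<and>
             f X = X * Y * inverse X \<and> f Y = poly_at \<kappa> P Y * inverse X"
  proof (rule ex1I[of _ \<phi>])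
    show "algebra_automorphism \<kappa> \<phi> \<and> \<phi> X = X * Y * inverse X \<and> \<phi> Y = poly_at \<kappa> P Y * inverse X"
      using ex c1 by (simp add: X1_def Y1_def)
  next
    fix f
    assume f: "algebra_automorphism \<kappa> f \<and>
             f X = X * Y * inverse X \<and> f Y = poly_at \<kappa> P Y * inverse X"
    show "f = \<phi>"
      using automorphism_unique[OF K, of f \<phi>] f ex c1(5,6) by (simp add: X1_def Y1_def)
  qed
  from theI'[OF this] show "algebra_automorphism \<kappa> (aut_F \<kappa> X Y P)"
    and "aut_F \<kappa> X Y P X = X * Y * inverse X"
    and "aut_F \<kappa> X Y P Y = poly_at \<kappa> P Y * inverse X"
    unfolding aut_F_def by auto
qed


subsection \<open>The elements \<open>Y\<^sub>m\<close>\<close>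

definition P_seq :: "'k::field poly \<Rightarrow> 'k poly \<Rightarrow> int \<Rightarrow> 'k poly" where
  "P_seq P1 P2 k =
     (if k mod 4 = 0 then reflect_poly P2
      else if k mod 4 = 1 then P1
      else if k mod 4 = 2 then P2
      else reflect_poly P1)"

definition Y_elem ::
    "('k::field \<Rightarrow> 'a::division_ring) \<Rightarrow> 'a \<Rightarrow> 'a \<Rightarrow> 'k poly \<Rightarrow> 'k poly \<Rightarrow> nat \<Rightarrow> 'a" where
  "Y_elem \<kappa> X Y P1 P2 m = foldr (\<lambda>k. aut_F \<kappa> X Y (P_seq P1 P2 k)) [1..int m] Y"


section \<open>Maximal Dyck paths\<close>

datatype step = East | North

definition path_x :: "step list \<Rightarrow> nat \<Rightarrow> nat" where
  "path_x w i = count_list (take i w) East"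

definition path_y :: "step list \<Rightarrow> nat \<Rightarrow> nat" where
  "path_y w i = count_list (take i w) North"

definition above_diagonal :: "nat \<Rightarrow> nat \<Rightarrow> nat \<Rightarrow> nat \<Rightarrow> bool" where
  "above_diagonal a1 a2 x y \<longleftrightarrow> y * a1 > x * a2"

definition above_path :: "step list \<Rightarrow> nat \<Rightarrow> nat \<Rightarrow> bool" where
  "above_path w x y \<longleftrightarrow> (\<forall>i\<le>length w. path_x w i = x \<longrightarrow> path_y w i < y)"

definition is_maximal_dyck_path :: "nat \<Rightarrow> nat \<Rightarrow> step list \<Rightarrow> bool" where
  "is_maximal_dyck_path a1 a2 w \<longleftrightarrow>
     count_list w East = a1 \<and> count_list w North = a2 \<and>
     (\<forall>i\<le>length w. \<not> above_diagonal a1 a2 (path_x w i) (path_y w i)) \<and>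
     (\<forall>x\<le>a1. \<forall>y\<le>a2. above_path w x y \<longrightarrow> above_diagonal a1 a2 x y)"

definition dyck_path :: "nat \<Rightarrow> nat \<Rightarrow> step list" where
  "dyck_path a1 a2 = (THE w. is_maximal_dyck_path a1 a2 w)"

text \<open>Edges are numbered from 1, so edge \<open>e\<close> is the list entry at position \<open>e - 1\<close>.\<close>

definition edges :: "step list \<Rightarrow> nat set" where
  "edges w = {1..length w}"

definition H_edges :: "step list \<Rightarrow> nat set" where
  "H_edges w = {e \<in> edges w. w ! (e - 1) = East}"

definition V_edges :: "step list \<Rightarrow> nat set" where
  "V_edges w = {e \<in> edges w. w ! (e - 1) = North}"


section \<open>Compatible gradings and their weights\<close>

definition compatible :: "step list \<Rightarrow> (nat \<Rightarrow> nat) \<Rightarrow> bool" where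
  "compatible w \<omega> \<longleftrightarrow>
     (\<forall>h\<in>H_edges w. \<forall>v\<in>V_edges w. h < v \<longrightarrow>
        (\<exists>e\<in>{h..v}.
           e \<noteq> v \<and> card ({h..e} \<inter> V_edges w) = (\<Sum>h'\<in>{h..e} \<inter> H_edges w. \<omega> h') \<or>
           e \<noteq> h \<and> card ({e..v} \<inter> H_edges w) = (\<Sum>v'\<in>{e..v} \<inter> V_edges w. \<omega> v')))"

definition bounded_grading :: "nat \<Rightarrow> nat \<Rightarrow> step list \<Rightarrow> (nat \<Rightarrow> nat) \<Rightarrow> bool" where
  "bounded_grading d1 d2 w \<omega> \<longleftrightarrow>
     (\<forall>h\<in>H_edges w. \<omega> h \<le> d1) \<and> (\<forall>v\<in>V_edges w. \<omega> v \<le> d2)"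

text \<open>Gradings are extensional functions on the edge set, so that each one is counted once.\<close>

definition gradings :: "nat \<Rightarrow> nat \<Rightarrow> step list \<Rightarrow> (nat \<Rightarrow> nat) set" where
  "gradings d1 d2 w =
     {\<omega> \<in> edges w \<rightarrow>\<^sub>E UNIV. bounded_grading d1 d2 w \<omega> \<and> compatible w \<omega>}"

lemma finite_gradings: "finite (gradings d1 d2 w)"
proof (rule finite_subset)
  show "gradings d1 d2 w \<subseteq> edges w \<rightarrow>\<^sub>E {..max d1 d2}"
  proof
    fix \<omega> assume w: "\<omega> \<in> gradings d1 d2 w"
    have "\<omega> e \<le> max d1 d2" if "e \<in> edges w" for e
      using w that unfolding gradings_def bounded_grading_def H_edges_def V_edges_def
      by (cases "w ! (e - 1)") (auto simp: le_max_iff_disj)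
    thus "\<omega> \<in> edges w \<rightarrow>\<^sub>E {..max d1 d2}"
      using w by (auto simp: gradings_def PiE_def)
  qed
  show "finite (edges w \<rightarrow>\<^sub>E {..max d1 d2})"
    by (rule finite_PiE) (auto simp: edges_def)
qed

definition wt ::
    "('k::field \<Rightarrow> 'a::division_ring) \<Rightarrow> 'a \<Rightarrow> 'a \<Rightarrow> 'k poly \<Rightarrow> 'k poly \<Rightarrow>
     step list \<Rightarrow> (nat \<Rightarrow> nat) \<Rightarrow> nat \<Rightarrow> 'a" where
  "wt \<kappa> X Y P1 P2 w \<omega> e =
     (if e \<in> H_edges w
      then \<kappa> (coeff P1 (\<omega> e)) * Y ^ \<omega> e * inverse X
      else \<kappa> (coeff P2 (degree P2 - \<omega> e)) * X ^ (\<omega> e + 1) * inverse Y * inverse X)"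

definition Y_dyck ::
    "('k::field \<Rightarrow> 'a::division_ring) \<Rightarrow> 'a \<Rightarrow> 'a \<Rightarrow> 'k poly \<Rightarrow> 'k poly \<Rightarrow> step list \<Rightarrow> 'a" where
  "Y_dyck \<kappa> X Y P1 P2 w =
     (\<Sum>\<omega>\<in>gradings (degree P1) (degree P2) w.
        prod_list (map (wt \<kappa> X Y P1 P2 w \<omega>) [1..<length w + 1]))"

fun a_vec :: "nat \<Rightarrow> nat \<Rightarrow> nat \<Rightarrow> int \<times> int" where
  "a_vec d1 d2 0 = (0, -1)"
| "a_vec d1 d2 (Suc 0) = (1, 0)"
| "a_vec d1 d2 (Suc (Suc n)) =
     (let d = int (if odd (Suc n) then d2 else d1)
      in (d * fst (a_vec d1 d2 (Suc n)) - fst (a_vec d1 d2 n),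
          d * snd (a_vec d1 d2 (Suc n)) - snd (a_vec d1 d2 n)))"

text \<open>
  For \<open>m \<ge> 1\<close> and \<open>d1 * d2 \<ge> 4\<close> both coordinates of \<open>a_vec d1 d2 m\<close> are nonnegative, so the
  conversion \<^const>\<open>nat\<close> loses nothing.
\<close>

definition D_path :: "nat \<Rightarrow> nat \<Rightarrow> nat \<Rightarrow> step list" where
  "D_path d1 d2 m = dyck_path (nat (fst (a_vec d1 d2 m))) (nat (snd (a_vec d1 d2 m)))"

end

theory Submission
  imports Defs Complex_Main
begin

text \<open>
  Since \<open>Y\<^bsub>m+1\<^esub> = F(Y'\<^sub>m)\<close> with \<open>F = F\<^bsub>P\<^sub>1\<^esub>\<close> and \<open>Y'\<^sub>m\<close> built from \<open>P\<^sub>2\<close> and the reversal of \<open>P\<^sub>1\<close>, it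
  suffices to compare \<open>F\<close> of the sum over a path \<open>D'\<close> with blocks \<open>H V\<^bsup>k\<^sub>i\<^esup>\<close> with the sum over the path
  with blocks \<open>H\<^bsup>d - k\<^sub>i\<^esup> V\<close>, where \<open>d = d\<^sub>2\<close>.  The two sums agree already when the grades \<open>c\<^sub>i\<close> of the
  horizontal edges of \<open>D'\<close> are fixed, those of the vertical edges of the second path being
  \<open>d - c\<^sub>i\<close>.  Then both compatibility conditions are governed by the same bracket word, in which the
  \<open>i\<close>-th block contributes \<open>c\<^sub>i - k\<^sub>i\<close> opening brackets (closing ones if negative): on one side the
  closing brackets carry the remaining grades, on the other side the opening ones, and a
  matched pair is admissible iff the sum of the grades of all the pairs nested in it, including
  its own, is at most the number of blocks ending inside it.

  With \<open>A = P\<^sub>1(Y) X\<^sup>-\<^sup>1 = \<Sum>\<^sub>i y\<^sub>i\<close> and \<open>Z = X Y\<^sup>-\<^sup>1 X\<^sup>-\<^sup>1\<close>, a pair enclosing a factor of value \<open>W\<close> and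
  balance \<open>t\<close> turns it into \<open>\<Sum>\<^bsub>i \<le> t\<^esub> A W X y\<^sub>i A\<^sup>-\<^sup>1\<close> on one side and into \<open>\<Sum>\<^bsub>i \<le> t\<^esub> y\<^sub>i W X\<close> on the other.
  These agree if \<open>t \<ge> d\<^sub>1\<close>, or if \<open>W\<close> is a scalar multiple of \<open>Z\<^sup>t\<close>.  Measuring the distance of both
  paths to their diagonals shows that nothing else occurs.
\<close>

section \<open>Compatibility of graded words\<close>

type_synonym gword = "(step \<times> nat) list"

fun nH :: "gword \<Rightarrow> nat" where
  "nH [] = 0"
| "nH ((East, a) # g) = Suc (nH g)"
| "nH ((North, a) # g) = nH g"

fun nV :: "gword \<Rightarrow> nat" where
  "nV [] = 0"
| "nV ((East, a) # g) = nV g"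
| "nV ((North, a) # g) = Suc (nV g)"

fun sH :: "gword \<Rightarrow> nat" where
  "sH [] = 0"
| "sH ((East, a) # g) = a + sH g"
| "sH ((North, a) # g) = sH g"

fun sV :: "gword \<Rightarrow> nat" where
  "sV [] = 0"
| "sV ((East, a) # g) = sV g"
| "sV ((North, a) # g) = a + sV g"

lemma gword_append [simp]:
  "nH (g @ g') = nH g + nH g'" "nV (g @ g') = nV g + nV g'"
  "sH (g @ g') = sH g + sH g'" "sV (g @ g') = sV g + sV g'"
  by (induction g rule: nH.induct) simp_all

text \<open>
  By a discrete intermediate value argument, \<open>covers\<close> says that HGC fails for every edge of the
  factor \<open>u\<close> between the two edges, and \<open>reaches\<close> says the same of VGC.
\<close>

definition covers :: "nat \<Rightarrow> gword \<Rightarrow> bool" where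
  "covers c u \<longleftrightarrow> (\<forall>u1 u2. u = u1 @ u2 \<longrightarrow> nV u1 < c + sH u1)"

definition reaches :: "nat \<Rightarrow> gword \<Rightarrow> bool" where
  "reaches w u \<longleftrightarrow> (\<forall>u1 u2. u = u1 @ u2 \<longrightarrow> nH u2 < w + sV u2)"

definition compat_word :: "gword \<Rightarrow> bool" where
  "compat_word g \<longleftrightarrow> (\<forall>a c u w r. g = a @ (East, c) # u @ (North, w) # r \<longrightarrow> \<not> (covers c u \<and> reaches w u))"

definition compat_left :: "gword \<Rightarrow> bool" where
  "compat_left g \<longleftrightarrow>
     (\<forall>a c u w r. g = a @ (East, c) # u @ (North, w) # r \<longrightarrow> covers c u \<longrightarrow> sV u + w \<le> nH u)"

definition compat_right :: "gword \<Rightarrow> bool" where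
  "compat_right g \<longleftrightarrow>
     (\<forall>a c u w r. g = a @ (East, c) # u @ (North, w) # r \<longrightarrow> reaches w u \<longrightarrow> sH u + c \<le> nV u)"

lemma covers_prefix: "covers c (u @ v) \<Longrightarrow> covers c u"
  unfolding covers_def by (metis append.assoc)

lemma reaches_suffix: "reaches c (u @ v) \<Longrightarrow> reaches c v"
  unfolding reaches_def by (metis append.assoc)

text \<open>If \<open>covers c u\<close> holds, \<open>reaches\<close> fails on some suffix
  \<open>u2\<close>, which bounds \<open>sV u2 + w\<close> by \<open>nH u2\<close>. On the remaining
  prefix \<open>covers\<close> persists, so induction on the length of the factor, applied at each
  of its North letters, bounds the rest. Conversely \<open>reaches\<close> at the whole factor
  contradicts the bound. The condition is now one-sided and can be checked while reading from left
  to right.\<close>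

lemma compat_iff_left: "compat_word g \<longleftrightarrow> compat_left g"
proof
  assume g: "compat_word g"
  have "sV u + w \<le> nH u" if "g = a @ (East, c) # u @ (North, w) # r" "covers c u" for a c u w r
    using that
  proof (induction "length u" arbitrary: u w r rule: less_induct)
    case less
    have "\<not> reaches w u" using g less.prems unfolding compat_word_def by blast
    then obtain u1 u2 where u: "u = u1 @ u2" "nH u2 \<ge> w + sV u2"
      unfolding reaches_def by (auto simp: not_less)
    have "sV v1 \<le> nH v1" if "u = v1 @ v2" for v1 v2
      using that
    proof (induction v1 arbitrary: v2 rule: rev_induct)
      case (snoc x v1)
      obtain s b where x: "x = (s, b)" by force
      have 1: "sV v1 \<le> nH v1" using snoc.IH[of "x # v2"] snoc.prems by simp
      show ?case
      proof (cases s)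
        case North
        have "sV v1 + b \<le> nH v1"
          using less.hyps[of v1 b "v2 @ (North, w) # r"] less.prems snoc.prems x North
            covers_prefix[of c v1] by simp
        thus ?thesis using x North by simp
      qed (use 1 x in simp)
    qed simp
    from this[OF u(1)] show ?case using u by simp
  qed
  thus "compat_left g" unfolding compat_left_def by blast
next
  assume g: "compat_left g"
  show "compat_word g"
    unfolding compat_word_def
  proof (intro allI impI notI)
    fix a c u w r assume *: "g = a @ (East, c) # u @ (North, w) # r" "covers c u \<and> reaches w u"
    hence "nH u < w + sV u" unfolding reaches_def by (metis append_Nil)
    thus False using * g unfolding compat_left_def by (metis add.commute not_le)
  qed
qed

text \<open>Mirror image of \<open>compat_iff_left\<close>: the prefix on which
  \<open>covers\<close> fails gives the bound, and the suffix is handled by induction at its East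
  letters.\<close>

lemma compat_iff_right: "compat_word g \<longleftrightarrow> compat_right g"
proof
  assume g: "compat_word g"
  have "sH u + c \<le> nV u" if "g = a @ (East, c) # u @ (North, w) # r" "reaches w u" for a c u w r
    using that
  proof (induction "length u" arbitrary: u c a rule: less_induct)
    case less
    have "\<not> covers c u" using g less.prems unfolding compat_word_def by blast
    then obtain u1 u2 where u: "u = u1 @ u2" "nV u1 \<ge> c + sH u1"
      unfolding covers_def by (auto simp: not_less)
    have "sH v2 \<le> nV v2" if "u = v1 @ v2" for v1 v2
      using that
    proof (induction v2 arbitrary: v1)
      case (Cons x v2)
      obtain s b where x: "x = (s, b)" by force
      have 1: "sH v2 \<le> nV v2" using Cons.IH[of "v1 @ [x]"] Cons.prems by simp
      show ?case
      proof (cases s)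
        case East
        have "reaches w v2" using reaches_suffix[of w "v1 @ [x]" v2] less.prems Cons.prems by simp
        hence "sH v2 + b \<le> nV v2"
          using less.hyps[of v2 "a @ (East, c) # v1" b] less.prems Cons.prems x East by simp
        thus ?thesis using x East by simp
      qed (use 1 x in simp)
    qed simp
    from this[OF u(1)] show ?case using u by simp
  qed
  thus "compat_right g" unfolding compat_right_def by blast
next
  assume g: "compat_right g"
  show "compat_word g"
    unfolding compat_word_def
  proof (intro allI impI notI)
    fix a c u w r assume *: "g = a @ (East, c) # u @ (North, w) # r" "covers c u \<and> reaches w u"
    hence "nV u < c + sH u" unfolding covers_def by (metis append_Nil2)
    thus False using * g unfolding compat_right_def by (metis add.commute not_le)
  qed
qed

section \<open>Stack machines\<close>

fun bump :: "'b::plus \<Rightarrow> 'b list \<Rightarrow> 'b list" where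
  "bump n [] = []"
| "bump n (t # st) = (t + n) # st"

lemma length_bump [simp]: "length (bump n st) = length st"
  by (cases st) simp_all

lemma bump_bump [simp]: "bump m (bump n st) = bump (n + m) (st :: 'b::semigroup_add list)"
  by (cases st) (simp_all add: add.assoc)

lemma bump_0 [simp]: "bump 0 st = (st :: 'b::monoid_add list)"
  by (cases st) simp_all

lemma sum_take_bump:
  "j < length st \<Longrightarrow> sum_list (take (Suc j) (bump n st)) = (n :: 'b::comm_monoid_add) + sum_list (take (Suc j) st)"
  by (cases st) (simp_all add: ac_simps)

text \<open>
  A horizontal edge of grade \<open>c\<close> opens \<open>c\<close> brackets and a vertical edge closes the last open one.
  The entry of an open bracket is the number of horizontal edges minus the sum of the grades of
  the vertical edges since then, less the part already counted in the entries above it.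
\<close>

fun runL :: "nat list \<Rightarrow> gword \<Rightarrow> bool" where
  "runL st [] = True"
| "runL st ((East, c) # g) = runL (replicate c 0 @ bump 1 st) g"
| "runL [] ((North, w) # g) = runL [] g"
| "runL (t # st) ((North, w) # g) = (w \<le> t \<and> runL (bump (t - w) st) g)"

text \<open>The condition of \<open>compat_left\<close> for brackets inherited from an earlier
  prefix. \<open>covers (Suc j) u\<close> says that bracket \<open>j\<close> from the top is still
  open after \<open>u\<close>; its true entry is a partial sum because entries are stored relative
  to those above.\<close>

definition okL :: "nat list \<Rightarrow> gword \<Rightarrow> bool" where
  "okL st g \<longleftrightarrow> (\<forall>u w r j. g = u @ (North, w) # r \<longrightarrow> j < length st \<longrightarrow> covers (Suc j) u \<longrightarrow>
     sV u + w \<le> nH u + sum_list (take (Suc j) st))"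

lemma all_split_Cons:
  "(\<forall>u1 u2. x # u = u1 @ u2 \<longrightarrow> Q u1 u2) \<longleftrightarrow> Q [] (x # u) \<and> (\<forall>u1 u2. u = u1 @ u2 \<longrightarrow> Q (x # u1) u2)"
proof -
  have "(\<exists>u1 u2. x # u = u1 @ u2 \<and> R u1 u2) \<longleftrightarrow> R [] (x # u) \<or> (\<exists>u1 u2. u = u1 @ u2 \<and> R (x # u1) u2)"
    for R
    by (subst Cons_eq_append_conv) blast
  from this[of "\<lambda>u1 u2. \<not> Q u1 u2"] show ?thesis by blast
qed

lemma all_north_Cons:
  "(\<forall>u w r. x # g = u @ (North, w) # r \<longrightarrow> Q u w) \<longleftrightarrow>
   (\<forall>w. x = (North, w) \<longrightarrow> Q [] w) \<and> (\<forall>u w r. g = u @ (North, w) # r \<longrightarrow> Q (x # u) w)"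
proof -
  have "(\<exists>u w r. x # g = u @ (North, w) # r \<and> R u w) \<longleftrightarrow>
     (\<exists>w. x = (North, w) \<and> R [] w) \<or> (\<exists>u w r. g = u @ (North, w) # r \<and> R (x # u) w)" for R
    by (subst Cons_eq_append_conv) blast
  from this[of "\<lambda>u w. \<not> Q u w"] show ?thesis by blast
qed

lemma all_east_north_Cons:
  "(\<forall>a c u w r. x # g = a @ (East, c) # u @ (North, w) # r \<longrightarrow> Q c u w) \<longleftrightarrow>
   (\<forall>c. x = (East, c) \<longrightarrow> (\<forall>u w r. g = u @ (North, w) # r \<longrightarrow> Q c u w)) \<and>
   (\<forall>a c u w r. g = a @ (East, c) # u @ (North, w) # r \<longrightarrow> Q c u w)"
proof -
  have "(\<exists>a c u w r. x # g = a @ (East, c) # u @ (North, w) # r \<and> R c u w) \<longleftrightarrow>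
     (\<exists>c u w r. x = (East, c) \<and> g = u @ (North, w) # r \<and> R c u w) \<or>
     (\<exists>a c u w r. g = a @ (East, c) # u @ (North, w) # r \<and> R c u w)" for R
    by (subst Cons_eq_append_conv) blast
  from this[of "\<lambda>c u w. \<not> Q c u w"] show ?thesis by blast
qed

lemma covers_Nil: "covers c [] \<longleftrightarrow> 0 < c"
  by (simp add: covers_def)

lemma covers_East: "covers (Suc c) ((East, a) # u) \<longleftrightarrow> covers (Suc c + a) u"
  unfolding covers_def all_split_Cons by (simp add: add.assoc)

lemma covers_North: "covers (Suc c) ((North, a) # u) \<longleftrightarrow> covers c u"
  unfolding covers_def all_split_Cons by simp

lemma covers_0: "\<not> covers 0 u"
  unfolding covers_def by (auto intro: exI[of _ "[]"])

lemma covers_mono: "covers c u \<Longrightarrow> c \<le> c' \<Longrightarrow> covers c' u"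
  unfolding covers_def using less_le_trans add_le_mono1 by blast

lemma reaches_Cons: "reaches w (x # u) \<longleftrightarrow> nH (x # u) < w + sV (x # u) \<and> reaches w u"
  unfolding reaches_def all_split_Cons by simp

lemma reaches_Nil: "reaches w [] \<longleftrightarrow> 0 < w"
  by (simp add: reaches_def)

lemma compat_left_Cons:
  "compat_left (x # g) \<longleftrightarrow> compat_left g \<and>
     (\<forall>c. x = (East, c) \<longrightarrow> (\<forall>u w r. g = u @ (North, w) # r \<longrightarrow> covers c u \<longrightarrow> sV u + w \<le> nH u))"
  unfolding compat_left_def all_east_north_Cons by blast

lemma compat_right_Cons:
  "compat_right (x # g) \<longleftrightarrow> compat_right g \<and>
     (\<forall>c. x = (East, c) \<longrightarrow> (\<forall>u w r. g = u @ (North, w) # r \<longrightarrow> reaches w u \<longrightarrow> sH u + c \<le> nV u))"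
  unfolding compat_right_def all_east_north_Cons by blast

text \<open>An East letter hands its own clause of \<open>compat_left\<close> over to the brackets
  that it pushes; a North letter discharges the clause of the top bracket and shifts the indices of
  the others by one.\<close>

lemma runL_iff: "runL st g \<longleftrightarrow> okL st g \<and> compat_left g"
proof (induction st g rule: runL.induct)
  case (1 st)
  show ?case by (simp add: okL_def compat_left_def)
next
  case (2 st c g)
  let ?P = "\<lambda>u w. covers c u \<longrightarrow> sV u + w \<le> nH u"
  have st: "sum_list (take (Suc j) (replicate c 0 @ bump 1 st)) =
      (if j < c then 0 else Suc (sum_list (take (Suc (j - c)) st)))"
    if "j < c + length st" for j
  proof (cases "j < c")
    case False
    hence "Suc j - c = Suc (j - c)" by simp
    thus ?thesis using False that sum_take_bump[of "j - c" st 1] by (simp add: sum_list_replicate)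
  qed (simp add: sum_list_replicate)
  have "okL (replicate c 0 @ bump 1 st) g \<longleftrightarrow> okL st ((East, c) # g) \<and>
      (\<forall>u w r. g = u @ (North, w) # r \<longrightarrow> ?P u w)" (is "?A \<longleftrightarrow> ?B \<and> ?C")
  proof (intro iffI conjI)
    assume A: ?A
    have A': "sV u + w \<le> nH u + (if j < c then 0 else Suc (sum_list (take (Suc (j - c)) st)))"
      if "g = u @ (North, w) # r" "j < c + length st" "covers (Suc j) u" for u w r j
      using A[unfolded okL_def, rule_format, OF that(1) _ that(3)] that(2) st[OF that(2)] by simp
    show ?B
      unfolding okL_def
    proof (intro allI impI)
      fix u w r j
      assume *: "(East, c) # g = u @ (North, w) # r" "j < length st" "covers (Suc j) u"
      then obtain u' where u: "u = (East, c) # u'" "g = u' @ (North, w) # r"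
        by (cases u) auto
      have "covers (Suc (c + j)) u'" using * u by (simp add: covers_East add.commute)
      from A'[OF u(2) _ this] * show "sV u + w \<le> nH u + sum_list (take (Suc j) st)" by (simp add: u)
    qed
    show ?C
    proof (intro allI impI)
      fix u w r assume *: "g = u @ (North, w) # r" "covers c u"
      then obtain c' where "c = Suc c'" using covers_0 by (cases c) auto
      thus "sV u + w \<le> nH u" using A'[OF *(1), of c'] * by simp
    qed
  next
    assume BC: "?B \<and> ?C"
    show ?A
      unfolding okL_def
    proof (intro allI impI)
      fix u w r j
      assume *: "g = u @ (North, w) # r" "j < length (replicate c 0 @ bump 1 st)" "covers (Suc j) u"
      hence j: "j < c + length st" by simp
      show "sV u + w \<le> nH u + sum_list (take (Suc j) (replicate c 0 @ bump 1 st))"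
      proof (cases "j < c")
        case True
        \<comment> \<open>All new brackets have true entry 0, so the lowest one, which stays open
          longest, imposes the strongest condition.\<close>
        hence "covers c u" using covers_mono[OF *(3)] by simp
        thus ?thesis using BC *(1) by (simp add: trans_le_add1)
      next
        case False
        have "covers (Suc (j - c)) ((East, c) # u)" using False * by (simp add: covers_East)
        hence "sV ((East, c) # u) + w \<le> nH ((East, c) # u) + sum_list (take (Suc (j - c)) st)"
          using BC[THEN conjunct1, unfolded okL_def, rule_format, of "(East, c) # u" w r "j - c"]
            j False *(1) by simp
        thus ?thesis using st[OF j] False by simp
      qed
    qed
  qed
  from this show ?case unfolding runL.simps "2.IH" compat_left_Cons by blast
next
  case (3 w g)
  thus ?case by (simp add: okL_def compat_left_Cons)
next
  case (4 t st w g)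
  have n: "okL (t # st) ((North, w) # g) \<longleftrightarrow>
     (\<forall>j<Suc (length st). w \<le> sum_list (take (Suc j) (t # st))) \<and>
     (\<forall>u w' r. g = u @ (North, w') # r \<longrightarrow> (\<forall>j<Suc (length st). covers j u \<longrightarrow>
       w + sV u + w' \<le> nH u + sum_list (take (Suc j) (t # st))))"
  proof -
    have "okL (t # st) ((North, w) # g) \<longleftrightarrow> (\<forall>u w' r. (North, w) # g = u @ (North, w') # r \<longrightarrow>
      (\<forall>j<Suc (length st). covers (Suc j) u \<longrightarrow> sV u + w' \<le> nH u + sum_list (take (Suc j) (t # st))))"
      unfolding okL_def by auto
    thus ?thesis
      unfolding all_north_Cons by (simp add: covers_Nil covers_North)
  qed
  have 1: "(\<forall>j<Suc (length st). w \<le> sum_list (take (Suc j) (t # st))) \<longleftrightarrow> w \<le> t"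
    by (auto simp: trans_le_add1)
  \<comment> \<open>The popped bracket drops out, as \<open>covers 0 u\<close> is false; adding the
    remainder \<open>t - w\<close> to the next entry keeps all partial sums below it
    correct.\<close>
  have 2: "(\<forall>j<Suc (length st). covers j u \<longrightarrow> w + sV u + w' \<le> nH u + sum_list (take (Suc j) (t # st)))
     \<longleftrightarrow> (\<forall>j<length st. covers (Suc j) u \<longrightarrow> sV u + w' \<le> nH u + sum_list (take (Suc j) (bump (t - w) st)))"
    if "w \<le> t" for u w'
  proof -
    have "(\<forall>j<Suc (length st). covers j u \<longrightarrow> w + sV u + w' \<le> nH u + sum_list (take (Suc j) (t # st)))
      \<longleftrightarrow> (\<forall>j<length st. covers (Suc j) u \<longrightarrow> w + sV u + w' \<le> nH u + (t + sum_list (take (Suc j) st)))"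
      by (subst All_less_Suc2) (simp add: covers_0)
    also have "\<dots> \<longleftrightarrow> (\<forall>j<length st. covers (Suc j) u \<longrightarrow>
       sV u + w' \<le> nH u + sum_list (take (Suc j) (bump (t - w) st)))"
      using that by (intro all_cong1 imp_cong refl) (auto simp: sum_take_bump simp del: take_Suc_Cons)
    finally show ?thesis .
  qed
  show ?case
  proof (cases "w \<le> t")
    case True
    have "okL (bump (t - w) st) g \<longleftrightarrow> okL (t # st) ((North, w) # g)"
      unfolding n using True 1 by (simp only: 2[OF True]) (auto simp: okL_def)
    thus ?thesis using "4.IH" True by (simp add: compat_left_Cons)
  next
    case False
    thus ?thesis unfolding n 1 by simp
  qed
qed

lemma runL_compat: "runL [] g \<longleftrightarrow> compat_word g"
  by (simp add: runL_iff compat_iff_left okL_def)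

text \<open>
  The dual reading: a horizontal edge opens one bracket, and a vertical edge of grade \<open>c\<close> closes
  \<open>c\<close> of them.
\<close>

fun pops :: "nat \<Rightarrow> int list \<Rightarrow> int list option" where
  "pops 0 st = Some st"
| "pops (Suc c) [] = Some []"
| "pops (Suc c) (t # st) = (if 0 \<le> t then pops c (bump t st) else None)"

fun runR :: "int list \<Rightarrow> gword \<Rightarrow> bool" where
  "runR st [] = True"
| "runR st ((East, w) # g) = runR (- int w # st) g"
| "runR st ((North, c) # g) =
     (case pops c st of None \<Rightarrow> False | Some st' \<Rightarrow> runR (bump 1 st') g)"

text \<open>Dual of \<open>okL\<close>. \<open>reaches c u\<close> says that the closings of the
  North letter get past all brackets opened in \<open>u\<close>, and the inequality on
  \<open>j\<close> says that bracket \<open>j\<close> of the old stack has been closed by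
  then.\<close>

definition okR :: "int list \<Rightarrow> gword \<Rightarrow> bool" where
  "okR st g \<longleftrightarrow> (\<forall>u c r. g = u @ (North, c) # r \<longrightarrow> reaches c u \<longrightarrow>
     (\<forall>j<length st. j + nH u < sV u + c \<longrightarrow>
       int (sH u) \<le> int (nV u) + sum_list (take (Suc j) st)))"

lemma bump_drop: "n \<noteq> 0 \<Longrightarrow> drop n (bump t st) = drop n st"
  by (cases st; cases n) simp_all

text \<open>A popped entry is added to the next one, so the entry tested at the \<open>j\<close>-th
  pop is the sum of the top \<open>j + 1\<close> original entries. A stack that is too short is
  merely emptied: unmatched closings are unconstrained.\<close>

lemma pops_eq:
  "pops c st = (if \<forall>j<length st. j < c \<longrightarrow> 0 \<le> sum_list (take (Suc j) st)
     then Some (if c < length st then sum_list (take (Suc c) st) # drop (Suc c) st else []) else None)"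
proof (induction c st rule: pops.induct)
  case (1 st)
  show ?case by (cases st) simp_all
next
  case (3 c t st)
  have 1: "(\<forall>j<length (bump t st). j < c \<longrightarrow> 0 \<le> sum_list (take (Suc j) (bump t st))) \<longleftrightarrow>
      (\<forall>j<length st. j < c \<longrightarrow> 0 \<le> t + sum_list (take (Suc j) st))"
    by (intro all_cong1) (auto simp: sum_take_bump)
  have 2: "(\<forall>j<length (t # st). j < Suc c \<longrightarrow> 0 \<le> sum_list (take (Suc j) (t # st))) \<longleftrightarrow>
     0 \<le> t \<and> (\<forall>j<length st. j < c \<longrightarrow> 0 \<le> t + sum_list (take (Suc j) st))"
    by (simp add: All_less_Suc2)
  show ?case
    unfolding pops.simps 2 using "3.IH" unfolding 1
    by (auto simp: sum_take_bump bump_drop)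
qed simp

lemma reaches_length: "reaches c u \<Longrightarrow> nH u < c + sV u"
  unfolding reaches_def by (metis append_Nil)

text \<open>The leftmost East letter of \<open>u\<close> gives the bound on everything after it,
  together with its own grade; North letters before it only increase \<open>nV\<close>.\<close>

lemma compat_right_sum:
  "compat_right (u @ (North, w) # r) \<Longrightarrow> reaches w u \<Longrightarrow> sH u \<le> nV u"
proof (induction u)
  case (Cons x u)
  obtain s b where x: "x = (s, b)" by force
  have IH: "sH u \<le> nV u" and r: "reaches w u"
    using Cons by (auto simp: compat_right_Cons reaches_Cons)
  show ?case
  proof (cases s)
    case East
    have "sH u + b \<le> nV u"
      using Cons.prems(1)[unfolded append_Cons compat_right_Cons] r x East by blast
    thus ?thesis using x East by simp
  qed (use IH x in simp)
qed simp

lemma runR_iff: "runR st g \<longleftrightarrow> okR st g \<and> compat_right g"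
proof (induction st g rule: runR.induct)
  case (1 st)
  show ?case by (simp add: okR_def compat_right_def)
next
  case (2 st w g)
  have "okR st ((East, w) # g) \<longleftrightarrow> (\<forall>u c r. g = u @ (North, c) # r \<longrightarrow> reaches c u \<longrightarrow>
     (\<forall>j<length st. Suc j + nH u < sV u + c \<longrightarrow>
       int w + int (sH u) \<le> int (nV u) + sum_list (take (Suc j) st)))"
    unfolding okR_def all_north_Cons by (auto simp: reaches_Cons)
  moreover have "okR (- int w # st) g \<longleftrightarrow> (\<forall>u c r. g = u @ (North, c) # r \<longrightarrow> reaches c u \<longrightarrow>
     sH u + w \<le> nV u \<and> (\<forall>j<length st. Suc j + nH u < sV u + c \<longrightarrow>
       int w + int (sH u) \<le> int (nV u) + sum_list (take (Suc j) st)))"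
    unfolding okR_def length_Cons All_less_Suc2
    by (intro all_cong1 imp_cong refl conj_cong) (use reaches_length in \<open>auto simp: algebra_simps\<close>)
  ultimately show ?case unfolding runR.simps "2.IH" compat_right_Cons by blast
next
  case (3 st c g)
  let ?P = "\<forall>j<length st. j < c \<longrightarrow> 0 \<le> sum_list (take (Suc j) st)"
  let ?st = "if c < length st then sum_list (take (Suc c) st) # drop (Suc c) st else []"
  have N: "okR st ((North, c) # g) \<longleftrightarrow> ?P \<and> (\<forall>u c' r. g = u @ (North, c') # r \<longrightarrow> reaches c' u \<longrightarrow>
     (\<forall>j<length st. j + nH u < c + sV u + c' \<longrightarrow>
       int (sH u) \<le> 1 + int (nV u) + sum_list (take (Suc j) st)))"
    unfolding okR_def all_north_Cons by (auto simp: reaches_Cons reaches_Nil dest: reaches_length)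
  have st: "sum_list (take (Suc j) (bump 1 ?st)) = 1 + sum_list (take (Suc (c + j)) st)"
    if "j < length ?st" for j
  proof -
    have c: "c < length st" using that by (auto split: if_splits)
    have "take (Suc (c + j)) st = take (Suc c) st @ take j (drop (Suc c) st)"
      by (metis add_Suc take_add)
    thus ?thesis using c by (simp add: add.assoc)
  qed
  have len: "length ?st = length st - c" by auto
  have "okR (bump 1 ?st) g \<and> compat_right g \<longleftrightarrow> okR st ((North, c) # g) \<and> compat_right g" if ?P
  proof (intro iffI conjI; (elim conjE)?)
    assume A: "okR (bump 1 ?st) g" and g: "compat_right g"
    have "int (sH u) \<le> 1 + int (nV u) + sum_list (take (Suc j) st)"
      if *: "g = u @ (North, c') # r" "reaches c' u" "j < length st" "j + nH u < c + sV u + c'" for u c' r j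
    proof (cases "j < c")
      case True
      \<comment> \<open>Bracket \<open>j\<close> is closed by the current letter already;
        \<open>okR\<close> still asks for its inequality at later letters, where it follows from the
        test made now.\<close>
      hence "0 \<le> sum_list (take (Suc j) st)" using \<open>?P\<close> * by blast
      moreover have "sH u \<le> nV u" using compat_right_sum g * by blast
      ultimately show ?thesis by simp
    next
      case False
      hence j: "j - c < length ?st" using * len by simp
      have "int (sH u) \<le> int (nV u) + sum_list (take (Suc (j - c)) (bump 1 ?st))"
        by (rule A[unfolded okR_def, rule_format, OF *(1,2)]) (use j * False in auto)
      thus ?thesis using st[OF j] False by simp
    qed
    thus "okR st ((North, c) # g)" unfolding N using \<open>?P\<close> by blast
  next
    assume B: "okR st ((North, c) # g)"
    show "okR (bump 1 ?st) g"
      unfolding okR_def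
    proof (intro allI impI)
      fix u c' r j
      assume *: "g = u @ (North, c') # r" "reaches c' u" "j < length (bump 1 ?st)" "j + nH u < sV u + c'"
      hence j: "j < length ?st" by simp
      have "int (sH u) \<le> 1 + int (nV u) + sum_list (take (Suc (c + j)) st)"
        by (rule B[unfolded N, THEN conjunct2, rule_format, OF *(1,2)]) (use j[unfolded len] *(4) in auto)
      thus "int (sH u) \<le> int (nV u) + sum_list (take (Suc j) (bump 1 ?st))" using st[OF j] by simp
    qed
  qed
  moreover have "runR st ((North, c) # g) \<longleftrightarrow> ?P \<and> runR (bump 1 ?st) g"
    unfolding runR.simps pops_eq by simp
  moreover have "runR (bump 1 ?st) g \<longleftrightarrow> okR (bump 1 ?st) g \<and> compat_right g" if ?P
    by (rule "3.IH") (use that in \<open>simp add: pops_eq\<close>)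
  moreover have "compat_right ((North, c) # g) \<longleftrightarrow> compat_right g"
    unfolding compat_right_Cons by simp
  moreover have "okR st ((North, c) # g) \<Longrightarrow> ?P" unfolding N by blast
  ultimately show ?case by blast
qed

lemma runR_compat: "runR [] g \<longleftrightarrow> compat_word g"
  by (simp add: runR_iff compat_iff_right okR_def)

section \<open>Bracket words\<close>

datatype letter = Opn | Cls | Zed

datatype forest = Leaf | Zf forest | Pf forest forest

primrec flatten :: "forest \<Rightarrow> letter list" where
  "flatten Leaf = []"
| "flatten (Zf v) = Zed # flatten v"
| "flatten (Pf u v) = Opn # flatten u @ Cls # flatten v"

primrec top_zeds :: "forest \<Rightarrow> nat" where
  "top_zeds Leaf = 0"
| "top_zeds (Zf v) = Suc (top_zeds v)"
| "top_zeds (Pf u v) = top_zeds v"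

inductive no_close :: "letter list \<Rightarrow> bool" where
  nc_forest: "no_close (flatten f)"
| nc_open: "no_close w \<Longrightarrow> no_close (flatten f @ Opn # w)"

lemma no_close_Zed: "no_close w \<Longrightarrow> no_close (Zed # w)"
proof (induction rule: no_close.induct)
  case (nc_forest f)
  show ?case using no_close.nc_forest[of "Zf f"] by simp
next
  case (nc_open w f)
  thus ?case using no_close.nc_open[of w "Zf f"] by simp
qed

lemma no_close_bracket: "no_close w \<Longrightarrow> no_close (Opn # flatten u @ Cls # w)"
proof (induction rule: no_close.induct)
  case (nc_forest f)
  show ?case using no_close.nc_forest[of "Pf u f"] by simp
next
  case (nc_open w f)
  thus ?case using no_close.nc_open[of w "Pf u f"] by simp
qed

text \<open>A word can be cut at its first unmatched closing bracket, and what precedes that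
  bracket, once unmatched opening ones are excluded, is a forest. For a leading \<open>Opn\<close>,
  the tail is cut twice: at the partner of that bracket and then at the next unmatched one.\<close>

lemma word_cases: "no_close w \<or> (\<exists>f w'. w = flatten f @ Cls # w')"
proof (induction "length w" arbitrary: w rule: less_induct)
  case less
  show ?case
  proof (cases w)
    case Nil
    thus ?thesis using nc_forest[of Leaf] by simp
  next
    case (Cons l w')
    have IH: "no_close w' \<or> (\<exists>f v. w' = flatten f @ Cls # v)" using less Cons by simp
    show ?thesis
    proof (cases l)
      case Cls
      thus ?thesis using Cons by (intro disjI2 exI[of _ Leaf]) simp
    next
      case Zed
      from IH show ?thesis
      proof
        assume "\<exists>f v. w' = flatten f @ Cls # v"
        then obtain f v where "w' = flatten f @ Cls # v" by blast
        thus ?thesis using Cons Zed by (intro disjI2 exI[of _ "Zf f"]) simp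
      qed (use Cons Zed no_close_Zed in blast)
    next
      case Opn
      from IH show ?thesis
      proof
        assume "no_close w'"
        thus ?thesis using Cons Opn nc_open[of w' Leaf] by simp
      next
        assume "\<exists>f v. w' = flatten f @ Cls # v"
        then obtain u v where w': "w' = flatten u @ Cls # v" by blast
        have "no_close v \<or> (\<exists>f x. v = flatten f @ Cls # x)" using less Cons w' by simp
        thus ?thesis
        proof
          assume "no_close v"
          thus ?thesis using Cons Opn w' no_close_bracket by simp
        next
          assume "\<exists>f x. v = flatten f @ Cls # x"
          then obtain f x where "v = flatten f @ Cls # x" by blast
          thus ?thesis using Cons Opn w' by (intro disjI2 exI[of _ "Pf u f"]) simp
        qed
      qed
    qed
  qed
qed

subsection \<open>Potentials\<close>

text \<open>
  The second potential is \<open>x - \<rho> y\<close> along the path whose vertical edges are the closing brackets,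
  the first one is \<open>\<sigma> x - y\<close> along the path whose horizontal edges are the opening brackets.
\<close>

inductive pstep :: "real \<Rightarrow> real \<Rightarrow> letter \<Rightarrow> real \<times> real \<Rightarrow> real \<times> real \<Rightarrow> bool"
  for \<rho> \<sigma> :: real where
  "r' \<le> r + 1 \<Longrightarrow> l \<le> l' + 1 \<Longrightarrow> pstep \<rho> \<sigma> Zed (l, r) (l', r')"
| "1 \<le> r \<Longrightarrow> 0 \<le> l \<Longrightarrow> l < 1 \<Longrightarrow> l + \<sigma> \<le> l' \<Longrightarrow> pstep \<rho> \<sigma> Opn (l, r) (l', r')"
| "r' + \<rho> \<le> r \<Longrightarrow> 0 \<le> r' \<Longrightarrow> r' < 1 \<Longrightarrow> 1 \<le> l' \<Longrightarrow> pstep \<rho> \<sigma> Cls (l, r) (l', r')"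

inductive_cases pstepE: "pstep \<rho> \<sigma> x (l, r) (l', r')"

fun ppath :: "real \<Rightarrow> real \<Rightarrow> letter list \<Rightarrow> real \<times> real \<Rightarrow> real \<times> real \<Rightarrow> bool" where
  "ppath \<rho> \<sigma> [] s t \<longleftrightarrow> s = t"
| "ppath \<rho> \<sigma> (x # w) s t \<longleftrightarrow> (\<exists>s'. pstep \<rho> \<sigma> x s s' \<and> ppath \<rho> \<sigma> w s' t)"

lemma ppath_append:
  "ppath \<rho> \<sigma> (u @ v) s t \<longleftrightarrow> (\<exists>s'. ppath \<rho> \<sigma> u s s' \<and> ppath \<rho> \<sigma> v s' t)"
  by (induction u arbitrary: s) auto

lemma ppath_PfE:
  assumes "ppath \<rho> \<sigma> (flatten (Pf u v)) (l, r) (l', r')"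
  obtains l1 r1 l2 r2 l3 r3 where
    "1 \<le> r" "0 \<le> l" "l < 1" "l + \<sigma> \<le> l1" "ppath \<rho> \<sigma> (flatten u) (l1, r1) (l2, r2)"
    "r3 + \<rho> \<le> r2" "0 \<le> r3" "r3 < 1" "1 \<le> l3" "ppath \<rho> \<sigma> (flatten v) (l3, r3) (l', r')"
proof -
  obtain s1 s2 s3 where s: "pstep \<rho> \<sigma> Opn (l, r) s1" "ppath \<rho> \<sigma> (flatten u) s1 s2"
    "pstep \<rho> \<sigma> Cls s2 s3" "ppath \<rho> \<sigma> (flatten v) s3 (l', r')"
    using assms by (auto simp: ppath_append)
  obtain l1 r1 l2 r2 l3 r3 where e: "s1 = (l1, r1)" "s2 = (l2, r2)" "s3 = (l3, r3)"
    by (metis surj_pair)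
  show ?thesis
    by (rule that[of l1 r1 l2 r2 r3 l3]) (use s e in \<open>auto elim: pstepE\<close>)
qed

lemma ppath_ZfE:
  assumes "ppath \<rho> \<sigma> (flatten (Zf v)) (l, r) (l', r')"
  obtains l1 r1 where "r1 \<le> r + 1" "l \<le> l1 + 1" "ppath \<rho> \<sigma> (flatten v) (l1, r1) (l', r')"
proof -
  obtain s1 where s: "pstep \<rho> \<sigma> Zed (l, r) s1" "ppath \<rho> \<sigma> (flatten v) s1 (l', r')"
    using assms by auto
  thus ?thesis using that by (cases s1) (auto elim: pstepE)
qed

section \<open>Noncommutative identities for the weights of bracket pairs\<close>

locale kontsevich =
  fixes X Y A :: "'a::division_ring" and p :: "nat \<Rightarrow> 'a" and d :: nat
  assumes XY: "X \<noteq> 0" "Y \<noteq> 0" and A0: "A \<noteq> 0"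
    and p_central: "p i * u = u * p i" and p0: "p 0 = 1" and p_zero: "d < i \<Longrightarrow> p i = 0"
    and A_sum: "A = (\<Sum>i\<le>d. p i * Y ^ i * inverse X)"
begin

definition y :: "nat \<Rightarrow> 'a" where "y i = p i * Y ^ i * inverse X"
definition Z :: 'a where "Z = X * inverse Y * inverse X"
definition N :: "nat \<Rightarrow> 'a" where "N i = X * y i * inverse A"

lemma A_eq: "A = (\<Sum>i\<le>d. y i)"
  by (simp add: A_sum y_def)

lemma sum_y: "(\<Sum>i\<le>d. y i) = A"
  by (rule A_eq[symmetric])

lemma cancel [simp]:
  "X * (inverse X * a) = a" "inverse X * (X * a) = a"
  "Y * (inverse Y * a) = a" "inverse Y * (Y * a) = a"
  "A * (inverse A * a) = a" "inverse A * (A * a) = a"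
  using XY A0 by (simp_all flip: mult.assoc)

lemma cancel' [simp]:
  "X * inverse X = 1" "inverse X * X = 1" "A * inverse A = 1" "inverse A * A = 1"
  "Y * inverse Y = 1" "inverse Y * Y = 1"
  using XY A0 by simp_all

lemma Z_power: "Z ^ t = X * inverse Y ^ t * inverse X"
proof (induction t)
  case (Suc t)
  have "Z ^ Suc t = Z * (X * inverse Y ^ t * inverse X)" by (simp only: power_Suc Suc)
  thus ?case by (simp add: Z_def mult.assoc)
qed simp

lemma p_left: "a * (p i * b) = p i * (a * b)"
  by (metis mult.assoc p_central)

lemma Y_powers: "Y ^ i * inverse Y ^ t * Y ^ j = Y ^ j * inverse Y ^ t * Y ^ i"
proof -
  have "Y ^ k * inverse Y = inverse Y * Y ^ k" for k
    by (rule power_commuting_commutes) simp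
  hence c: "Y ^ k * inverse Y ^ t = inverse Y ^ t * Y ^ k" for k
    by (intro power_commuting_commutes[symmetric]) simp
  have "Y ^ i * inverse Y ^ t * Y ^ j = inverse Y ^ t * (Y ^ i * Y ^ j)"
    by (simp only: c mult.assoc)
  also have "\<dots> = inverse Y ^ t * (Y ^ j * Y ^ i)" by (simp only: power_add[symmetric] add.commute)
  also have "\<dots> = Y ^ j * inverse Y ^ t * Y ^ i" by (simp only: c mult.assoc)
  finally show ?thesis .
qed

text \<open>Since \<open>Z ^ t * X\<close> equals \<open>X * inverse Y ^ t\<close>, all inner
  factors \<open>X\<close> cancel and only commuting powers of \<open>Y\<close> and central scalars
  stand before the last \<open>inverse X\<close>. Summed over \<open>i\<close>, this is the
  commutation rule \<open>A_Z_y\<close> on which the comparison rests.\<close>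

lemma y_Z_y: "y i * Z ^ t * X * y j = y j * Z ^ t * X * y i"
proof -
  have *: "y i * Z ^ t * X * y j = p i * p j * (Y ^ i * inverse Y ^ t * Y ^ j) * inverse X" for i j
    by (simp add: y_def Z_power mult.assoc) (simp add: p_left)
  show ?thesis unfolding * Y_powers[of i t j] p_central[of i "p j"] ..
qed

lemma A_Z_y: "A * Z ^ t * X * y j = y j * Z ^ t * X * A"
  unfolding A_eq by (simp add: sum_distrib_left sum_distrib_right y_Z_y)

text \<open>A grade that uses up the whole balance \<open>t\<close> cancels \<open>Z ^ t\<close> and
  leaves a scalar.\<close>

lemma y_Z_X: "y t * Z ^ t * X = p t"
proof -
  have "Y ^ t * inverse Y ^ t = 1" using XY by (simp add: power_inverse)
  thus ?thesis by (simp add: y_def Z_power mult.assoc)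
qed

lemma y0: "y 0 = inverse X"
  by (simp add: y_def p0)

lemma N0: "N 0 = inverse A"
  by (simp add: N_def y0)

text \<open>With \<open>sum_y\<close>, this makes brackets of unrestricted grade weigh the same on
  both sides: \<open>A\<close> for an opening one and \<open>X\<close> for a closing one.\<close>

lemma sum_N: "(\<Sum>i\<le>d. N i) = X"
proof -
  have "(\<Sum>i\<le>d. N i) = X * A * inverse A"
    by (simp only: N_def A_eq[symmetric] sum_distrib_left[symmetric] sum_distrib_right[symmetric])
  thus ?thesis by (simp add: mult.assoc)
qed

subsection \<open>Summation over the gradings of a bracket word\<close>

text \<open>The stack discipline is that of \<open>runL\<close>, with the letters decoupled from the
  edges; \<open>sumR\<close> likewise follows \<open>runR\<close>. On an empty stack a closing
  bracket is unmatched and its grade is free.\<close>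

primrec sumL :: "letter list \<Rightarrow> nat list \<Rightarrow> 'a" where
  "sumL [] st = 1"
| "sumL (x # w) st = (case x of
      Opn \<Rightarrow> A * sumL w (0 # st)
    | Zed \<Rightarrow> Z * sumL w (bump 1 st)
    | Cls \<Rightarrow> (case st of
          [] \<Rightarrow> (\<Sum>i\<le>d. N i * sumL w [])
        | t # st' \<Rightarrow> (\<Sum>i\<le>d. if i \<le> t then N i * sumL w (bump (t - i) st') else 0)))"

primrec sumR :: "letter list \<Rightarrow> int list \<Rightarrow> 'a" where
  "sumR [] st = 1"
| "sumR (x # w) st = (case x of
      Opn \<Rightarrow> (\<Sum>i\<le>d. y i * sumR w (- int i # st))
    | Zed \<Rightarrow> Z * sumR w (bump 1 st)
    | Cls \<Rightarrow> (case st of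
          [] \<Rightarrow> X * sumR w []
        | t # st' \<Rightarrow> if 0 \<le> t then X * sumR w (bump t st') else 0))"

text \<open>
  \<open>LF f \<phi>\<close> and \<open>RF f \<phi>\<close> are the sums of \<open>W * \<phi> t\<close> over the admissible gradings of \<open>f\<close>, where \<open>W\<close> is
  the value of the grading and \<open>t\<close> its balance: the number of \<open>Zed\<close>s minus the sum of the grades.
\<close>

primrec LF :: "forest \<Rightarrow> (nat \<Rightarrow> 'a) \<Rightarrow> 'a" where
  "LF Leaf \<phi> = \<phi> 0"
| "LF (Zf v) \<phi> = Z * LF v (\<lambda>t. \<phi> (Suc t))"
| "LF (Pf u v) \<phi> = A * LF u (\<lambda>t. \<Sum>i\<le>d. if i \<le> t then N i * LF v (\<lambda>s. \<phi> (t - i + s)) else 0)"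

primrec RF :: "forest \<Rightarrow> (nat \<Rightarrow> 'a) \<Rightarrow> 'a" where
  "RF Leaf \<phi> = \<phi> 0"
| "RF (Zf v) \<phi> = Z * RF v (\<lambda>t. \<phi> (Suc t))"
| "RF (Pf u v) \<phi> = (\<Sum>i\<le>d. y i * RF u (\<lambda>t. if i \<le> t then X * RF v (\<lambda>s. \<phi> (t - i + s)) else 0))"

text \<open>A forest touches the surrounding stack only by adding its balance to the top entry, so
  the rest of the word becomes the continuation.\<close>

lemma sumL_flatten: "sumL (flatten f @ w) st = LF f (\<lambda>t. sumL w (bump t st))"
proof (induction f arbitrary: w st)
  case (Pf u v)
  show ?case by (simp add: Pf cong: if_cong)
qed (simp_all add: add.commute)

lemma sumR_flatten: "sumR (flatten f @ w) st = RF f (\<lambda>t. sumR w (bump (int t) st))"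
proof (induction f arbitrary: w st)
  case (Pf u v)
  have "(if 0 \<le> int t - int i then X * sumR (flatten v @ w) (bump (int t - int i) st) else 0) =
        (if i \<le> t then X * RF v (\<lambda>s. sumR w (bump (int (t - i + s)) st)) else 0)" for t i
    by (simp add: Pf(2) of_nat_diff algebra_simps)
  thus ?case by (simp add: Pf(1))
qed (simp_all add: add.commute)

section \<open>Linearity and evaluation of forest sums\<close>

lemma LF_scale: "LF f (\<lambda>t. \<phi> t * a) = LF f \<phi> * a"
proof (induction f arbitrary: \<phi>)
  case (Pf u v)
  have "(\<Sum>i\<le>d. if i \<le> t then N i * LF v (\<lambda>s. \<phi> (t - i + s) * a) else 0) =
     (\<Sum>i\<le>d. if i \<le> t then N i * LF v (\<lambda>s. \<phi> (t - i + s)) else 0) * a" for t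
    unfolding sum_distrib_right by (intro sum.cong refl) (simp add: Pf mult.assoc)
  thus ?case by (simp add: Pf mult.assoc)
qed (simp_all add: mult.assoc)

lemma LF_diff: "LF f (\<lambda>t. \<phi> t - \<psi> t) = LF f \<phi> - LF f \<psi>"
proof (induction f arbitrary: \<phi> \<psi>)
  case (Pf u v)
  have "(\<Sum>i\<le>d. if i \<le> t then N i * LF v (\<lambda>s. \<phi> (t - i + s) - \<psi> (t - i + s)) else 0) =
     (\<Sum>i\<le>d. if i \<le> t then N i * LF v (\<lambda>s. \<phi> (t - i + s)) else 0) -
     (\<Sum>i\<le>d. if i \<le> t then N i * LF v (\<lambda>s. \<psi> (t - i + s)) else 0)" for t
    unfolding sum_subtractf[symmetric] by (intro sum.cong refl) (simp add: Pf right_diff_distrib)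
  thus ?case by (simp add: Pf right_diff_distrib)
qed (simp_all add: right_diff_distrib)

lemma RF_scale: "RF f (\<lambda>t. \<phi> t * a) = RF f \<phi> * a"
proof (induction f arbitrary: \<phi>)
  case (Pf u v)
  have "(\<lambda>t. if i \<le> t then X * RF v (\<lambda>s. \<phi> (t - i + s) * a) else 0) =
     (\<lambda>t. (if i \<le> t then X * RF v (\<lambda>s. \<phi> (t - i + s)) else 0) * a)" for i
    by (auto simp: Pf mult.assoc)
  thus ?case by (simp add: Pf sum_distrib_right mult.assoc)
qed (simp_all add: mult.assoc)

lemma RF_diff: "RF f (\<lambda>t. \<phi> t - \<psi> t) = RF f \<phi> - RF f \<psi>"
proof (induction f arbitrary: \<phi> \<psi>)
  case (Pf u v)
  have "(\<lambda>t. if i \<le> t then X * RF v (\<lambda>s. \<phi> (t - i + s) - \<psi> (t - i + s)) else 0) =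
     (\<lambda>t. (if i \<le> t then X * RF v (\<lambda>s. \<phi> (t - i + s)) else 0) -
          (if i \<le> t then X * RF v (\<lambda>s. \<psi> (t - i + s)) else 0))" for i
    by (auto simp: Pf right_diff_distrib)
  thus ?case by (simp add: Pf right_diff_distrib sum_subtractf)
qed (simp_all add: right_diff_distrib)

lemma LF_const: "LF f (\<lambda>_. a) = LF f (\<lambda>_. 1) * a"
  using LF_scale[of f "\<lambda>_. 1" a] by simp

lemma RF_const: "RF f (\<lambda>_. a) = RF f (\<lambda>_. 1) * a"
  using RF_scale[of f "\<lambda>_. 1" a] by simp

lemma LF_zero: "LF f (\<lambda>_. 0) = 0" "RF f (\<lambda>_. 0) = 0"
  using LF_const[of f 0] RF_const[of f 0] by simp_all

text \<open>The scalar contributed by the grading in which every pair takes all the balance inside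
  it as its grade: such a pair encloses just \<open>top_zeds u\<close> units and yields
  \<open>p (top_zeds u)\<close> by \<open>y_Z_X\<close>.\<close>

primrec scal :: "forest \<Rightarrow> 'a" where
  "scal Leaf = 1"
| "scal (Zf v) = scal v"
| "scal (Pf u v) = p (top_zeds u) * scal u * scal v"

lemma scal_central: "scal f * a = a * scal f"
proof (induction f arbitrary: a)
  case (Pf u v)
  have "scal (Pf u v) * a = p (top_zeds u) * (scal u * (scal v * a))" by (simp add: mult.assoc)
  also have "scal v * a = a * scal v" by (rule Pf)
  also have "scal u * (a * scal v) = a * (scal u * scal v)" by (simp only: Pf(1)[of a] flip: mult.assoc)
  also have "p (top_zeds u) * (a * (scal u * scal v)) = a * scal (Pf u v)"
    by (simp add: mult.assoc p_left)
  finally show ?case .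
qed simp_all

lemma scal_left: "a * (scal f * b) = scal f * (a * b)"
  by (metis mult.assoc scal_central)

text \<open>A \<open>Zed\<close> raises \<open>r\<close> by at most 1 and the balance by exactly 1.
  Across a pair \<open>r\<close> falls from at least 1 to below 1, while the pair leaves a
  nonnegative balance. Hence no balance of the forest lies below \<open>r' - r\<close>.\<close>

lemma forest_vanish:
  assumes "ppath \<rho> \<sigma> (flatten f) (l, r) (l', r')" and "\<And>t. r' - r \<le> real t \<Longrightarrow> \<phi> t = 0"
  shows "LF f \<phi> = 0 \<and> RF f \<phi> = 0"
  using assms
proof (induction f arbitrary: l r \<phi>)
  case (Zf v)
  obtain l1 r1 where 1: "r1 \<le> r + 1" "ppath \<rho> \<sigma> (flatten v) (l1, r1) (l', r')"
    using ppath_ZfE[OF Zf.prems(1)] by metis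
  have "LF v (\<lambda>t. \<phi> (Suc t)) = 0 \<and> RF v (\<lambda>t. \<phi> (Suc t)) = 0"
    by (rule Zf.IH[OF 1(2)]) (use 1 in \<open>auto intro!: Zf.prems(2)\<close>)
  thus ?case by simp
next
  case (Pf u v)
  obtain l1 r1 l2 r2 l3 r3 where 1: "1 \<le> r" "r3 < 1" "ppath \<rho> \<sigma> (flatten v) (l3, r3) (l', r')"
    using ppath_PfE[OF Pf.prems(1)] by metis
  have k: "LF v (\<lambda>s. \<phi> (k + s)) = 0 \<and> RF v (\<lambda>s. \<phi> (k + s)) = 0" for k
    by (rule Pf.IH(2)[OF 1(3)]) (use 1 in \<open>auto intro!: Pf.prems(2)\<close>)
  have "(if i \<le> t then N i * LF v (\<lambda>s. \<phi> (t - i + s)) else 0) = 0"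
    "(if i \<le> t then X * RF v (\<lambda>s. \<phi> (t - i + s)) else 0) = 0" for i t
    by (simp_all only: k mult_zero_right if_cancel)
  thus ?case by (simp add: LF_zero)
qed simp

text \<open>By \<open>A_Z_y\<close> the factor \<open>A\<close> moves to the right, where it meets
  the \<open>inverse A\<close> contained in \<open>N t\<close>; \<open>y_Z_X\<close> evaluates what
  remains.\<close>

lemma central_wrap:
  assumes that: "\<And>b. s * b = b * s"
  shows "A * (s * Z ^ t * (N t * a)) = p t * s * a"
proof -
  have left: "b * (s * c) = s * (b * c)" for b c by (metis mult.assoc that)
  have "A * (s * Z ^ t * (N t * a)) = s * (A * Z ^ t * X * y t) * inverse A * a"
    by (simp add: N_def mult.assoc left)
  also have "\<dots> = s * p t * A * inverse A * a"
    unfolding A_Z_y y_Z_X by (simp add: mult.assoc)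
  also have "\<dots> = s * p t * a" by (simp add: mult.assoc)
  also have "s * p t = p t * s" by (rule that)
  finally show ?thesis .
qed

text \<open>
  Balances at most \<open>l + r' - 1\<close> only come from the grading in which every inner pair has balance
  0, and that grading has a scalar multiple of a power of \<open>Z\<close> as its value.
\<close>

lemma forest_low:
  assumes "ppath \<rho> \<sigma> (flatten f) (l, r) (l', r')" and \<rho>: "real d \<le> \<rho> + \<sigma>"
    and "\<And>t. l + r' - 1 < real t \<Longrightarrow> \<phi> t = 0"
  shows "LF f \<phi> = scal f * Z ^ top_zeds f * \<phi> (top_zeds f) \<and>
         RF f \<phi> = scal f * Z ^ top_zeds f * \<phi> (top_zeds f)"
  using assms(1,3)
proof (induction f arbitrary: l r l' r' \<phi>)
  case (Zf v)
  obtain l1 r1 where 1: "l \<le> l1 + 1" "ppath \<rho> \<sigma> (flatten v) (l1, r1) (l', r')"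
    using ppath_ZfE[OF Zf.prems(1)] by metis
  have "LF v (\<lambda>t. \<phi> (Suc t)) = scal v * Z ^ top_zeds v * \<phi> (Suc (top_zeds v)) \<and>
        RF v (\<lambda>t. \<phi> (Suc t)) = scal v * Z ^ top_zeds v * \<phi> (Suc (top_zeds v))"
    by (rule Zf.IH[OF 1(2)]) (use 1 in \<open>auto intro!: Zf.prems(2)\<close>)
  moreover have "Z * (scal v * Z ^ top_zeds v * a) = scal v * (Z * Z ^ top_zeds v) * a" for a
    by (simp add: mult.assoc scal_left)
  ultimately show ?case by simp
next
  case (Pf u v)
  obtain l1 r1 l2 r2 l3 r3 where 1: "1 \<le> r" "0 \<le> l" "l < 1" "l + \<sigma> \<le> l1"
    "ppath \<rho> \<sigma> (flatten u) (l1, r1) (l2, r2)" "r3 + \<rho> \<le> r2" "0 \<le> r3" "r3 < 1" "1 \<le> l3"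
    "ppath \<rho> \<sigma> (flatten v) (l3, r3) (l', r')"
    using ppath_PfE[OF Pf.prems(1)] by metis
  \<comment> \<open>If the pair leaves \<open>k \<ge> 1\<close>, the total balance is at least
    \<open>1 + r' - r3\<close>, which exceeds \<open>r'\<close> and hence \<open>l + r' - 1\<close>.
    So only grades equal to the inner balance survive.\<close>
  have k: "LF v (\<lambda>s. \<phi> (k + s)) = 0 \<and> RF v (\<lambda>s. \<phi> (k + s)) = 0" if "0 < k" for k
    by (rule forest_vanish[OF 1(10)]) (use 1 that in \<open>auto intro!: Pf.prems(2)\<close>)
  define b where "b = scal v * Z ^ top_zeds v * \<phi> (top_zeds v)"
  have v: "LF v \<phi> = b" "RF v \<phi> = b"
    using Pf.IH(2)[OF 1(10), of \<phi>] Pf.prems(2) 1 unfolding b_def by auto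
  \<comment> \<open>Every balance of \<open>v\<close> is at least \<open>r' - r3\<close>, which then
    exceeds \<open>l + r' - 1\<close>.\<close>
  have b: "b = 0" if "l + r3 < 1"
    using forest_vanish[OF 1(10), of \<phi>] v that Pf.prems(2) by auto
  let ?t = "top_zeds u"
  have ifk: "(if i \<le> t then N i * LF v (\<lambda>s. \<phi> (t - i + s)) else 0) = (if i = t then N t * b else 0)"
    "(if i \<le> t then X * RF v (\<lambda>s. \<phi> (t - i + s)) else 0) = (if i = t then X * b else 0)" for i t
    using k[of "t - i"] v by auto
  \<comment> \<open>Here \<open>\<rho> + \<sigma> \<ge> d\<close> enters:
    \<open>l1 + r2 \<ge> l + r3 + d\<close>, so an inner balance beyond the low range that is still
    an allowed grade forces \<open>l + r3 < 1\<close>.\<close>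
  have low: "b = 0" if "d \<ge> t" "l1 + r2 - 1 < real t" for t :: nat
    by (rule b) (use that \<rho> 1 in linarith)
  have L: "LF u (\<lambda>t. if t \<le> d then N t * b else 0) = scal u * Z ^ ?t * (if ?t \<le> d then N ?t * b else 0)"
    by (rule Pf.IH(1)[OF 1(5), THEN conjunct1]) (use low in auto)
  have R: "RF u (\<lambda>t. if i = t then X * b else 0) = scal u * Z ^ ?t * (if i = ?t then X * b else 0)"
    if "i \<le> d" for i
    by (rule Pf.IH(1)[OF 1(5), THEN conjunct2]) (use low that in auto)
  have goal: "scal (Pf u v) * Z ^ top_zeds (Pf u v) * \<phi> (top_zeds (Pf u v)) = p ?t * scal u * b"
    by (simp add: b_def mult.assoc)
  have "LF (Pf u v) \<phi> = A * (scal u * Z ^ ?t * (if ?t \<le> d then N ?t * b else 0))"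
    by (simp add: ifk L)
  hence 1: "LF (Pf u v) \<phi> = p ?t * scal u * b"
    using central_wrap[where s = "scal u" and t = ?t and a = b, OF scal_central] p_zero[of ?t] by (cases "?t \<le> d") simp_all
  have "RF (Pf u v) \<phi> = (\<Sum>i\<le>d. y i * (scal u * Z ^ ?t * (if i = ?t then X * b else 0)))"
    by (simp add: ifk R)
  also have "\<dots> = (\<Sum>i\<le>d. if i = ?t then y ?t * (scal u * Z ^ ?t * (X * b)) else 0)"
    by (intro sum.cong) auto
  also have "\<dots> = (if ?t \<le> d then y ?t * (scal u * Z ^ ?t * (X * b)) else 0)" by simp
  also have "y ?t * (scal u * Z ^ ?t * (X * b)) = scal u * (y ?t * Z ^ ?t * X) * b"
    by (simp add: mult.assoc scal_left)
  also have "\<dots> = p ?t * scal u * b" by (simp only: y_Z_X scal_central)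
  also have "(if ?t \<le> d then p ?t * scal u * b else 0) = p ?t * scal u * b" using p_zero[of ?t] by auto
  finally show ?case using 1 goal by simp
qed simp

text \<open>For a pair, the grades \<open>i \<le> t\<close> are all grades minus those with
  \<open>i > t\<close>. The full sums agree by induction. The excluded grades require
  \<open>t < d\<close>, and \<open>l1 + r2 \<ge> \<rho> + \<sigma> \<ge> d\<close> places such
  \<open>t\<close> in the range of \<open>forest_low\<close>; there the inner value is a scalar
  times \<open>Z ^ t\<close> and \<open>A_Z_y\<close> matches the corrections.\<close>

lemma forest_total:
  assumes "ppath \<rho> \<sigma> (flatten f) (l, r) (l', r')" and \<rho>: "real d \<le> \<rho> + \<sigma>"
  shows "LF f (\<lambda>_. 1) = RF f (\<lambda>_. 1)"
  using assms(1)
proof (induction f arbitrary: l r l' r')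
  case (Zf v)
  obtain l1 r1 where "ppath \<rho> \<sigma> (flatten v) (l1, r1) (l', r')"
    using ppath_ZfE[OF Zf.prems] by metis
  from Zf.IH[OF this] show ?case by simp
next
  case (Pf u v)
  obtain l1 r1 l2 r2 l3 r3 where 1: "1 \<le> r" "0 \<le> l" "l < 1" "l + \<sigma> \<le> l1"
    "ppath \<rho> \<sigma> (flatten u) (l1, r1) (l2, r2)" "r3 + \<rho> \<le> r2" "0 \<le> r3" "r3 < 1" "1 \<le> l3"
    "ppath \<rho> \<sigma> (flatten v) (l3, r3) (l', r')"
    using ppath_PfE[OF Pf.prems(1)] by metis
  define b where "b = RF v (\<lambda>_. 1)"
  define W where "W = RF u (\<lambda>_. 1)"
  have v: "LF v (\<lambda>_. 1) = b" using Pf.IH(2)[OF 1(10)] by (simp add: b_def)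
  have u: "LF u (\<lambda>_. 1) = W" using Pf.IH(1)[OF 1(5)] by (simp add: W_def)
  let ?t = "top_zeds u"
  let ?s = "scal u * Z ^ ?t"
  \<comment> \<open>The excluded grades, with the common right factor \<open>inverse A\<close> of
    the \<open>N i\<close> removed.\<close>
  let ?hi = "\<lambda>t i. if t < i then X * y i else 0"
  have bd: "real d - 1 < real t" if "l1 + r2 - 1 < real t" for t :: nat
    using that \<rho> 1 by linarith
  have L1: "LF u (\<lambda>t. \<Sum>i\<le>d. ?hi t i) = ?s * (\<Sum>i\<le>d. ?hi ?t i)"
  proof (rule forest_low[OF 1(5) \<rho>, THEN conjunct1])
    fix t :: nat assume "l1 + r2 - 1 < real t"
    hence "d \<le> t" using bd[of t] by linarith
    thus "(\<Sum>i\<le>d. ?hi t i) = 0" by (intro sum.neutral) auto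
  qed
  have R1: "RF u (\<lambda>t. if t < i then X * b else 0) = ?s * (if ?t < i then X * b else 0)" if "i \<le> d" for i
  proof (rule forest_low[OF 1(5) \<rho>, THEN conjunct2])
    fix t :: nat assume "l1 + r2 - 1 < real t"
    hence "i \<le> t" using bd[of t] that by linarith
    thus "(if t < i then X * b else 0) = 0" by auto
  qed
  have XA: "X * A = (\<Sum>i\<le>d. X * y i)" by (simp add: A_eq sum_distrib_left)
  have "(\<Sum>i\<le>d. if i \<le> t then N i * b else 0) = (X * A - (\<Sum>i\<le>d. ?hi t i)) * (inverse A * b)" for t
  proof -
    have "(X * A - (\<Sum>i\<le>d. ?hi t i)) * (inverse A * b) =
        (\<Sum>i\<le>d. (X * y i - ?hi t i) * (inverse A * b))"
      unfolding XA by (simp only: sum_distrib_left sum_distrib_right flip: sum_subtractf)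
    also have "\<dots> = (\<Sum>i\<le>d. if i \<le> t then N i * b else 0)"
      by (intro sum.cong refl) (auto simp: N_def mult.assoc)
    finally show ?thesis by simp
  qed
  hence "LF (Pf u v) (\<lambda>_. 1) = A * ((W * (X * A) - ?s * (\<Sum>i\<le>d. ?hi ?t i)) * (inverse A * b))"
    by (simp only: LF.simps v LF_scale LF_diff L1) (simp add: LF_const[of _ X] u mult.assoc)
  also have "\<dots> = (A * W * X) * b - (\<Sum>i\<le>d. A * ?s * ?hi ?t i) * inverse A * b"
    by (simp only: left_diff_distrib right_diff_distrib sum_distrib_left sum_distrib_right mult.assoc
        cancel)
  also have "(\<Sum>i\<le>d. A * ?s * ?hi ?t i) = (\<Sum>i\<le>d. if ?t < i then y i * ?s * X else 0) * A"
    unfolding sum_distrib_right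
  proof (intro sum.cong refl)
    fix i
    have "A * ?s * (X * y i) = scal u * (A * Z ^ ?t * X * y i)"
      by (simp add: mult.assoc scal_left)
    also have "\<dots> = y i * ?s * X * A"
      unfolding A_Z_y by (simp add: mult.assoc scal_left)
    finally show "A * ?s * ?hi ?t i = (if ?t < i then y i * ?s * X else 0) * A" by simp
  qed
  also have "\<dots> * inverse A * b = (\<Sum>i\<le>d. if ?t < i then y i * ?s * X * b else 0)"
    by (simp add: mult.assoc sum_distrib_right) (intro sum.cong refl, simp add: mult.assoc)
  finally have L: "LF (Pf u v) (\<lambda>_. 1) = A * W * X * b - (\<Sum>i\<le>d. if ?t < i then y i * ?s * X * b else 0)" .
  have ifd: "(\<lambda>t. if i \<le> t then X * b else 0) = (\<lambda>t. X * b - (if t < i then X * b else 0))" for i :: nat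
    by auto
  have "RF (Pf u v) (\<lambda>_. 1) = (\<Sum>i\<le>d. y i * (W * (X * b) - ?s * (if ?t < i then X * b else 0)))"
  proof -
    have "RF (Pf u v) (\<lambda>_. 1) = (\<Sum>i\<le>d. y i * RF u (\<lambda>t. if i \<le> t then X * b else 0))"
      unfolding b_def by simp
    thus ?thesis unfolding ifd RF_diff by (simp add: R1 RF_const[of _ "X * b"] W_def)
  qed
  also have "\<dots> = A * W * X * b - (\<Sum>i\<le>d. if ?t < i then y i * ?s * X * b else 0)"
    unfolding right_diff_distrib sum_subtractf A_eq sum_distrib_right
    by (intro arg_cong2[of _ _ _ _ "(-)"] sum.cong refl) (auto simp: mult.assoc)
  finally show ?case using L by simp
qed simp

section \<open>Words with unmatched brackets\<close>

lemma sumL_no_close: "no_close w \<Longrightarrow> sumL w st = sumL w []"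
proof (induction arbitrary: st rule: no_close.induct)
  case (nc_forest f)
  show ?case using sumL_flatten[of f "[]"] by simp
next
  case (nc_open w f)
  show ?case unfolding sumL_flatten by (simp add: nc_open.IH[of "0 # st" for st])
qed

lemma sumR_no_close: "no_close w \<Longrightarrow> sumR w st = sumR w []"
proof (induction arbitrary: st rule: no_close.induct)
  case (nc_forest f)
  show ?case using sumR_flatten[of f "[]"] by simp
next
  case (nc_open w f)
  show ?case unfolding sumR_flatten by (simp add: nc_open.IH[of "_ # _"])
qed

lemma sumL_sumR_no_close:
  assumes "no_close w" "ppath \<rho> \<sigma> w s t" "real d \<le> \<rho> + \<sigma>"
  shows "sumL w [] = sumR w []"
  using assms(1,2)
proof (induction arbitrary: s rule: no_close.induct)
  case (nc_forest f)
  thus ?case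
    using sumL_flatten[of f "[]" "[]"] sumR_flatten[of f "[]" "[]"] forest_total[OF _ assms(3), of f]
    by (cases s; cases t) auto
next
  case (nc_open w f)
  then obtain s1 s2 where 1: "ppath \<rho> \<sigma> (flatten f) s s1" "ppath \<rho> \<sigma> w s2 t"
    by (auto simp: ppath_append)
  have f: "LF f (\<lambda>_. 1) = RF f (\<lambda>_. 1)"
    using forest_total[OF _ assms(3), of f] 1(1) by (cases s; cases s1) auto
  have "sumL w (0 # st) = sumL w []" "sumR w (x # st') = sumR w []" for st st' x
    using sumL_no_close sumR_no_close nc_open.hyps by blast+
  hence "sumL (flatten f @ Opn # w) [] = LF f (\<lambda>_. A * sumL w [])"
    "sumR (flatten f @ Opn # w) [] = RF f (\<lambda>_. A * sumR w [])"
    unfolding sumL_flatten sumR_flatten by (simp_all add: sum_y flip: sum_distrib_right)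
  thus ?case using nc_open.IH[OF 1(2)] f by (simp only: LF_const[of _ "A * _"] RF_const[of _ "A * _"])
qed

text \<open>Unmatched brackets cut the word into forests, on which \<open>forest_total\<close>
  applies, and have free grades, so they contribute \<open>A\<close> or \<open>X\<close> on both
  sides. The cut is made at the first unmatched closing bracket, where the stack is empty
  again.\<close>

theorem sumL_eq_sumR:
  assumes "ppath \<rho> \<sigma> w s t" "real d \<le> \<rho> + \<sigma>"
  shows "sumL w [] = sumR w []"
  using assms(1)
proof (induction "length w" arbitrary: w s rule: less_induct)
  case less
  show ?case
  proof (cases "no_close w")
    case True
    thus ?thesis using sumL_sumR_no_close less.prems assms(2) by blast
  next
    case False
    then obtain f w' where w: "w = flatten f @ Cls # w'" using word_cases by blast
    then obtain s1 s2 where 1: "ppath \<rho> \<sigma> (flatten f) s s1" "ppath \<rho> \<sigma> w' s2 t"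
      using less.prems by (auto simp: ppath_append)
    have f: "LF f (\<lambda>_. 1) = RF f (\<lambda>_. 1)"
      using forest_total[OF _ assms(2), of f] 1(1) by (cases s; cases s1) auto
    have "sumL w [] = LF f (\<lambda>_. X * sumL w' [])" "sumR w [] = RF f (\<lambda>_. X * sumR w' [])"
      unfolding w sumL_flatten sumR_flatten by (simp_all add: sum_N flip: sum_distrib_right)
    moreover have "sumL w' [] = sumR w' []" using less.hyps[OF _ 1(2)] w by simp
    ultimately show ?thesis using f by (simp only: LF_const[of _ "X * _"] RF_const[of _ "X * _"])
  qed
qed

end

section \<open>Sums over graded words\<close>

definition glists :: "(step \<Rightarrow> nat) \<Rightarrow> step list \<Rightarrow> gword set" where
  "glists b w = {g. map fst g = w \<and> (\<forall>(s, a)\<in>set g. a \<le> b s)}"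

lemma glists_Nil: "glists b [] = {[]}"
  by (auto simp: glists_def)

lemma glists_Cons: "glists b (s # w) = (\<lambda>(a, g). (s, a) # g) ` ({..b s} \<times> glists b w)"
proof
  show "glists b (s # w) \<subseteq> (\<lambda>(a, g). (s, a) # g) ` ({..b s} \<times> glists b w)"
  proof
    fix g assume "g \<in> glists b (s # w)"
    then obtain a g' where "g = (s, a) # g'" "a \<le> b s" "g' \<in> glists b w"
      unfolding glists_def by (cases g) auto
    thus "g \<in> (\<lambda>(a, g). (s, a) # g) ` ({..b s} \<times> glists b w)" by auto
  qed
qed (auto simp: glists_def)

lemma sum_glists_Cons:
  fixes f :: "gword \<Rightarrow> 'b::comm_monoid_add"
  shows "(\<Sum>g\<in>glists b (s # w). f g) = (\<Sum>a\<le>b s. \<Sum>g\<in>glists b w. f ((s, a) # g))"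
proof -
  have "inj_on (\<lambda>(a, g). (s, a) # g) ({..b s} \<times> glists b w)" by (auto simp: inj_on_def)
  thus ?thesis
    unfolding glists_Cons by (simp add: sum.reindex sum.cartesian_product case_prod_unfold)
qed

definition clists :: "nat \<Rightarrow> nat \<Rightarrow> nat list set" where
  "clists D n = {cs. set cs \<subseteq> {..D} \<and> length cs = n}"

lemma sum_clists_0: "(\<Sum>cs\<in>clists D 0. f cs) = f []"
proof -
  have "clists D 0 = {[]}" by (auto simp: clists_def)
  thus ?thesis by simp
qed

lemma sum_clists_Suc:
  fixes f :: "nat list \<Rightarrow> 'b::comm_monoid_add"
  shows "(\<Sum>cs\<in>clists D (Suc n). f cs) = (\<Sum>c\<le>D. \<Sum>cs\<in>clists D n. f (c # cs))"
proof -
  have "inj_on (\<lambda>(cs, c). c # cs) (clists D n \<times> {..D})" by (auto simp: inj_on_def)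
  hence "(\<Sum>cs\<in>clists D (Suc n). f cs) = (\<Sum>(cs, c)\<in>clists D n \<times> {..D}. f (c # cs))"
    unfolding clists_def lists_length_Suc_eq by (simp add: sum.reindex case_prod_unfold)
  also have "\<dots> = (\<Sum>cs\<in>clists D n. \<Sum>c\<le>D. f (c # cs))"
    by (rule sum.cartesian_product[symmetric])
  also have "\<dots> = (\<Sum>c\<le>D. \<Sum>cs\<in>clists D n. f (c # cs))" by (rule sum.swap)
  finally show ?thesis .
qed

definition block_word :: "(nat \<times> nat) list \<Rightarrow> letter list" where
  "block_word cks = concat (map (\<lambda>(c, k). replicate c Opn @ replicate k Cls @ [Zed]) cks)"

text \<open>By truncated subtraction each block keeps brackets of one kind only. This form depends
  on the differences \<open>c - k\<close> alone, so it is shared by the two paths.\<close>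

definition reduced_word :: "(nat \<times> nat) list \<Rightarrow> letter list" where
  "reduced_word cks = block_word (map (\<lambda>(c, k). (c - k, k - c)) cks)"

lemma block_word_simps:
  "block_word [] = []"
  "block_word ((c, k) # cks) = replicate c Opn @ replicate k Cls @ Zed # block_word cks"
  by (simp_all add: block_word_def)

definition east_word :: "nat list \<Rightarrow> step list" where
  "east_word ks = concat (map (\<lambda>k. East # replicate k North) ks)"

definition north_word :: "nat \<Rightarrow> nat list \<Rightarrow> step list" where
  "north_word D ks = concat (map (\<lambda>k. replicate (D - k) East @ [North]) ks)"

fun step_bound :: "nat \<Rightarrow> nat \<Rightarrow> step \<Rightarrow> nat" where
  "step_bound dE dN East = dE"
| "step_bound dE dN North = dN"

context kontsevich
begin

subsection \<open>Cancellation of adjacent brackets\<close>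

lemma sumL_cong: "(\<And>st. sumL w st = sumL w' st) \<Longrightarrow> sumL (x @ w) st = sumL (x @ w') st"
  by (induction x arbitrary: st) (auto split: letter.split list.split cong: if_cong)

lemma sumR_cong: "(\<And>st. sumR w st = sumR w' st) \<Longrightarrow> sumR (x @ w) st = sumR (x @ w') st"
  by (induction x arbitrary: st) (auto split: letter.split list.split)

text \<open>An empty pair has balance 0, so its grade is 0 and its weight is
  \<open>A * N 0 = 1\<close>. On the other side it is \<open>y 0 * X = 1\<close>; both use that the
  constant coefficient is 1.\<close>

lemma sumL_cancel: "sumL (Opn # Cls # w) st = sumL w st"
proof -
  have "(\<Sum>i\<le>d. if i = 0 then N i * sumL w (bump (0 - i) st) else 0) = N 0 * sumL w st"
    by (subst sum.delta) simp_all
  thus ?thesis by (simp add: N0)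
qed

lemma sumR_cancel: "sumR (Opn # Cls # w) st = sumR w st"
proof -
  have "(\<Sum>i\<le>d. y i * (if i = 0 then X * sumR w (bump (- int i) st) else 0)) = y 0 * (X * sumR w st)"
    by (subst sum.mono_neutral_right[of _ "{0}"]) auto
  thus ?thesis by (simp add: y0)
qed

lemma sumL_reduce:
  "sumL (replicate c Opn @ replicate k Cls @ w) st =
   sumL (replicate (c - k) Opn @ replicate (k - c) Cls @ w) st"
proof (induction c k rule: diff_induct)
  case (3 c k)
  have "sumL (replicate (Suc c) Opn @ replicate (Suc k) Cls @ w) st =
      sumL (replicate c Opn @ (Opn # Cls # replicate k Cls @ w)) st"
    by (simp add: replicate_app_Cons_same)
  also have "\<dots> = sumL (replicate c Opn @ (replicate k Cls @ w)) st"
    by (rule sumL_cong) (rule sumL_cancel)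
  finally show ?case using 3 by simp
qed simp_all

lemma sumR_reduce:
  "sumR (replicate c Opn @ replicate k Cls @ w) st =
   sumR (replicate (c - k) Opn @ replicate (k - c) Cls @ w) st"
proof (induction c k rule: diff_induct)
  case (3 c k)
  have "sumR (replicate (Suc c) Opn @ replicate (Suc k) Cls @ w) st =
      sumR (replicate c Opn @ (Opn # Cls # replicate k Cls @ w)) st"
    by (simp add: replicate_app_Cons_same)
  also have "\<dots> = sumR (replicate c Opn @ (replicate k Cls @ w)) st"
    by (rule sumR_cong) (rule sumR_cancel)
  finally show ?case using 3 by simp
qed simp_all

lemma sumL_reduced_word: "sumL (block_word cks) st = sumL (reduced_word cks) st"
proof (induction cks arbitrary: st)
  case (Cons ck cks)
  obtain c k where ck: "ck = (c, k)" by force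
  let ?x = "replicate (c - k) Opn @ replicate (k - c) Cls @ [Zed]"
  have "sumL (block_word (ck # cks)) st = sumL (?x @ block_word cks) st"
    by (simp only: ck block_word_simps append_assoc append_Cons append_Nil) (rule sumL_reduce)
  also have "\<dots> = sumL (?x @ reduced_word cks) st" by (rule sumL_cong) (rule Cons)
  finally show ?case by (simp add: ck reduced_word_def block_word_simps)
qed (simp add: reduced_word_def)

lemma sumR_reduced_word: "sumR (block_word cks) st = sumR (reduced_word cks) st"
proof (induction cks arbitrary: st)
  case (Cons ck cks)
  obtain c k where ck: "ck = (c, k)" by force
  let ?x = "replicate (c - k) Opn @ replicate (k - c) Cls @ [Zed]"
  have "sumR (block_word (ck # cks)) st = sumR (?x @ block_word cks) st"
    by (simp only: ck block_word_simps append_assoc append_Cons append_Nil) (rule sumR_reduce)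
  also have "\<dots> = sumR (?x @ reduced_word cks) st" by (rule sumR_cong) (rule Cons)
  finally show ?case by (simp add: ck reduced_word_def block_word_simps)
qed (simp add: reduced_word_def)

subsection \<open>Reading off bracket words from graded words\<close>

fun weightR :: "(nat \<Rightarrow> 'a) \<Rightarrow> nat \<Rightarrow> step \<times> nat \<Rightarrow> 'a" where
  "weightR q D (East, a) = y a"
| "weightR q D (North, a) = q (D - a) * X ^ a * Z"

text \<open>Images under \<open>F\<close> of the edge weights for \<open>P2\<close> and the reversal
  of \<open>P1\<close>, as \<open>F_edge_wt\<close> shows.\<close>

fun weightL :: "(nat \<Rightarrow> 'a) \<Rightarrow> step \<times> nat \<Rightarrow> 'a" where
  "weightL q (East, c) = q c * A ^ c * Z"
| "weightL q (North, a) = inverse Z * N a * Z"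

definition edgeR :: "(nat \<Rightarrow> 'a) \<Rightarrow> nat \<Rightarrow> step list \<Rightarrow> int list \<Rightarrow> 'a" where
  "edgeR q D w st =
     (\<Sum>g\<in>glists (step_bound d D) w. if runR st g then prod_list (map (weightR q D) g) else 0)"

definition edgeL :: "(nat \<Rightarrow> 'a) \<Rightarrow> nat \<Rightarrow> step list \<Rightarrow> nat list \<Rightarrow> 'a" where
  "edgeL q D w st =
     (\<Sum>g\<in>glists (step_bound D d) w. if runL st g then prod_list (map (weightL q) g) else 0)"

lemma Z_neq_0: "Z \<noteq> 0"
  using XY by (simp add: Z_def)

lemma Z_cancel: "Z * (inverse Z * a) = a"
  using Z_neq_0 by (simp flip: mult.assoc)

lemma edgeR_Nil: "edgeR q D [] st = 1"
  by (simp add: edgeR_def glists_Nil)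

lemma edgeR_East: "edgeR q D (East # w) st = (\<Sum>i\<le>d. y i * edgeR q D w (- int i # st))"
  unfolding edgeR_def sum_glists_Cons sum_distrib_left
  by (intro sum.cong) auto

lemma edgeR_North:
  "edgeR q D (North # w) st = (\<Sum>a\<le>D. case pops a st of None \<Rightarrow> 0
     | Some st' \<Rightarrow> q (D - a) * X ^ a * Z * edgeR q D w (bump 1 st'))"
  unfolding edgeR_def sum_glists_Cons
  by (intro sum.cong) (auto simp: sum_distrib_left split: option.split intro!: sum.cong)

lemma sumR_pops:
  "sumR (replicate a Cls @ Zed # w) st =
   (case pops a st of None \<Rightarrow> 0 | Some st' \<Rightarrow> X ^ a * Z * sumR w (bump 1 st'))"
proof (induction a st rule: pops.induct)
  case (2 c)
  have "pops c [] = Some []" for c by (cases c) simp_all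
  moreover from this have "sumR (replicate c Cls @ Zed # w) [] = X ^ c * Z * sumR w []" for c
    by (induction c) (simp_all add: mult.assoc)
  ultimately show ?case by (simp add: mult.assoc)
next
  case (3 c t st)
  thus ?case by (auto simp: mult.assoc split: option.split)
qed simp

lemma edgeL_Nil: "edgeL q D [] st = 1"
  by (simp add: edgeL_def glists_Nil)

text \<open>A factor \<open>Z\<close> is kept in front. It cancels the \<open>inverse Z\<close> of
  every vertical weight and serves as the \<open>Zed\<close> of each horizontal edge, which must
  precede the brackets because \<open>runL\<close> bumps before it pushes.\<close>

lemma edgeL_East:
  "Z * edgeL q D (East # w) st =
   (\<Sum>c\<le>D. Z * (q c * A ^ c * (Z * edgeL q D w (replicate c 0 @ bump 1 st))))"
  unfolding edgeL_def sum_glists_Cons sum_distrib_left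
  by (intro sum.cong) (auto simp: mult.assoc)

lemma edgeL_North_Nil:
  "Z * edgeL q D (North # w) [] = (\<Sum>i\<le>d. N i * (Z * edgeL q D w []))"
  unfolding edgeL_def sum_glists_Cons sum_distrib_left
  by (intro sum.cong) (auto simp: mult.assoc Z_cancel sum_distrib_left intro!: sum.cong)

lemma edgeL_North_Cons:
  "Z * edgeL q D (North # w) (t # st) =
   (\<Sum>i\<le>d. if i \<le> t then N i * (Z * edgeL q D w (bump (t - i) st)) else 0)"
  unfolding edgeL_def sum_glists_Cons sum_distrib_left
  by (intro sum.cong) (auto simp: mult.assoc Z_cancel sum_distrib_left intro!: sum.cong)

context
  fixes q :: "nat \<Rightarrow> 'a" and D :: nat
  assumes q_central: "\<And>i u. q i * u = u * q i"
begin

definition Q :: "nat list \<Rightarrow> 'a" where "Q cs = prod_list (map q cs)"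

lemma Q_simps: "Q [] = 1" "Q (c # cs) = q c * Q cs"
  by (simp_all add: Q_def)

lemma q_left: "a * (q i * b) = q i * (a * b)"
  by (metis mult.assoc q_central)

lemma Q_left: "a * (Q cs * b) = Q cs * (a * b)"
proof (induction cs arbitrary: a b)
  case (Cons c cs)
  have "a * (Q (c # cs) * b) = a * (q c * (Q cs * b))" by (simp add: Q_simps mult.assoc)
  also have "\<dots> = q c * (Q cs * (a * b))" by (simp only: q_left[of a] Cons[of a])
  finally show ?case by (simp add: Q_simps mult.assoc)
qed (simp add: Q_simps)

lemma edgeR_north_word:
  "edgeR q D (north_word D ks) st =
   (\<Sum>cs\<in>clists D (length ks). Q cs *
      sumR (block_word (map (\<lambda>(c, k). (D - k, D - c)) (zip cs ks))) st)"
proof (induction ks arbitrary: st)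
  case Nil
  show ?case by (simp add: north_word_def edgeR_Nil sum_clists_0 Q_simps block_word_simps)
next
  case (Cons k ks)
  let ?V = "\<lambda>cs. block_word (map (\<lambda>(c, k). (D - k, D - c)) (zip cs ks))"
  let ?I = "clists D (length ks)"
  have N: "edgeR q D (North # north_word D ks) st =
      (\<Sum>c\<le>D. \<Sum>cs\<in>?I. Q (c # cs) * sumR (replicate (D - c) Cls @ Zed # ?V cs) st)" for st
  proof -
    \<comment> \<open>The vertical grade is written as \<open>D - c\<close>, so that its coefficient
      becomes \<open>q c\<close> as on the other side.\<close>
    have "edgeR q D (North # north_word D ks) st = (\<Sum>c\<le>D. case pops (D - c) st of None \<Rightarrow> 0
       | Some st' \<Rightarrow> q (D - (D - c)) * X ^ (D - c) * Z * edgeR q D (north_word D ks) (bump 1 st'))"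
      unfolding edgeR_North by (rule sum.reindex_bij_witness[of _ "\<lambda>c. D - c" "\<lambda>c. D - c"])
         (auto split: option.split)
    also have "\<dots> = (\<Sum>c\<le>D. \<Sum>cs\<in>?I. Q (c # cs) * sumR (replicate (D - c) Cls @ Zed # ?V cs) st)"
      unfolding Cons sumR_pops
      by (intro sum.cong refl)
         (auto simp: Q_simps sum_distrib_left mult.assoc Q_left split: option.split intro!: sum.cong)
    finally show ?thesis .
  qed
  have "edgeR q D (replicate n East @ North # north_word D ks) st =
      (\<Sum>c\<le>D. \<Sum>cs\<in>?I. Q (c # cs) * sumR (replicate n Opn @ replicate (D - c) Cls @ Zed # ?V cs) st)"
    for n st
  proof (induction n arbitrary: st)
    case (Suc n)
    have "edgeR q D (replicate (Suc n) East @ North # north_word D ks) st =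
       (\<Sum>i\<le>d. \<Sum>c\<le>D. \<Sum>cs\<in>?I. Q (c # cs) * (y i *
           sumR (replicate n Opn @ replicate (D - c) Cls @ Zed # ?V cs) (- int i # st)))"
      by (simp add: edgeR_East Suc sum_distrib_left Q_left)
    also have "\<dots> = (\<Sum>c\<le>D. \<Sum>cs\<in>?I. \<Sum>i\<le>d. Q (c # cs) * (y i *
           sumR (replicate n Opn @ replicate (D - c) Cls @ Zed # ?V cs) (- int i # st)))"
      by (subst sum.swap) (intro sum.cong refl sum.swap)
    finally show ?case by (simp add: sum_distrib_left)
  qed (simp add: N)
  thus ?case by (simp add: north_word_def sum_clists_Suc block_word_simps)
qed

lemma edgeL_east_word_aux:
  "Z * edgeL q D (east_word ks) st =
   (\<Sum>cs\<in>clists D (length ks). Q cs * sumL (Zed # block_word (zip cs ks)) st)"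
proof (induction ks arbitrary: st)
  case Nil
  show ?case by (simp add: east_word_def edgeL_Nil sum_clists_0 Q_simps block_word_simps)
next
  case (Cons k ks)
  let ?V = "\<lambda>cs. Zed # block_word (zip cs ks)"
  let ?I = "clists D (length ks)"
  have N: "Z * edgeL q D (replicate n North @ east_word ks) st =
      (\<Sum>cs\<in>?I. Q cs * sumL (replicate n Cls @ ?V cs) st)" for n st
  proof (induction n arbitrary: st)
    case (Suc n)
    show ?case
    proof (cases st)
      case Nil
      have "Z * edgeL q D (replicate (Suc n) North @ east_word ks) st =
         (\<Sum>i\<le>d. \<Sum>cs\<in>?I. Q cs * (N i * sumL (replicate n Cls @ ?V cs) []))"
        by (simp add: Nil edgeL_North_Nil Suc sum_distrib_left Q_left del: sumL.simps)
      also have "\<dots> = (\<Sum>cs\<in>?I. \<Sum>i\<le>d. Q cs * (N i * sumL (replicate n Cls @ ?V cs) []))"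
        by (rule sum.swap)
      finally show ?thesis using Nil by (simp add: sum_distrib_left)
    next
      case st: (Cons t st')
      have "Z * edgeL q D (replicate (Suc n) North @ east_word ks) st =
         (\<Sum>i\<le>d. \<Sum>cs\<in>?I. Q cs * (if i \<le> t then N i * sumL (replicate n Cls @ ?V cs) (bump (t - i) st') else 0))"
        by (simp add: st edgeL_North_Cons del: sumL.simps)
           (intro sum.cong refl, simp add: Suc sum_distrib_left Q_left del: sumL.simps)
      also have "\<dots> = (\<Sum>cs\<in>?I. \<Sum>i\<le>d. Q cs * (if i \<le> t then N i * sumL (replicate n Cls @ ?V cs) (bump (t - i) st') else 0))"
        by (rule sum.swap)
      finally show ?thesis using st by (simp add: sum_distrib_left)
    qed
  qed (simp add: Cons)
  have O: "sumL (replicate c Opn @ w) st = A ^ c * sumL w (replicate c 0 @ st)" for c w st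
  proof (induction c arbitrary: st)
    case (Suc c)
    show ?case by (simp add: Suc mult.assoc replicate_app_Cons_same)
  qed simp
  have "Z * edgeL q D (East # replicate k North @ east_word ks) st =
      (\<Sum>c\<le>D. \<Sum>cs\<in>?I. Q (c # cs) * sumL (Zed # replicate c Opn @ replicate k Cls @ ?V cs) st)"
    unfolding edgeL_East N
    by (intro sum.cong refl) (simp add: O sum_distrib_left Q_simps mult.assoc Q_left q_left[of Z])
  thus ?case by (simp add: east_word_def sum_clists_Suc block_word_simps)
qed

text \<open>The auxiliary \<open>Z\<close> is the leading \<open>Zed\<close> of the word; on the
  empty stack it bumps nothing and can be cancelled.\<close>

lemma edgeL_east_word:
  "edgeL q D (east_word ks) [] = (\<Sum>cs\<in>clists D (length ks). Q cs * sumL (block_word (zip cs ks)) [])"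
proof -
  have "Z * edgeL q D (east_word ks) [] = Z * (\<Sum>cs\<in>clists D (length ks). Q cs * sumL (block_word (zip cs ks)) [])"
    unfolding edgeL_east_word_aux by (simp add: sum_distrib_left Q_left)
  thus ?thesis using Z_neq_0 by simp
qed

theorem edgeL_eq_edgeR:
  assumes ks: "set ks \<subseteq> {..D}" and \<rho>: "real d \<le> \<rho> + \<sigma>"
    and path: "\<And>cs. cs \<in> clists D (length ks) \<Longrightarrow> \<exists>s t. ppath \<rho> \<sigma> (reduced_word (zip cs ks)) s t"
  shows "edgeL q D (east_word ks) [] = edgeR q D (north_word D ks) []"
  unfolding edgeL_east_word edgeR_north_word
proof (intro sum.cong refl arg_cong2[of _ _ _ _ "(*)"])
  fix cs assume cs: "cs \<in> clists D (length ks)"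
  have "sumL (block_word (zip cs ks)) [] = sumR (reduced_word (zip cs ks)) []"
    unfolding sumL_reduced_word using path[OF cs] sumL_eq_sumR[OF _ \<rho>] by blast
  also have "reduced_word (zip cs ks) = reduced_word (map (\<lambda>(c, k). (D - k, D - c)) (zip cs ks))"
  proof -
    \<comment> \<open>The bounds \<open>c \<le> D\<close> and \<open>k \<le> D\<close> are needed
      because subtraction is truncated.\<close>
    have "c - k = D - k - (D - c) \<and> k - c = D - c - (D - k)" if "(c, k) \<in> set (zip cs ks)" for c k
    proof -
      have "c \<in> set cs" "k \<in> set ks" using set_zip_leftD[OF that] set_zip_rightD[OF that] .
      hence "c \<le> D" "k \<le> D" using ks cs by (auto simp: clists_def)
      thus ?thesis by arith
    qed
    thus ?thesis unfolding reduced_word_def by (auto intro!: arg_cong[of _ _ block_word])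
  qed
  finally show "sumL (block_word (zip cs ks)) [] =
      sumR (block_word (map (\<lambda>(c, k). (D - k, D - c)) (zip cs ks))) []"
    by (simp add: sumR_reduced_word)
qed

end

end

section \<open>Potentials along a maximal Dyck path\<close>

lemma ppath_snoc: "ppath \<rho> \<sigma> w s t \<Longrightarrow> pstep \<rho> \<sigma> x t t' \<Longrightarrow> ppath \<rho> \<sigma> (w @ [x]) s t'"
  unfolding ppath_append ppath.simps by blast

lemma ppath_opens:
  assumes "\<And>j. j < n \<Longrightarrow> 0 \<le> l + real j * \<sigma> \<and> l + real j * \<sigma> < 1" "1 \<le> r"
  shows "ppath \<rho> \<sigma> (replicate n Opn) (l, r) (l + real n * \<sigma>, r)"
  using assms(1)
proof (induction n)
  case (Suc n)
  have "pstep \<rho> \<sigma> Opn (l + real n * \<sigma>, r) (l + real (Suc n) * \<sigma>, r)"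
    using Suc.prems[of n] assms(2) by (intro pstep.intros) (simp_all add: algebra_simps)
  moreover have "ppath \<rho> \<sigma> (replicate n Opn) (l, r) (l + real n * \<sigma>, r)"
    using Suc by simp
  ultimately have "ppath \<rho> \<sigma> (replicate n Opn @ [Opn]) (l, r) (l + real (Suc n) * \<sigma>, r)"
    by (rule ppath_snoc[rotated])
  thus ?case by (simp add: replicate_append_same)
qed simp

lemma ppath_closes:
  assumes "\<And>j. j \<le> n \<Longrightarrow> 1 \<le> j \<Longrightarrow> 0 \<le> r - real j * \<rho> \<and> r - real j * \<rho> < 1" "1 \<le> l'" "0 < n"
    "r + \<rho> \<le> r0 + \<rho>"
  shows "ppath \<rho> \<sigma> (replicate n Cls) (l, r0) (l', r - real n * \<rho>)"
  using assms(1,3)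
proof (induction n)
  case (Suc n)
  show ?case
  proof (cases "n = 0")
    case True
    thus ?thesis using assms(2,4) Suc.prems(1)[of 1] by (auto intro!: pstep.intros)
  next
    case False
    have "pstep \<rho> \<sigma> Cls (l', r - real n * \<rho>) (l', r - real (Suc n) * \<rho>)"
      using Suc.prems(1)[of "Suc n"] assms(2) by (intro pstep.intros) (simp_all add: algebra_simps)
    moreover have "ppath \<rho> \<sigma> (replicate n Cls) (l, r0) (l', r - real n * \<rho>)"
      using Suc False by simp
    ultimately have "ppath \<rho> \<sigma> (replicate n Cls @ [Cls]) (l, r0) (l', r - real (Suc n) * \<rho>)"
      by (rule ppath_snoc[rotated])
    thus ?thesis by (simp add: replicate_append_same)
  qed
qed simp

text \<open>The first path has height \<open>f i\<close> after \<open>i\<close> columns; the second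
  has length \<open>D * i - f i\<close> at height \<open>i\<close>. The inequalities say that both
  stay within one unit step of diagonals of slope \<open>1 / \<rho>\<close> and
  \<open>\<sigma>\<close>.\<close>

locale slopes =
  fixes D :: nat and \<rho> \<sigma> :: real and n :: nat and f :: "nat \<Rightarrow> nat"
  assumes \<rho>: "0 < \<rho>" and \<sigma>: "0 < \<sigma>"
    and f_mono: "i < n \<Longrightarrow> f i \<le> f (Suc i)" and f_step: "i < n \<Longrightarrow> f (Suc i) \<le> f i + D"
    and f_le: "i \<le> n \<Longrightarrow> real (f i) * \<rho> \<le> i" and f_ge: "i \<le> n \<Longrightarrow> i < (real (f i) + 1) * \<rho>"
    and g_ge: "i \<le> n \<Longrightarrow> real i \<le> \<sigma> * (real D * i - f i)"
    and g_le: "i \<le> n \<Longrightarrow> \<sigma> * (real D * i - f i - 1) < real i"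
begin

text \<open>The extra 1 in the second component appears because the horizontal edge of a column
  precedes its vertical edges.\<close>

definition pot :: "nat \<Rightarrow> real \<times> real" where
  "pot i = (\<sigma> * (real D * i - f i) - i, real i + 1 - \<rho> * f i)"

text \<open>The reduced block traverses only part of the corresponding stretch of a path. The
  missing steps fit into the slack of \<open>pstep\<close>: at the \<open>Zed\<close> for opening
  brackets, at the first \<open>Cls\<close> for closing ones.\<close>

lemma ppath_block:
  assumes i: "i < n" and c: "c \<le> D" and k: "k = f (Suc i) - f i"
  shows "ppath \<rho> \<sigma> (replicate (c - k) Opn @ replicate (k - c) Cls @ [Zed]) (pot i) (pot (Suc i))"
proof -
  have k': "real (f (Suc i)) = real (f i) + real k" "k \<le> D"
    using f_mono[OF i] f_step[OF i] k by simp_all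
  have f: "real (f i) * \<rho> \<le> i" "i < (real (f i) + 1) * \<rho>"
    "(real (f i) + real k) * \<rho> \<le> real i + 1"
    using f_le[of i] f_ge[of i] f_le[of "Suc i"] i k' by simp_all
  have g: "real i \<le> \<sigma> * (real D * i - f i)"
    "real i + 1 \<le> \<sigma> * (real D * i - f i + (real D - k))"
    "\<sigma> * (real D * i - f i + (real D - k) - 1) < real i + 1"
    using g_ge[of i] g_ge[of "Suc i"] g_le[of "Suc i"] i k' by (simp_all add: algebra_simps)
  show ?thesis
  proof (cases "k \<le> c")
    case True
    let ?l = "fst (pot i)" and ?r = "snd (pot i)"
    have "ppath \<rho> \<sigma> (replicate (c - k) Opn) (?l, ?r) (?l + real (c - k) * \<sigma>, ?r)"
    proof (rule ppath_opens)
      fix j assume j: "j < c - k"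
      hence "real j \<le> real D - k - 1" using c by linarith
      hence "\<sigma> * real j \<le> \<sigma> * (real D - k - 1)" using \<sigma> by simp
      hence "?l + real j * \<sigma> < 1" using g unfolding pot_def by (simp add: algebra_simps)
      moreover have "0 \<le> ?l" "0 \<le> real j * \<sigma>" using g \<sigma> by (simp_all add: pot_def)
      ultimately show "0 \<le> ?l + real j * \<sigma> \<and> ?l + real j * \<sigma> < 1" by simp
    qed (use f in \<open>simp add: pot_def algebra_simps\<close>)
    moreover have "pstep \<rho> \<sigma> Zed (?l + real (c - k) * \<sigma>, ?r) (pot (Suc i))"
    proof -
      have "real (c - k) \<le> real D - k" using True c by linarith
      hence "\<sigma> * real (c - k) \<le> \<sigma> * (real D - k)" using \<sigma> by simp
      moreover have "0 \<le> \<rho> * k" using \<rho> by simp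
      ultimately show ?thesis
        unfolding pot_def by (intro pstep.intros) (simp_all add: k' algebra_simps)
    qed
    ultimately have "ppath \<rho> \<sigma> (replicate (c - k) Opn @ [Zed]) (?l, ?r) (pot (Suc i))"
      unfolding prod.collapse by (rule ppath_snoc)
    thus ?thesis using True by simp
  next
    case False
    \<comment> \<open>The potential as if the \<open>c\<close> cancelled vertical edges had been
      passed first; \<open>?l\<close> is already taken at the end of the row of the second path,
      where it is at least 1.\<close>
    let ?r = "real i + 1 - \<rho> * (real (f i) + c)"
    let ?l = "\<sigma> * (real D * i - f i + (real D - k)) - i"
    have "ppath \<rho> \<sigma> (replicate (k - c) Cls) (fst (pot i), snd (pot i)) (?l, ?r - real (k - c) * \<rho>)"
    proof (rule ppath_closes)
      fix j assume j: "j \<le> k - c" "1 \<le> j"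
      hence "real j + c \<le> k" "1 \<le> real j + c" by linarith+
      hence "\<rho> * (real j + c) \<le> \<rho> * k" "\<rho> * 1 \<le> \<rho> * (real j + c)" using \<rho> by (simp_all del: mult_1_right)
      thus "0 \<le> ?r - real j * \<rho> \<and> ?r - real j * \<rho> < 1"
        using f by (simp add: algebra_simps)
    next
      have "0 \<le> \<rho> * c" using \<rho> by simp
      thus "?r + \<rho> \<le> snd (pot i) + \<rho>" by (simp add: pot_def algebra_simps)
    qed (use False g in auto)
    moreover have "pstep \<rho> \<sigma> Zed (?l, ?r - real (k - c) * \<rho>) (pot (Suc i))"
      using False unfolding pot_def by (intro pstep.intros) (simp_all add: k' of_nat_diff algebra_simps)
    ultimately have "ppath \<rho> \<sigma> (replicate (k - c) Cls @ [Zed]) (pot i) (pot (Suc i))"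
      unfolding prod.collapse by (rule ppath_snoc)
    thus ?thesis using False by simp
  qed
qed

lemma ppath_reduced_word:
  "i + m = n \<Longrightarrow> length cs = m \<Longrightarrow> set cs \<subseteq> {..D} \<Longrightarrow>
   ppath \<rho> \<sigma> (reduced_word (zip cs (map (\<lambda>i. f (Suc i) - f i) [i..<n]))) (pot i) (pot n)"
proof (induction m arbitrary: i cs)
  case 0
  thus ?case by (simp add: reduced_word_def block_word_simps)
next
  case (Suc m)
  then obtain c cs' where cs: "cs = c # cs'" by (cases cs) auto
  let ?k = "f (Suc i) - f i"
  have "[i..<n] = i # [Suc i..<n]" using Suc.prems(1) by (simp add: upt_conv_Cons)
  hence w: "reduced_word (zip cs (map (\<lambda>i. f (Suc i) - f i) [i..<n])) =
      (replicate (c - ?k) Opn @ replicate (?k - c) Cls @ [Zed]) @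
      reduced_word (zip cs' (map (\<lambda>i. f (Suc i) - f i) [Suc i..<n]))"
    by (simp add: cs reduced_word_def block_word_simps)
  have "ppath \<rho> \<sigma> (replicate (c - ?k) Opn @ replicate (?k - c) Cls @ [Zed]) (pot i) (pot (Suc i))"
    using Suc.prems cs by (intro ppath_block) auto
  moreover have "ppath \<rho> \<sigma> (reduced_word (zip cs' (map (\<lambda>i. f (Suc i) - f i) [Suc i..<n])))
      (pot (Suc i)) (pot n)"
    using Suc.prems cs by (intro Suc.IH) auto
  ultimately show ?case unfolding w ppath_append by blast
qed

end

section \<open>Maximal Dyck paths as words\<close>

text \<open>Greedy form of maximality: the path goes North exactly when this does not cross the
  diagonal, which determines every step.\<close>

fun dyck_from :: "nat \<Rightarrow> nat \<Rightarrow> nat \<Rightarrow> nat \<Rightarrow> step list \<Rightarrow> bool" where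
  "dyck_from a1 a2 x y [] \<longleftrightarrow> True"
| "dyck_from a1 a2 x y (East # w) \<longleftrightarrow> x * a2 < Suc y * a1 \<and> dyck_from a1 a2 (Suc x) y w"
| "dyck_from a1 a2 x y (North # w) \<longleftrightarrow> Suc y * a1 \<le> x * a2 \<and> dyck_from a1 a2 x (Suc y) w"

lemma dyck_from_append:
  "dyck_from a1 a2 x y (u @ v) \<longleftrightarrow> dyck_from a1 a2 x y u \<and>
     dyck_from a1 a2 (x + count_list u East) (y + count_list u North) v"
proof (induction u arbitrary: x y)
  case (Cons s u)
  thus ?case by (cases s) simp_all
qed simp

lemma dyck_from_below:
  "dyck_from a1 a2 0 0 w \<Longrightarrow> count_list w North * a1 \<le> count_list w East * a2"
proof (induction w rule: rev_induct)
  case (snoc s w)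
  thus ?case by (cases s) (auto simp: dyck_from_append intro: order_trans)
qed simp

lemma count_steps: "count_list w East + count_list w North = length w"
proof (induction w)
  case (Cons s w)
  thus ?case by (cases s) auto
qed simp

lemma path_xy_simps:
  "path_x (u @ v) (length u) = count_list u East" "path_y (u @ v) (length u) = count_list u North"
  by (simp_all add: path_x_def path_y_def)

lemma count_split:
  "n < count_list w s \<Longrightarrow> \<exists>u v. w = u @ s # v \<and> count_list u s = n"
proof (induction w arbitrary: n)
  case (Cons t w)
  show ?case
  proof (cases "s = t \<and> n = 0")
    case True
    thus ?thesis by (intro exI[of _ "[]"] exI[of _ w]) simp
  next
    case False
    hence "(if s = t then n - 1 else n) < count_list w s"
      using Cons.prems by (auto split: if_splits)
    from Cons.IH[OF this] obtain u v
      where "w = u @ s # v" "count_list u s = (if s = t then n - 1 else n)" by blast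
    thus ?thesis using False by (intro exI[of _ "t # u"] exI[of _ v]) (auto split: if_splits)
  qed
qed simp

lemma dyck_from_maximal:
  assumes "dyck_from a1 a2 0 0 w" "count_list w East = a1" "count_list w North = a2"
  shows "is_maximal_dyck_path a1 a2 w"
  unfolding is_maximal_dyck_path_def
proof (intro conjI allI impI)
  fix i assume "i \<le> length w"
  have "dyck_from a1 a2 0 0 (take i w)"
    using assms(1) dyck_from_append[of a1 a2 0 0 "take i w" "drop i w"] by simp
  from dyck_from_below[OF this] show "\<not> above_diagonal a1 a2 (path_x w i) (path_y w i)"
    by (simp add: above_diagonal_def path_x_def path_y_def not_less)
next
  fix x y assume *: "x \<le> a1" "y \<le> a2" "above_path w x y"
  have "count_list u North < y" if "w = u @ v" "count_list u East = x" for u v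
    using *(3)[unfolded above_path_def, rule_format, of "length u"] that path_xy_simps[of u v] by simp
  note above = this
  show "above_diagonal a1 a2 x y"
  proof (cases "x < a1")
    case True
    then obtain u v where u: "w = u @ East # v" "count_list u East = x"
      using count_split[of x w East] assms by auto
    have "x * a2 < Suc (count_list u North) * a1"
      using assms(1) u by (simp add: dyck_from_append)
    also have "\<dots> \<le> y * a1" using above[OF u] by (intro mult_right_mono) auto
    finally show ?thesis by (simp add: above_diagonal_def)
  next
    case False
    thus ?thesis using above[of w "[]"] assms * by simp
  qed
qed (use assms in auto)

lemma maximal_step:
  assumes w: "is_maximal_dyck_path a1 a2 w" "w = u @ s # v"
    and y: "count_list u North < a2"
  shows "s = North \<longleftrightarrow> Suc (count_list u North) * a1 \<le> count_list u East * a2"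
proof -
  let ?x = "count_list u East" and ?y = "count_list u North"
  have below: "\<not> above_diagonal a1 a2 (path_x w i) (path_y w i)" if "i \<le> length w" for i
    using w(1) that unfolding is_maximal_dyck_path_def by blast
  show ?thesis
  proof (cases s)
    case North
    have "w = (u @ [s]) @ v" using w by simp
    with below[of "length (u @ [s])"] path_xy_simps[of "u @ [s]" v] North
    show ?thesis by (simp add: above_diagonal_def not_less)
  next
    case East
    \<comment> \<open>An East step leaves the current column, so the lattice point one above is
      strictly above the path and, by maximality, above the diagonal.\<close>
    have "path_y w i < Suc ?y" if "i \<le> length w" "path_x w i = ?x" for i
    proof (cases "i \<le> length u")
      case True
      have "u = take i u @ drop i u" by simp
      hence "?y = count_list (take i u) North + count_list (drop i u) North"
        by (metis count_list_append)
      thus ?thesis using True w(2) by (simp add: path_y_def)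
    next
      case False
      then obtain j where "i = Suc (length u + j)" by (metis add_Suc_right less_iff_Suc_add not_le)
      hence "path_x w i \<ge> Suc ?x" using w(2) East by (simp add: path_x_def)
      thus ?thesis using that by simp
    qed
    hence "above_path w ?x (Suc ?y)" unfolding above_path_def by blast
    moreover have "?x \<le> a1" using w unfolding is_maximal_dyck_path_def by auto
    ultimately have "above_diagonal a1 a2 ?x (Suc ?y)"
      using w(1) y unfolding is_maximal_dyck_path_def by (metis Suc_leI)
    thus ?thesis using East by (auto simp: above_diagonal_def)
  qed
qed

lemma maximal_dyck_path_unique:
  assumes w: "is_maximal_dyck_path a1 a2 w" and w': "is_maximal_dyck_path a1 a2 w'"
  shows "w = w'"
proof -
  have len: "length w = length w'"
    using w w' count_steps[of w] count_steps[of w'] unfolding is_maximal_dyck_path_def by simp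
  have "take i w = take i w'" if "i \<le> length w" for i
    using that
  proof (induction i)
    case (Suc i)
    let ?u = "take i w"
    have 1: "w = ?u @ w ! i # drop (Suc i) w" using Suc.prems by (simp add: id_take_nth_drop)
    have "w' = take i w' @ w' ! i # drop (Suc i) w'" using Suc.prems len by (simp add: id_take_nth_drop)
    hence 2: "w' = ?u @ w' ! i # drop (Suc i) w'" using Suc by simp
    have "w ! i = w' ! i"
    proof (cases "count_list ?u North < a2")
      case True
      from maximal_step[OF w 1 True] maximal_step[OF w' 2 True] show ?thesis
        by (cases "w ! i"; cases "w' ! i") auto
    next
      case False
      \<comment> \<open>All \<open>a2\<close> North steps have been used.\<close>
      have "w ! i = East" if "is_maximal_dyck_path a1 a2 w" "w = ?u @ w ! i # v" for w v
      proof (rule ccontr)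
        assume "w ! i \<noteq> East"
        hence "w ! i = North" by (cases "w ! i") auto
        hence "count_list w North > count_list ?u North"
          by (subst that(2)) simp
        thus False using False that(1) unfolding is_maximal_dyck_path_def by simp
      qed
      from this[OF w 1] this[OF w' 2] show ?thesis by simp
    qed
    thus ?case using Suc len by (simp add: take_Suc_conv_app_nth)
  qed simp
  from this[of "length w"] show ?thesis using len by simp
qed

lemma dyck_path_eqI:
  assumes "dyck_from a1 a2 0 0 w" "count_list w East = a1" "count_list w North = a2"
  shows "dyck_path a1 a2 = w"
  unfolding dyck_path_def
  by (rule the_equality) (use dyck_from_maximal[OF assms] maximal_dyck_path_unique in blast)+


lemma dyck_from_norths:
  "(y + k) * a1 \<le> x * a2 \<Longrightarrow> dyck_from a1 a2 x y (replicate k North)"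
proof (induction k arbitrary: y)
  case (Suc k)
  have "Suc y * a1 \<le> (y + Suc k) * a1" by (intro mult_right_mono) auto
  hence "Suc y * a1 \<le> x * a2" using Suc.prems by (rule order_trans)
  thus ?case using Suc.prems Suc.IH[of "Suc y"] by simp
qed simp

lemma dyck_from_easts:
  "x' * a2 < Suc y * a1 + a2 \<Longrightarrow> x + k \<le> x' \<Longrightarrow> dyck_from a1 a2 x y (replicate k East)"
proof (induction k arbitrary: x)
  case (Suc k)
  have "Suc x * a2 \<le> x' * a2" using Suc.prems by (intro mult_right_mono) auto
  hence "x * a2 + a2 < Suc y * a1 + a2" using Suc.prems(1) by simp
  hence "x * a2 < Suc y * a1" by simp
  thus ?case using Suc.prems Suc.IH[of "Suc x"] by simp
qed simp

lemma east_word_simps: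
  "east_word [] = []" "east_word (k # ks) = [East] @ replicate k North @ east_word ks"
  by (simp_all add: east_word_def)

lemma north_word_simps:
  "north_word D [] = []" "north_word D (k # ks) = replicate (D - k) East @ [North] @ north_word D ks"
  by (simp_all add: north_word_def)

lemma count_list_replicate: "count_list (replicate n x) y = (if x = y then n else 0)"
  by (induction n) auto

section \<open>Two Dyck paths sharing one sequence of column heights\<close>

locale christoffel =
  fixes n b D A :: nat
  assumes n: "0 < n" and A: "A + b = D * n" "0 < A"
begin

definition f :: "nat \<Rightarrow> nat" where "f i = i * b div n"

definition ks :: "nat list" where "ks = map (\<lambda>i. f (Suc i) - f i) [0..<n]"

lemma f_le: "f i * n \<le> i * b" and f_ge: "i * b < Suc (f i) * n"
  using n dividend_less_div_times[of n "i * b"] by (simp_all add: f_def div_times_less_eq_dividend)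

lemma f_mono: "f i \<le> f (Suc i)"
  unfolding f_def by (intro div_le_mono) simp

lemma f_step: "f (Suc i) \<le> f i + D"
proof -
  have "Suc i * b \<le> i * b + D * n" using A by simp
  hence "f (Suc i) \<le> (i * b + D * n) div n" unfolding f_def by (rule div_le_mono)
  thus ?thesis using n by (simp add: f_def)
qed

lemma f_bound: "f i \<le> D * i"
proof (induction i)
  case (Suc i)
  thus ?case using f_step[of i] by simp
qed (simp add: f_def)

lemma f_0: "f 0 = 0" and f_n: "f n = b"
  using n by (simp_all add: f_def)

lemma upt_Suc_Cons: "i + Suc m = n \<Longrightarrow> [i..<n] = i # [Suc i..<n]"
  by (simp add: upt_conv_Cons)

lemma east_word_from:
  "i + m = n \<Longrightarrow> dyck_from n b i (f i) (east_word (map (\<lambda>i. f (Suc i) - f i) [i..<n])) \<and>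
     count_list (east_word (map (\<lambda>i. f (Suc i) - f i) [i..<n])) East = m \<and>
     count_list (east_word (map (\<lambda>i. f (Suc i) - f i) [i..<n])) North + f i = f n"
proof (induction m arbitrary: i)
  case (Suc m)
  have "dyck_from n b (Suc i) (f i) (replicate (f (Suc i) - f i) North)"
    using f_mono[of i] f_le[of "Suc i"] by (intro dyck_from_norths) simp
  thus ?case
    using Suc.IH[of "Suc i"] Suc.prems f_ge[of i] f_mono[of i]
    by (simp add: upt_Suc_Cons east_word_simps dyck_from_append count_list_replicate)
qed (simp add: east_word_simps)

text \<open>The path to \<open>(A, n)\<close> reaches height \<open>i\<close> at the ceiling of
  \<open>i * A / n\<close>, and this is \<open>D * i - f i\<close> because
  \<open>A = D * n - b\<close>.\<close>

lemma north_word_from: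
  "i + m = n \<Longrightarrow> dyck_from A n (D * i - f i) i (north_word D (map (\<lambda>i. f (Suc i) - f i) [i..<n])) \<and>
     count_list (north_word D (map (\<lambda>i. f (Suc i) - f i) [i..<n])) East + (D * i - f i) = D * n - f n \<and>
     count_list (north_word D (map (\<lambda>i. f (Suc i) - f i) [i..<n])) North = m"
proof (induction m arbitrary: i)
  case (Suc m)
  let ?x = "D * i - f i" and ?x' = "D * Suc i - f (Suc i)" and ?k = "f (Suc i) - f i"
  have x: "?x + (D - ?k) = ?x'"
    using f_bound[of i] f_bound[of "Suc i"] f_mono[of i] f_step[of i] by simp
  have "?x' + f (Suc i) = D * Suc i" using f_bound[of "Suc i"] by simp
  hence "?x' * n + f (Suc i) * n = Suc i * (A + b)"
    by (metis A(1) add_mult_distrib mult.assoc mult.commute)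
  hence x': "?x' * n + f (Suc i) * n = Suc i * A + Suc i * b" by (simp only: distrib_left)
  have 1: "?x' * n < Suc i * A + n" using x' f_ge[of "Suc i"] by simp
  have 2: "Suc i * A \<le> ?x' * n" using x' f_le[of "Suc i"] by simp
  have "dyck_from A n ?x i (replicate (D - ?k) East)"
    using 1 x by (intro dyck_from_easts[of ?x']) simp_all
  thus ?case
    using Suc.IH[of "Suc i"] Suc.prems 2 x
    by (simp add: upt_Suc_Cons north_word_simps dyck_from_append count_list_replicate)
qed (simp add: north_word_simps)

lemma length_ks: "length ks = n"
  by (simp add: ks_def)

lemma ks_le: "set ks \<subseteq> {..D}"
proof -
  have "f (Suc i) - f i \<le> D" for i using f_step[of i] by simp
  thus ?thesis by (auto simp: ks_def)
qed

lemma dyck_path_east: "dyck_path n b = east_word ks"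
  using east_word_from[of 0 n] by (intro dyck_path_eqI) (auto simp: ks_def f_0 f_n)

lemma dyck_path_north: "dyck_path A n = north_word D ks"
  using north_word_from[of 0 n] A by (intro dyck_path_eqI) (auto simp: ks_def f_0 f_n)

text \<open>With the diagonal slopes \<open>\<rho> = n / b\<close> and
  \<open>\<sigma> = n / A\<close>, clearing denominators in \<open>d \<le> \<rho> + \<sigma>\<close>
  and using \<open>A + b = D * n\<close> gives exactly the quadratic hypothesis.\<close>

lemma potentials:
  assumes q: "d * D * n * b \<le> D * n\<^sup>2 + d * b\<^sup>2"
  shows "\<exists>\<rho> \<sigma>. real d \<le> \<rho> + \<sigma> \<and>
    (\<forall>cs\<in>clists D (length ks). \<exists>s t. ppath \<rho> \<sigma> (reduced_word (zip cs ks)) s t)"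
proof -
  \<comment> \<open>For \<open>b = 0\<close> the first path has no vertical edges, and any value
    exceeding \<open>n\<close> and at least \<open>d\<close> will do.\<close>
  define \<rho> where "\<rho> = (if b = 0 then real n + d + 1 else n / b)"
  define \<sigma> where "\<sigma> = real n / A"
  have A': "real A = real D * n - b" using A(1) by (metis add_diff_cancel_right' of_nat_add of_nat_mult)
  have r: "real (f i) * n \<le> i * b" "real i * b < (real (f i) + 1) * n" for i
    using f_le[of i] f_ge[of i]
    by (simp_all only: flip: of_nat_mult of_nat_Suc of_nat_le_iff[where ?'a = real] of_nat_less_iff[where ?'a = real])
       (simp_all add: algebra_simps)
  have f0: "f i = 0" if "b = 0" for i
    unfolding f_def using that by simp
  interpret slopes D \<rho> \<sigma> n f
  proof
    show "0 < \<rho>" "0 < \<sigma>" using n A by (simp_all add: \<rho>_def \<sigma>_def)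
    fix i
    show "f i \<le> f (Suc i)" "f (Suc i) \<le> f i + D" by (rule f_mono f_step)+
    show "real (f i) * \<rho> \<le> real i"
      using r(1)[of i] f0[of i] by (cases "b = 0") (simp_all add: \<rho>_def field_simps)
    show "i \<le> n \<Longrightarrow> real i < (real (f i) + 1) * \<rho>"
      using r(2)[of i] f0[of i] by (cases "b = 0") (simp_all add: \<rho>_def field_simps)
    have "real i * A \<le> n * (real D * i - f i)" "n * (real D * i - f i - 1) < real i * A"
      using r[of i] unfolding A' by (simp_all add: algebra_simps)
    thus "real i \<le> \<sigma> * (real D * i - f i)" "\<sigma> * (real D * i - f i - 1) < real i"
      using A(2) by (simp_all add: \<sigma>_def field_simps)
  qed
  have "real d \<le> \<rho> + \<sigma>"
  proof (cases "b = 0")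
    case True
    thus ?thesis using n by (simp add: \<rho>_def \<sigma>_def add_increasing2)
  next
    case False
    have "real (d * D * n * b) \<le> real (D * n\<^sup>2 + d * b\<^sup>2)" using q by (rule of_nat_mono)
    hence "real d * (real b * real A) \<le> real n * real A + real n * real b"
      unfolding A' by (simp add: algebra_simps power2_eq_square)
    hence "real d \<le> (real n * real A + real n * real b) / (real b * real A)" using False A(2) by (simp add: field_simps)
    also have "\<dots> = \<rho> + \<sigma>" using False A(2) by (simp add: \<rho>_def \<sigma>_def field_simps)
    finally show ?thesis .
  qed
  moreover have "\<exists>s t. ppath \<rho> \<sigma> (reduced_word (zip cs ks)) s t" if "cs \<in> clists D (length ks)" for cs
  proof -
    have "length cs = n" "set cs \<subseteq> {..D}" using that by (simp_all add: clists_def length_ks)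
    from ppath_reduced_word[OF _ this, of 0] show ?thesis unfolding ks_def by fastforce
  qed
  ultimately show ?thesis by blast
qed

end

section \<open>The dimension vectors\<close>

lemma a_vec_shift:
  "a_vec d1 d2 (Suc m) =
     (int d2 * fst (a_vec d2 d1 m) - snd (a_vec d2 d1 m), fst (a_vec d2 d1 m))"
proof (induction m rule: induct_nat_012)
  case (ge2 m)
  define e where "e = int (if odd (Suc m) then d1 else d2)"
  have 1: "a_vec d1 d2 (Suc (Suc (Suc m))) =
     (e * fst (a_vec d1 d2 (Suc (Suc m))) - fst (a_vec d1 d2 (Suc m)),
      e * snd (a_vec d1 d2 (Suc (Suc m))) - snd (a_vec d1 d2 (Suc m)))"
    by (subst a_vec.simps(3)) (simp add: e_def Let_def)
  have 2: "a_vec d2 d1 (Suc (Suc m)) =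
     (e * fst (a_vec d2 d1 (Suc m)) - fst (a_vec d2 d1 m),
      e * snd (a_vec d2 d1 (Suc m)) - snd (a_vec d2 d1 m))"
    by (subst a_vec.simps(3)) (simp add: e_def Let_def)
  show ?case unfolding 1 2 ge2 by (simp add: algebra_simps)
qed simp_all

text \<open>The form \<open>d1 * x^2 - d1 * d2 * x * y + d2 * y^2\<close> is preserved by
  \<open>a_vec_shift\<close> when \<open>d1\<close> and \<open>d2\<close> are exchanged along with
  it, and it is nonnegative at the initial vector \<open>(0, -1)\<close>.\<close>

lemma a_vec_quadratic:
  "int d1 * int d2 * fst (a_vec d1 d2 m) * snd (a_vec d1 d2 m)
     \<le> int d1 * (fst (a_vec d1 d2 m))\<^sup>2 + int d2 * (snd (a_vec d1 d2 m))\<^sup>2"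
proof (induction m arbitrary: d1 d2)
  case (Suc m)
  show ?case unfolding a_vec_shift using Suc[of d2 d1]
    by (simp add: algebra_simps power2_eq_square)
qed simp

text \<open>Positivity is not inductive by itself. It is strengthened by
  \<open>2 * a m \<le> e (m + 1) * a (m + 1)\<close> for the first coordinates \<open>a\<close>,
  which propagates because consecutive multipliers have product at least 4.\<close>

lemma a_vec_fst_pos:
  assumes "4 \<le> d1 * d2"
  shows "1 \<le> fst (a_vec d1 d2 (Suc m))"
proof -
  define e where "e m = int (if odd m then d2 else d1)" for m :: nat
  have e: "4 \<le> e (Suc m) * e m" "1 \<le> e m" for m
  proof -
    have "1 \<le> d1" "1 \<le> d2" using assms by (cases d1; cases d2; simp)+
    thus "1 \<le> e m" by (simp add: e_def)
    have "4 \<le> int d1 * int d2" using assms by (metis of_nat_le_iff of_nat_mult of_nat_numeral)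
    thus "4 \<le> e (Suc m) * e m" by (simp add: e_def mult.commute)
  qed
  have "1 \<le> fst (a_vec d1 d2 (Suc m)) \<and>
      2 * fst (a_vec d1 d2 m) \<le> e (Suc m) * fst (a_vec d1 d2 (Suc m))"
  proof (induction m)
    case (Suc m)
    let ?u = "fst (a_vec d1 d2 m)" and ?v = "fst (a_vec d1 d2 (Suc m))"
      and ?w = "fst (a_vec d1 d2 (Suc (Suc m)))"
    have "?w = e (Suc m) * ?v - ?u" by (simp add: e_def Let_def)
    hence w: "e (Suc m) * ?v \<le> 2 * ?w" using Suc by linarith
    have "1 * 1 \<le> e (Suc m) * ?v" using Suc e(2)[of "Suc m"] by (intro mult_mono) auto
    hence "1 \<le> ?w" using w by linarith
    moreover have "2 * ?v \<le> e (Suc (Suc m)) * ?w"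
    proof -
      have "4 * ?v \<le> e (Suc (Suc m)) * e (Suc m) * ?v"
        using Suc e(1)[of "Suc m"] by (intro mult_right_mono) auto
      also have "\<dots> \<le> e (Suc (Suc m)) * (2 * ?w)"
        unfolding mult.assoc using w e(2)[of "Suc (Suc m)"] by (intro mult_left_mono) auto
      finally show ?thesis by simp
    qed
    ultimately show ?case ..
  qed (simp add: e_def)
  thus ?thesis ..
qed

lemma a_vec_snd_nonneg:
  assumes "4 \<le> d1 * d2" "1 \<le> m"
  shows "0 \<le> snd (a_vec d1 d2 m)"
proof (cases "m = 1")
  case False
  then obtain n where m: "m = Suc (Suc n)" using assms(2) by (cases m rule: nat.exhaust; cases "m - 1") auto
  show ?thesis
    using a_vec_fst_pos[of d2 d1 n] assms(1) unfolding m a_vec_shift[of d1 d2 "Suc n"]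
    by (simp add: mult.commute)
qed simp

section \<open>Gradings as graded words\<close>

definition grade_word :: "step list \<Rightarrow> (nat \<Rightarrow> nat) \<Rightarrow> gword" where
  "grade_word w \<omega> = map (\<lambda>i. (w ! i, \<omega> (Suc i))) [0..<length w]"

lemma length_grade_word [simp]: "length (grade_word w \<omega>) = length w"
  by (simp add: grade_word_def)

lemma nth_grade_word [simp]: "i < length w \<Longrightarrow> grade_word w \<omega> ! i = (w ! i, \<omega> (Suc i))"
  by (simp add: grade_word_def)

text \<open>Edge numbers start at 1, so the edges \<open>i + 1, \<dots>, j\<close> are the letters at positions \<open>i, \<dots>, j - 1\<close>.\<close>

abbreviation factor :: "'b list \<Rightarrow> nat \<Rightarrow> nat \<Rightarrow> 'b list" where
  "factor g i j \<equiv> take (j - i) (drop i g)"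

lemma factor_Suc: "i \<le> j \<Longrightarrow> j < length g \<Longrightarrow> factor g i (Suc j) = factor g i j @ [g ! j]"
  by (simp add: Suc_diff_le take_Suc_conv_app_nth)

lemma edge_counts:
  assumes "i \<le> j" "j \<le> length w"
  shows "card ({Suc i..j} \<inter> V_edges w) = nV (factor (grade_word w \<omega>) i j)"
    and "card ({Suc i..j} \<inter> H_edges w) = nH (factor (grade_word w \<omega>) i j)"
    and "(\<Sum>e\<in>{Suc i..j} \<inter> V_edges w. \<omega> e) = sV (factor (grade_word w \<omega>) i j)"
    and "(\<Sum>e\<in>{Suc i..j} \<inter> H_edges w. \<omega> e) = sH (factor (grade_word w \<omega>) i j)"
proof -
  have "card ({Suc i..j} \<inter> V_edges w) = nV (factor (grade_word w \<omega>) i j) \<and>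
     card ({Suc i..j} \<inter> H_edges w) = nH (factor (grade_word w \<omega>) i j) \<and>
     (\<Sum>e\<in>{Suc i..j} \<inter> V_edges w. \<omega> e) = sV (factor (grade_word w \<omega>) i j) \<and>
     (\<Sum>e\<in>{Suc i..j} \<inter> H_edges w. \<omega> e) = sH (factor (grade_word w \<omega>) i j)"
    using assms
  proof (induction j rule: dec_induct)
    case (step j)
    have j: "{Suc i..Suc j} = insert (Suc j) {Suc i..j}" using step.hyps by auto
    have f: "factor (grade_word w \<omega>) i (Suc j) = factor (grade_word w \<omega>) i j @ [(w ! j, \<omega> (Suc j))]"
      using factor_Suc[of i j "grade_word w \<omega>"] step by simp
    have "Suc j \<in> edges w" using step.prems by (simp add: edges_def)
    hence "Suc j \<in> H_edges w \<longleftrightarrow> w ! j = East" "Suc j \<in> V_edges w \<longleftrightarrow> w ! j = North"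
      by (simp_all add: H_edges_def V_edges_def)
    thus ?case
      using step unfolding f j by (cases "w ! j") (simp_all add: Int_insert_left)
  qed simp
  thus "card ({Suc i..j} \<inter> V_edges w) = nV (factor (grade_word w \<omega>) i j)"
    "card ({Suc i..j} \<inter> H_edges w) = nH (factor (grade_word w \<omega>) i j)"
    "(\<Sum>e\<in>{Suc i..j} \<inter> V_edges w. \<omega> e) = sV (factor (grade_word w \<omega>) i j)"
    "(\<Sum>e\<in>{Suc i..j} \<inter> H_edges w. \<omega> e) = sH (factor (grade_word w \<omega>) i j)"
    by blast+
qed

text \<open>Each letter raises \<open>nV - sH\<close> by at most 1, so starting from 0 the value
  \<open>c\<close> cannot be passed without being attained; the empty prefix accounts for
  \<open>c = 0\<close>.\<close>

lemma covers_iff: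
  "covers c u \<longleftrightarrow> \<not> (\<exists>u1 u2. u = u1 @ u2 \<and> nV u1 = c + sH u1)"
proof
  assume no: "\<not> (\<exists>u1 u2. u = u1 @ u2 \<and> nV u1 = c + sH u1)"
  have "nV u1 < c + sH u1" if "u = u1 @ u2" for u1 u2
    using that
  proof (induction u1 arbitrary: u2 rule: rev_induct)
    case Nil
    thus ?case using no by (metis append_Nil gr0I nV.simps(1) sH.simps(1) add_0_right)
  next
    case (snoc x u1)
    obtain s a where x: "x = (s, a)" by force
    have 1: "nV u1 < c + sH u1" using snoc.IH[of "x # u2"] snoc.prems by simp
    have "nV (u1 @ [x]) \<noteq> c + sH (u1 @ [x])" using no snoc.prems by blast
    thus ?case using 1 x by (cases s) auto
  qed
  thus "covers c u" unfolding covers_def by blast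
qed (unfold covers_def, metis less_irrefl)

lemma reaches_iff:
  "reaches c u \<longleftrightarrow> \<not> (\<exists>u1 u2. u = u1 @ u2 \<and> nH u2 = c + sV u2)"
proof
  assume no: "\<not> (\<exists>u1 u2. u = u1 @ u2 \<and> nH u2 = c + sV u2)"
  have "nH u2 < c + sV u2" if "u = u1 @ u2" for u1 u2
    using that
  proof (induction u2 arbitrary: u1)
    case Nil
    thus ?case using no by (metis append_Nil2 gr0I nH.simps(1) sV.simps(1) add_0_right)
  next
    case (Cons x u2)
    obtain s a where x: "x = (s, a)" by force
    have 1: "nH u2 < c + sV u2" using Cons.IH[of "u1 @ [x]"] Cons.prems by simp
    have "nH (x # u2) \<noteq> c + sV (x # u2)" using no Cons.prems by blast
    thus ?case using 1 x by (cases s) auto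
  qed
  thus "reaches c u" unfolding reaches_def by blast
qed (unfold reaches_def, metis less_irrefl)

text \<open>HGC at \<open>e\<close> concerns the prefix of \<open>u\<close> up to \<open>e\<close>,
  with \<open>e = h\<close> for the empty one; VGC at \<open>e\<close> concerns the suffix from
  \<open>e\<close> on, with \<open>e = v\<close> for the empty one. The grade of the outer edge is
  split off each sum.\<close>

lemma compatible_pair:
  fixes \<omega> :: "nat \<Rightarrow> nat"
  assumes h: "h \<in> H_edges w" and v: "v \<in> V_edges w" and hv: "h < v"
  defines "u \<equiv> factor (grade_word w \<omega>) h (v - 1)"
  shows "(\<exists>e\<in>{h..v}.
      e \<noteq> v \<and> card ({h..e} \<inter> V_edges w) = (\<Sum>h'\<in>{h..e} \<inter> H_edges w. \<omega> h') \<or>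
      e \<noteq> h \<and> card ({e..v} \<inter> H_edges w) = (\<Sum>v'\<in>{e..v} \<inter> V_edges w. \<omega> v')) \<longleftrightarrow>
    \<not> (covers (\<omega> h) u \<and> reaches (\<omega> v) u)"
proof -
  let ?g = "grade_word w \<omega>"
  have hw: "1 \<le> h" "v \<le> length w" "w ! (h - 1) = East" "w ! (v - 1) = North"
    using h v by (auto simp: H_edges_def V_edges_def edges_def)
  have len: "length u = v - 1 - h" using hw hv by (simp add: u_def)
  have A: "(\<exists>e\<in>{h..v}. e \<noteq> v \<and> card ({h..e} \<inter> V_edges w) = (\<Sum>h'\<in>{h..e} \<inter> H_edges w. \<omega> h'))
     \<longleftrightarrow> (\<exists>u1 u2. u = u1 @ u2 \<and> nV u1 = \<omega> h + sH u1)"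
  proof -
    have "card ({h..e} \<inter> V_edges w) = nV (take (e - h) u) \<and>
       (\<Sum>h'\<in>{h..e} \<inter> H_edges w. \<omega> h') = \<omega> h + sH (take (e - h) u)" if "h \<le> e" "e < v" for e
    proof -
      have "factor ?g (h - 1) e = (East, \<omega> h) # factor ?g h e"
      proof -
        have "drop (h - 1) ?g = ?g ! (h - 1) # drop h ?g"
          using Cons_nth_drop_Suc[of "h - 1" ?g] hw hv by simp
        moreover have "e - (h - 1) = Suc (e - h)" using that hw by simp
        ultimately show ?thesis using hw hv by simp
      qed
      moreover have "factor ?g h e = take (e - h) u"
        using that by (simp add: u_def min_def)
      moreover have "Suc (h - 1) = h" "h - 1 \<le> e" "e \<le> length w" using hw that by simp_all
      ultimately show ?thesis
        using edge_counts(1)[of "h - 1" e w \<omega>] edge_counts(4)[of "h - 1" e w \<omega>] by simp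
    qed
    note count = this
    show ?thesis
    proof
      assume "\<exists>e\<in>{h..v}. e \<noteq> v \<and> card ({h..e} \<inter> V_edges w) = (\<Sum>h'\<in>{h..e} \<inter> H_edges w. \<omega> h')"
      then obtain e where e': "e \<in> {h..v}" "e \<noteq> v"
        "card ({h..e} \<inter> V_edges w) = (\<Sum>h'\<in>{h..e} \<inter> H_edges w. \<omega> h')" by blast
      hence e: "h \<le> e" "e < v" by auto
      from e' have "nV (take (e - h) u) = \<omega> h + sH (take (e - h) u)" using count[OF e(1,2)] by simp
      thus "\<exists>u1 u2. u = u1 @ u2 \<and> nV u1 = \<omega> h + sH u1" by (metis append_take_drop_id)
    next
      assume "\<exists>u1 u2. u = u1 @ u2 \<and> nV u1 = \<omega> h + sH u1"
      then obtain u1 u2 where u: "u = u1 @ u2" "nV u1 = \<omega> h + sH u1" by blast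
      let ?e = "h + length u1"
      have e: "h \<le> ?e" "?e < v" using len u(1) hv by simp_all
      have "take (?e - h) u = u1" using u(1) by simp
      thus "\<exists>e\<in>{h..v}. e \<noteq> v \<and> card ({h..e} \<inter> V_edges w) = (\<Sum>h'\<in>{h..e} \<inter> H_edges w. \<omega> h')"
        using count[OF e] u(2) e by (intro bexI[of _ ?e]) auto
    qed
  qed
  have B: "(\<exists>e\<in>{h..v}. e \<noteq> h \<and> card ({e..v} \<inter> H_edges w) = (\<Sum>v'\<in>{e..v} \<inter> V_edges w. \<omega> v'))
     \<longleftrightarrow> (\<exists>u1 u2. u = u1 @ u2 \<and> nH u2 = \<omega> v + sV u2)"
  proof -
    have "card ({e..v} \<inter> H_edges w) = nH (drop (e - 1 - h) u) \<and>
       (\<Sum>v'\<in>{e..v} \<inter> V_edges w. \<omega> v') = \<omega> v + sV (drop (e - 1 - h) u)" if "h < e" "e \<le> v" for e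
    proof -
      have "factor ?g (e - 1) v = factor ?g (e - 1) (v - 1) @ [(North, \<omega> v)]"
        using factor_Suc[of "e - 1" "v - 1" ?g] hw hv that by simp
      moreover have "factor ?g (e - 1) (v - 1) = drop (e - 1 - h) u"
        using that by (simp add: u_def drop_take)
      moreover have "Suc (e - 1) = e" "e - 1 \<le> v" using that by simp_all
      ultimately show ?thesis
        using edge_counts(2)[of "e - 1" v w \<omega>] edge_counts(3)[of "e - 1" v w \<omega>] hw by simp
    qed
    note count = this
    show ?thesis
    proof
      assume "\<exists>e\<in>{h..v}. e \<noteq> h \<and> card ({e..v} \<inter> H_edges w) = (\<Sum>v'\<in>{e..v} \<inter> V_edges w. \<omega> v')"
      then obtain e where e': "e \<in> {h..v}" "e \<noteq> h"
        "card ({e..v} \<inter> H_edges w) = (\<Sum>v'\<in>{e..v} \<inter> V_edges w. \<omega> v')" by blast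
      hence e: "h < e" "e \<le> v" by auto
      from e' have "nH (drop (e - 1 - h) u) = \<omega> v + sV (drop (e - 1 - h) u)" using count[OF e(1,2)] by simp
      thus "\<exists>u1 u2. u = u1 @ u2 \<and> nH u2 = \<omega> v + sV u2" by (metis append_take_drop_id)
    next
      assume "\<exists>u1 u2. u = u1 @ u2 \<and> nH u2 = \<omega> v + sV u2"
      then obtain u1 u2 where u: "u = u1 @ u2" "nH u2 = \<omega> v + sV u2" by blast
      let ?e = "Suc (h + length u1)"
      have e: "h < ?e" "?e \<le> v" using len u(1) hv by simp_all
      have "drop (?e - 1 - h) u = u2" using u(1) by simp
      thus "\<exists>e\<in>{h..v}. e \<noteq> h \<and> card ({e..v} \<inter> H_edges w) = (\<Sum>v'\<in>{e..v} \<inter> V_edges w. \<omega> v')"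
        using count[OF e] u(2) e by (intro bexI[of _ ?e]) auto
    qed
  qed
  show ?thesis unfolding bex_disj_distrib A B covers_iff reaches_iff by blast
qed

lemma compatible_iff: "compatible w \<omega> \<longleftrightarrow> compat_word (grade_word w \<omega>)"
proof
  let ?g = "grade_word w \<omega>"
  assume c: "compatible w \<omega>"
  show "compat_word ?g"
    unfolding compat_word_def
  proof (intro allI impI)
    fix a c u x r assume g: "?g = a @ (East, c) # u @ (North, x) # r"
    let ?h = "Suc (length a)" and ?v = "length a + length u + 2"
    have len: "length w = length a + length u + 2 + length r"
      using arg_cong[OF g, of length] by simp
    have n1: "?g ! length a = (East, c)" unfolding g by (simp add: nth_append)
    have n2: "?g ! (length a + length u + 1) = (North, x)" unfolding g by (simp add: nth_append)
    have "w ! length a = East" "\<omega> ?h = c" using n1 len by simp_all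
    moreover have "w ! (length a + length u + 1) = North" "\<omega> ?v = x" using n2 len by simp_all
    moreover have "factor ?g ?h (?v - 1) = u" unfolding g by simp
    ultimately show "\<not> (covers c u \<and> reaches x u)"
      using compatible_pair[of ?h w ?v \<omega>] c len
      by (simp add: compatible_def H_edges_def V_edges_def edges_def)
  qed
next
  let ?g = "grade_word w \<omega>"
  assume c: "compat_word ?g"
  show "compatible w \<omega>"
    unfolding compatible_def
  proof (intro ballI impI)
    fix h v assume h: "h \<in> H_edges w" and v: "v \<in> V_edges w" and hv: "h < v"
    have hw: "1 \<le> h" "v \<le> length w" "w ! (h - 1) = East" "w ! (v - 1) = North"
      using h v by (auto simp: H_edges_def V_edges_def edges_def)
    have "?g = take (h - 1) ?g @ ?g ! (h - 1) # drop h ?g"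
      using id_take_nth_drop[of "h - 1" ?g] hw hv by simp
    also have "drop h ?g = factor ?g h (v - 1) @ drop (v - 1) ?g"
      using append_take_drop_id[of "v - 1 - h" "drop h ?g"] hv by simp
    also have "drop (v - 1) ?g = ?g ! (v - 1) # drop v ?g"
      using Cons_nth_drop_Suc[of "v - 1" ?g] hw hv by simp
    finally have "?g = take (h - 1) ?g @ (East, \<omega> h) # factor ?g h (v - 1) @ (North, \<omega> v) # drop v ?g"
      using hw hv by simp
    hence "\<not> (covers (\<omega> h) (factor ?g h (v - 1)) \<and> reaches (\<omega> v) (factor ?g h (v - 1)))"
      using c unfolding compat_word_def by blast
    thus "\<exists>e\<in>{h..v}.
      e \<noteq> v \<and> card ({h..e} \<inter> V_edges w) = (\<Sum>h'\<in>{h..e} \<inter> H_edges w. \<omega> h') \<or>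
      e \<noteq> h \<and> card ({e..v} \<inter> H_edges w) = (\<Sum>v'\<in>{e..v} \<inter> V_edges w. \<omega> v')"
      unfolding compatible_pair[OF h v hv] .
  qed
qed

section \<open>The sum over gradings as a sum over graded words\<close>

fun edge_wt :: "('k::field \<Rightarrow> 'a::division_ring) \<Rightarrow> 'a \<Rightarrow> 'a \<Rightarrow> 'k poly \<Rightarrow> 'k poly \<Rightarrow> step \<times> nat \<Rightarrow> 'a" where
  "edge_wt \<kappa> X Y P1 P2 (East, a) = \<kappa> (coeff P1 a) * Y ^ a * inverse X"
| "edge_wt \<kappa> X Y P1 P2 (North, a) =
     \<kappa> (coeff P2 (degree P2 - a)) * X ^ (a + 1) * inverse Y * inverse X"

lemma bounded_iff:
  "bounded_grading d1 d2 w \<omega> \<longleftrightarrow> grade_word w \<omega> \<in> glists (step_bound d1 d2) w"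
proof -
  have "map fst (grade_word w \<omega>) = w" by (simp add: grade_word_def map_nth comp_def)
  hence "grade_word w \<omega> \<in> glists (step_bound d1 d2) w \<longleftrightarrow>
      (\<forall>i<length w. \<omega> (Suc i) \<le> step_bound d1 d2 (w ! i))"
    by (auto simp: glists_def grade_word_def)
  also have "\<dots> \<longleftrightarrow> (\<forall>e\<in>edges w. \<omega> e \<le> step_bound d1 d2 (w ! (e - 1)))"
  proof (intro iffI ballI allI impI)
    fix e assume *: "\<forall>i<length w. \<omega> (Suc i) \<le> step_bound d1 d2 (w ! i)" and "e \<in> edges w"
    hence "e = Suc (e - 1)" "e - 1 < length w" by (auto simp: edges_def)
    thus "\<omega> e \<le> step_bound d1 d2 (w ! (e - 1))" using * by metis
  next
    fix i assume *: "\<forall>e\<in>edges w. \<omega> e \<le> step_bound d1 d2 (w ! (e - 1))" and "i < length w"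
    thus "\<omega> (Suc i) \<le> step_bound d1 d2 (w ! i)" using bspec[OF *, of "Suc i"] by (simp add: edges_def)
  qed
  also have "\<dots> \<longleftrightarrow> bounded_grading d1 d2 w \<omega>"
  proof (intro iffI ballI)
    fix e assume "bounded_grading d1 d2 w \<omega>" "e \<in> edges w"
    thus "\<omega> e \<le> step_bound d1 d2 (w ! (e - 1))"
      by (cases "w ! (e - 1)") (simp_all add: bounded_grading_def H_edges_def V_edges_def)
  next
    assume "\<forall>e\<in>edges w. \<omega> e \<le> step_bound d1 d2 (w ! (e - 1))"
    thus "bounded_grading d1 d2 w \<omega>"
      unfolding bounded_grading_def H_edges_def V_edges_def by fastforce
  qed
  finally show ?thesis ..
qed

lemma Y_dyck_glists:
  "Y_dyck \<kappa> X Y P1 P2 w = (\<Sum>g\<in>glists (step_bound (degree P1) (degree P2)) w.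
     if compat_word g then prod_list (map (edge_wt \<kappa> X Y P1 P2) g) else 0)"
proof -
  let ?G = "glists (step_bound (degree P1) (degree P2)) w"
  \<comment> \<open>The inverse of \<open>grade_word w\<close>; restriction makes the grading
    extensional, as \<open>gradings\<close> demands.\<close>
  let ?wd = "\<lambda>g. restrict (\<lambda>e. snd (g ! (e - 1))) (edges w)"
  have fin: "finite ?G" by (induction w) (simp_all add: glists_Nil glists_Cons)
  have wt: "prod_list (map (wt \<kappa> X Y P1 P2 w \<omega>) [1..<length w + 1]) =
     prod_list (map (edge_wt \<kappa> X Y P1 P2) (grade_word w \<omega>))" for \<omega>
  proof -
    have "map (wt \<kappa> X Y P1 P2 w \<omega>) [1..<length w + 1] =
        map (\<lambda>i. wt \<kappa> X Y P1 P2 w \<omega> (Suc i)) [0..<length w]"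
    proof -
      have "[1..<length w + 1] = map Suc [0..<length w]" by (simp add: map_Suc_upt del: upt_Suc)
      thus ?thesis by (simp only: map_map comp_def)
    qed
    also have "\<dots> = map (edge_wt \<kappa> X Y P1 P2) (grade_word w \<omega>)"
      unfolding grade_word_def map_map
    proof (rule map_cong[OF refl])
      fix i assume "i \<in> set [0..<length w]"
      thus "wt \<kappa> X Y P1 P2 w \<omega> (Suc i) = (edge_wt \<kappa> X Y P1 P2 \<circ> (\<lambda>i. (w ! i, \<omega> (Suc i)))) i"
        by (cases "w ! i") (simp_all add: wt_def H_edges_def edges_def)
    qed
    finally show ?thesis by simp
  qed
  have "Y_dyck \<kappa> X Y P1 P2 w =
      (\<Sum>g\<in>{g \<in> ?G. compat_word g}. prod_list (map (edge_wt \<kappa> X Y P1 P2) g))"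
    unfolding Y_dyck_def
  proof (rule sum.reindex_bij_witness[where j = "grade_word w" and i = ?wd])
    fix \<omega> assume \<omega>: "\<omega> \<in> gradings (degree P1) (degree P2) w"
    show "?wd (grade_word w \<omega>) = \<omega>"
    proof
      fix e show "?wd (grade_word w \<omega>) e = \<omega> e"
        using \<omega> by (cases "e \<in> edges w") (auto simp: gradings_def edges_def)
    qed
    show "grade_word w \<omega> \<in> {g \<in> ?G. compat_word g}"
      using \<omega> by (simp add: gradings_def bounded_iff compatible_iff)
    show "prod_list (map (edge_wt \<kappa> X Y P1 P2) (grade_word w \<omega>)) =
        prod_list (map (wt \<kappa> X Y P1 P2 w \<omega>) [1..<length w + 1])"
      by (rule wt[symmetric])
  next
    fix g assume g: "g \<in> {g \<in> ?G. compat_word g}"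
    hence m: "map fst g = w" by (simp add: glists_def)
    hence len: "length g = length w" by (metis length_map)
    show *: "grade_word w (?wd g) = g"
    proof (rule nth_equalityI)
      fix i assume i: "i < length (grade_word w (?wd g))"
      have "w ! i = fst (g ! i)" using m i len by (metis length_grade_word nth_map)
      thus "grade_word w (?wd g) ! i = g ! i" using i by (simp add: edges_def)
    qed (simp add: len)
    show "?wd g \<in> gradings (degree P1) (degree P2) w"
      using g unfolding gradings_def bounded_iff compatible_iff mem_Collect_eq * by auto
  qed
  thus ?thesis using fin by (simp add: sum.If_cases Int_def)
qed

section \<open>The recursion for the elements \<open>Y_elem\<close>\<close>

lemma upto_shift: "[i + 1..j + 1] = map (\<lambda>k. k + 1) [i..j]" for i j :: int
  by (rule nth_equalityI) (simp_all add: nth_upto)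

text \<open>Dropping the first polynomial gives the sequence started from \<open>P2\<close> and the
  reversal of \<open>P1\<close>; reversing twice returns \<open>P1\<close> because its constant
  coefficient is nonzero.\<close>

lemma P_seq_shift:
  assumes "coeff P1 0 \<noteq> 0"
  shows "P_seq P1 P2 (k + 1) = P_seq P2 (reflect_poly P1) k"
proof -
  have "k mod 4 = 0 \<or> k mod 4 = 1 \<or> k mod 4 = 2 \<or> k mod 4 = 3" by presburger
  moreover have "k mod 4 = 0 \<Longrightarrow> (k + 1) mod 4 = 1" "k mod 4 = 1 \<Longrightarrow> (k + 1) mod 4 = 2"
    "k mod 4 = 2 \<Longrightarrow> (k + 1) mod 4 = 3" "k mod 4 = 3 \<Longrightarrow> (k + 1) mod 4 = 0" by presburger+
  ultimately show ?thesis using assms by (auto simp: P_seq_def)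
qed

lemma Y_elem_Suc:
  assumes "coeff P1 0 \<noteq> 0"
  shows "Y_elem \<kappa> X Y P1 P2 (Suc m) = aut_F \<kappa> X Y P1 (Y_elem \<kappa> X Y P2 (reflect_poly P1) m)"
proof -
  have "[1..int (Suc m)] = 1 # map (\<lambda>k. k + 1) [1..int m]"
    using upto_shift[of 1 "int m"] by (simp add: upto_rec1 add.commute)
  thus ?thesis
    by (simp add: Y_elem_def foldr_map comp_def P_seq_shift[OF assms]) (simp add: P_seq_def)
qed

section \<open>The exchange step and the induction on m\<close>

locale exchange =
  fixes \<kappa> :: "'k::field_char_0 \<Rightarrow> 'a::division_ring" and X Y :: 'a and P1 P2 :: "'k poly"
  assumes K: "free_skew_field \<kappa> X Y"
    and lead: "lead_coeff P1 = 1" "lead_coeff P2 = 1"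
    and const: "coeff P1 0 = 1" "coeff P2 0 = 1"
begin

lemma scalar_embedding: "scalar_embedding \<kappa>"
  using K by (simp add: free_skew_field_def)

lemma P1_neq_0: "P1 \<noteq> 0"
  using lead by auto

sublocale kontsevich X Y "poly_at \<kappa> P1 Y * inverse X" "\<lambda>i. \<kappa> (coeff P1 i)" "degree P1"
proof
  show "X \<noteq> 0" "Y \<noteq> 0" by (rule free_nonzero[OF K])+
  thus "poly_at \<kappa> P1 Y * inverse X \<noteq> 0" using free_nonzero(4)[OF K P1_neq_0] by simp
  show "\<kappa> (coeff P1 i) * u = u * \<kappa> (coeff P1 i)" for i u by (rule scalar_rules(4)[OF scalar_embedding])
  show "\<kappa> (coeff P1 0) = 1" using scalar_rules(1)[OF scalar_embedding] const by simp
  show "\<kappa> (coeff P1 i) = 0" if "degree P1 < i" for i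
    using that scalar_zero[OF scalar_embedding] by (simp add: coeff_eq_0)
qed (simp add: poly_at_def sum_distrib_right)

abbreviation "q \<equiv> \<lambda>i. \<kappa> (coeff P2 i)"

lemma Y_dyck_edgeR: "Y_dyck \<kappa> X Y P1 P2 w = edgeR q (degree P2) w []"
proof -
  have "edge_wt \<kappa> X Y P1 P2 sa = weightR q (degree P2) sa" for sa
  proof (cases sa)
    case (Pair s a)
    thus ?thesis
      by (cases s) (simp_all add: y_def Z_def mult.assoc power_Suc2 del: power_Suc)
  qed
  hence "edge_wt \<kappa> X Y P1 P2 = weightR q (degree P2)" by (rule ext)
  thus ?thesis by (simp only: Y_dyck_glists edgeR_def runR_compat)
qed

abbreviation "F \<equiv> aut_F \<kappa> X Y P1"

lemma F_rules:
  "F (u + v) = F u + F v" "F (u * v) = F u * F v" "F (\<kappa> c) = \<kappa> c"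
  "F X = X * Y * inverse X" "F Y = poly_at \<kappa> P1 Y * inverse X"
  using aut_F_properties[OF K P1_neq_0] by (simp_all add: algebra_automorphism_def)

lemma F_0: "F 0 = 0" and F_1: "F 1 = 1"
  using F_rules(1)[of 0 0] F_rules(3)[of 1] scalar_rules(1)[OF scalar_embedding] by simp_all

lemma F_inverse: "u \<noteq> 0 \<Longrightarrow> F (inverse u) = inverse (F u)"
  using F_rules(2)[of u "inverse u"] F_1 by (simp add: inverse_unique)

lemma F_sum: "F (sum g S) = (\<Sum>x\<in>S. F (g x))"
  by (induction S rule: infinite_finite_induct) (simp_all add: F_0 F_rules)

lemma F_prod_list: "F (prod_list us) = prod_list (map F us)"
  by (induction us) (simp_all add: F_1 F_rules)

lemma F_power: "F (u ^ n) = F u ^ n"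
  by (induction n) (simp_all add: F_1 F_rules)

lemma inverse_Z: "inverse Z = X * Y * inverse X"
proof -
  have "Z * (X * Y * inverse X) = 1" by (simp add: Z_def mult.assoc)
  thus ?thesis by (rule inverse_unique)
qed

lemma inverse_Z_power: "inverse Z ^ n = X * Y ^ n * inverse X"
proof (induction n)
  case (Suc n)
  have "inverse Z ^ Suc n = inverse Z * (X * Y ^ n * inverse X)" by (simp only: power_Suc Suc)
  thus ?case by (simp add: inverse_Z mult.assoc)
qed simp

lemma F_inverse_X: "F (inverse X) = Z"
  using F_inverse[OF XY(1)] F_rules(4) inverse_Z by (metis inverse_inverse_eq)

text \<open>\<open>F\<close> sends \<open>inverse X\<close> to \<open>Z\<close> and \<open>Y\<close>
  to \<open>A\<close>, and the reversal of \<open>P1\<close> turns the complementary index of the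
  vertical coefficient back into \<open>a\<close>.\<close>

lemma F_edge_wt:
  assumes "a \<le> step_bound (degree P2) (degree P1) s"
  shows "F (edge_wt \<kappa> X Y P2 (reflect_poly P1) (s, a)) = weightL q (s, a)"
proof (cases s)
  case East
  thus ?thesis by (simp add: F_rules F_power F_inverse_X)
next
  case North
  hence "coeff (reflect_poly P1) (degree (reflect_poly P1) - a) = coeff P1 a"
    using assms const by (simp add: coeff_reflect_poly degree_reflect_poly_eq)
  hence "F (edge_wt \<kappa> X Y P2 (reflect_poly P1) (s, a)) =
      \<kappa> (coeff P1 a) * (inverse Z * inverse Z ^ a) * inverse (F Y) * Z"
    using North by (simp add: F_rules(1-4) F_power F_inverse_X F_inverse XY inverse_Z)
  also have "\<dots> = inverse Z * N a * Z"
    unfolding inverse_Z_power F_rules(5) N_def y_def by (simp add: mult.assoc) (simp only: p_left)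
  finally show ?thesis using North by simp
qed

lemma F_Y_dyck: "F (Y_dyck \<kappa> X Y P2 (reflect_poly P1) w) = edgeL q (degree P2) w []"
proof -
  have deg: "degree (reflect_poly P1) = degree P1" using const by (simp add: degree_reflect_poly_eq)
  show ?thesis
    unfolding Y_dyck_glists edgeL_def deg F_sum runL_compat
  proof (intro sum.cong refl)
    fix g assume "g \<in> glists (step_bound (degree P2) (degree P1)) w"
    hence "map F (map (edge_wt \<kappa> X Y P2 (reflect_poly P1)) g) = map (weightL q) g"
      by (auto simp: glists_def F_edge_wt)
    thus "F (if compat_word g then prod_list (map (edge_wt \<kappa> X Y P2 (reflect_poly P1)) g) else 0) =
        (if compat_word g then prod_list (map (weightL q) g) else 0)"
      by (simp add: F_prod_list F_0 del: map_map)
  qed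
qed

text \<open>By \<open>a_vec_shift\<close> the two endpoints have the form \<open>(n, b)\<close> and
  \<open>(d2 * n - b, n)\<close> required by \<open>christoffel\<close>, and
  \<open>a_vec_quadratic\<close> supplies the inequality for \<open>potentials\<close>.\<close>

lemma F_Y_dyck_path:
  assumes D: "degree P1 = d1" "degree P2 = d2" "4 \<le> d1 * d2" and m: "1 \<le> m"
  shows "F (Y_dyck \<kappa> X Y P2 (reflect_poly P1) (D_path d2 d1 m)) = Y_dyck \<kappa> X Y P1 P2 (D_path d1 d2 (Suc m))"
proof -
  define n where "n = nat (fst (a_vec d2 d1 m))"
  define b where "b = nat (snd (a_vec d2 d1 m))"
  define A' where "A' = nat (fst (a_vec d1 d2 (Suc m)))"
  obtain m' where m': "m = Suc m'" using m by (cases m) auto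
  have D': "4 \<le> d2 * d1" using D(3) by (simp only: mult.commute)
  have pos: "1 \<le> fst (a_vec d2 d1 m)" "0 \<le> snd (a_vec d2 d1 m)" "1 \<le> fst (a_vec d1 d2 (Suc m))"
    using a_vec_fst_pos[OF D', of m'] a_vec_snd_nonneg[OF D' m] a_vec_fst_pos[OF D(3), of m]
    unfolding m' by blast+
  hence i: "int n = fst (a_vec d2 d1 m)" "int b = snd (a_vec d2 d1 m)"
    "int A' = int d2 * fst (a_vec d2 d1 m) - snd (a_vec d2 d1 m)"
    by (simp_all add: n_def b_def A'_def a_vec_shift)
  interpret christoffel n b d2 A'
  proof
    show "0 < n" "0 < A'" using pos by (simp_all add: n_def A'_def)
    have "int (A' + b) = int (d2 * n)" by (simp add: i)
    thus "A' + b = d2 * n" by (simp only: of_nat_eq_iff)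
  qed
  have "int (d1 * d2 * n * b) \<le> int (d2 * n\<^sup>2 + d1 * b\<^sup>2)"
    using a_vec_quadratic[of d2 d1 m] by (simp add: i mult.commute)
  hence "d1 * d2 * n * b \<le> d2 * n\<^sup>2 + d1 * b\<^sup>2" by (simp only: of_nat_le_iff)
  then obtain \<rho> \<sigma> where pot: "real d1 \<le> \<rho> + \<sigma>"
    "\<And>cs. cs \<in> clists d2 (length ks) \<Longrightarrow> \<exists>s t. ppath \<rho> \<sigma> (reduced_word (zip cs ks)) s t"
    using potentials by meson
  have "D_path d2 d1 m = east_word ks"
    unfolding D_path_def n_def[symmetric] b_def[symmetric] by (rule dyck_path_east)
  moreover have "D_path d1 d2 (Suc m) = north_word d2 ks"
  proof -
    have "nat (snd (a_vec d1 d2 (Suc m))) = n" by (simp only: n_def a_vec_shift snd_conv)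
    thus ?thesis unfolding D_path_def A'_def[symmetric] by (simp only: dyck_path_north)
  qed
  moreover have "edgeL q d2 (east_word ks) [] = edgeR q d2 (north_word d2 ks) []"
    by (rule edgeL_eq_edgeR[OF _ ks_le])
       (use pot D scalar_rules(4)[OF scalar_embedding] in auto)
  ultimately show ?thesis unfolding F_Y_dyck Y_dyck_edgeR D by simp
qed

end

text \<open>The induction must vary the polynomials: the step passes from \<open>P1\<close>,
  \<open>P2\<close> to \<open>P2\<close>, \<open>reflect_poly P1\<close>, which exchanges the
  degrees and keeps the normalisation.\<close>

lemma Y_dyck_eq_Y_elem:
  fixes \<kappa> :: "'k::field_char_0 \<Rightarrow> 'a::division_ring"
  assumes "free_skew_field \<kappa> X Y"
    and "lead_coeff P1 = 1" "lead_coeff P2 = 1" "coeff P1 0 = 1" "coeff P2 0 = 1"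
    and "degree P1 = d1" "degree P2 = d2" "4 \<le> d1 * d2" "1 \<le> m"
  shows "Y_dyck \<kappa> X Y P1 P2 (D_path d1 d2 m) = Y_elem \<kappa> X Y P1 P2 m"
  using assms(9,2-8)
proof (induction m arbitrary: P1 P2 d1 d2 rule: dec_induct)
  case base
  interpret exchange \<kappa> X Y P1 P2 using assms(1) base by unfold_locales
  have "D_path d1 d2 1 = [East]"
    unfolding D_path_def by (simp, rule dyck_path_eqI) simp_all
  moreover have "Y_elem \<kappa> X Y P1 P2 1 = F Y" by (simp add: Y_elem_def P_seq_def)
  ultimately show ?case
    by (simp add: Y_dyck_edgeR edgeR_East edgeR_Nil sum_y F_rules)
next
  case (step m)
  interpret exchange \<kappa> X Y P1 P2 using assms(1) step.prems by unfold_locales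
  have "Y_dyck \<kappa> X Y P2 (reflect_poly P1) (D_path d2 d1 m) = Y_elem \<kappa> X Y P2 (reflect_poly P1) m"
    using step.prems by (intro step.IH) (simp_all add: degree_reflect_poly_eq coeff_reflect_poly mult.commute)
  thus ?case
    using F_Y_dyck_path[of d1 d2 m] step by (simp add: Y_elem_Suc)
qed

theorem theorem1p3:
  fixes \<kappa> :: "'k::field_char_0 \<Rightarrow> 'a::division_ring"
    and X Y :: 'a
    and P1 P2 :: "'k poly"
    and d1 d2 m :: nat
  assumes "free_skew_field \<kappa> X Y"
    and "lead_coeff P1 = 1" and "lead_coeff P2 = 1"
    and "degree P1 = d1" and "degree P2 = d2"
    and "poly P1 0 = 1" and "poly P2 0 = 1"
    and "d1 * d2 \<ge> 4"
    and "m \<ge> 1"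
  shows "Y_dyck \<kappa> X Y P1 P2 (D_path d1 d2 m) = Y_elem \<kappa> X Y P1 P2 m"
  using assms by (intro Y_dyck_eq_Y_elem) (simp_all add: poly_0_coeff_0)

end
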